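(* Let $F$ be a fragment of $L_{\omega_1\omega}(L)$ for a countable signature $L$, and let $T$ be an $F$-theory all of whose models are locally compact. Then the isomorphism relation $\cong_T$ on $\mathrm{Mod}(T)$ is classifiable by countable structures, i.e., there are a countable (classical, first-order) signature $L'$ and a Borel map $f$ from $\mathrm{Mod}(T)$ to the Polish space of countable $L'$-structures with universe $\mathbb N$ such that for all $M,N\in\mathrm{Mod}(T)$, $M\cong N$ iff $f(M)\cong f(N)$.
   Context: Continuous logic setting. A signature $L$ is a countable set of predicate symbols $P_0=d,P_1,\dots$ (function symbols are coded as predicates), each with an arity, a modulus of continuity and a compact bound interval. A metric structure is a complete metric space with interpretations of the predicates respecting the moduli and bounds. Formulas of $L_{\omega_1\omega}(L)$ are built from atomic formulas using $\phi+\psi$, $r\phi$ ($r\in\mathbb Q$), $\max$, the constant $1$, $\sup_x,\inf_x$, and countable suprema/infima of formulas with the same finite set of free variables respecting a common modulus and bound. A fragment is a countable set of formulas containing the atomic formulas and closed under finitary connectives, quantifiers, subformulas and substitution of terms for variables. A theory is a countable set of conditions $\phi=c$ with $\phi$ a sentence; it is an $F$-theory if its sentences are in $F$. $\mathrm{Mod}(L)$ is the Polish space of separable complete metric $L$-structures with a distinguished tail-dense sequence $(a_i)$, coded by the values $P_i^M(a_{j_0},\dots,a_{j_{n_i-1}})$ in $\prod_i\mathbb R^{\mathbb N^{n_i}}$ (product topology). $\mathrm{Mod}(T)\subseteq\mathrm{Mod}(L)$ is the set of models of $T$ with the induced Borel structure, and $\cong_T$ is the isomorphism relation on it. *)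

theory Defs
  imports "HOL-Analysis.Analysis"
begin

section \<open>Signatures and metric structures\<close>

text \<open>A modulus of continuity of arity \<open>n\<close> is a function on \<open>[0,\<infinity>)\<^sup>n\<close>; tuples are lists of
  length \<open>n\<close>, so values at other lists are irrelevant.\<close>

definition is_modulus :: "nat \<Rightarrow> (real list \<Rightarrow> real) \<Rightarrow> bool" where
  "is_modulus n \<Delta> \<longleftrightarrow>
     (\<forall>r. length r = n \<and> (\<forall>x\<in>set r. 0 \<le> x) \<longrightarrow> 0 \<le> \<Delta> r) \<and>
     \<Delta> (replicate n 0) = 0 \<and>
     (\<forall>r s. length r = n \<and> length s = n \<and> (\<forall>x\<in>set r. 0 \<le> x) \<and> (\<forall>x\<in>set s. 0 \<le> x) \<longrightarrow>
        \<Delta> r \<le> \<Delta> (map2 (+) r s) \<and> \<Delta> (map2 (+) r s) \<le> \<Delta> r + \<Delta> s) \<and>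
     continuous_map (product_topology (\<lambda>_. top_of_set {0..}) {..<n}) euclideanreal
       (\<lambda>r. \<Delta> (map r [0..<n]))"

text \<open>A countable signature is, up to renaming of symbols, one whose symbols are natural numbers.
  Symbol \<open>0\<close> is the metric. All symbols are predicates, so the only terms are variables.\<close>

record signature =
  symbols :: "nat set"
  arity :: "nat \<Rightarrow> nat"
  modulus :: "nat \<Rightarrow> real list \<Rightarrow> real"
  lower :: "nat \<Rightarrow> real"
  upper :: "nat \<Rightarrow> real"

definition is_signature :: "signature \<Rightarrow> bool" where
  "is_signature L \<longleftrightarrow>
     0 \<in> symbols L \<and> arity L 0 = 2 \<and>
     (\<forall>i\<in>symbols L. is_modulus (arity L i) (modulus L i) \<and> lower L i \<le> upper L i)"

record 'a mstruct =
  univ :: "'a set"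
  pred :: "nat \<Rightarrow> 'a list \<Rightarrow> real"

text \<open>The locale \<^locale>\<open>Metric_space\<close> demands symmetry and nonnegativity also off the carrier,
  hence the default value.\<close>

definition sdist :: "'a mstruct \<Rightarrow> 'a \<Rightarrow> 'a \<Rightarrow> real" where
  "sdist M x y = (if x \<in> univ M \<and> y \<in> univ M then pred M 0 [x, y] else 0)"

abbreviation structure_topology :: "'a mstruct \<Rightarrow> 'a topology" where
  "structure_topology M \<equiv> Metric_space.mtopology (univ M) (sdist M)"

definition is_structure :: "signature \<Rightarrow> 'a mstruct \<Rightarrow> bool" where
  "is_structure L M \<longleftrightarrow>
     univ M \<noteq> {} \<and>
     Metric_space (univ M) (sdist M) \<and>
     Metric_space.mcomplete (univ M) (sdist M) \<and>
     (\<forall>i\<in>symbols L. \<forall>xs ys.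
        set xs \<subseteq> univ M \<and> length xs = arity L i \<and> set ys \<subseteq> univ M \<and> length ys = arity L i \<longrightarrow>
          pred M i xs \<in> {lower L i..upper L i} \<and>
          \<bar>pred M i xs - pred M i ys\<bar> \<le> modulus L i (map2 (sdist M) xs ys))"

definition isomorphic :: "signature \<Rightarrow> 'a mstruct \<Rightarrow> 'b mstruct \<Rightarrow> bool" where
  "isomorphic L M N \<longleftrightarrow>
     (\<exists>h. bij_betw h (univ M) (univ N) \<and>
        (\<forall>i\<in>symbols L. \<forall>xs. set xs \<subseteq> univ M \<and> length xs = arity L i \<longrightarrow>
           pred N i (map h xs) = pred M i xs))"

section \<open>Formulas\<close>

text \<open>Variables are de Bruijn indices: \<open>Sup_q\<close> and \<open>Inf_q\<close> bind index \<open>0\<close> of their argument.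
  Renaming is then capture-avoiding, and \<open>sup\<^sub>x \<phi>\<close> is \<open>Sup_q\<close> applied to a renaming of \<open>\<phi>\<close>.\<close>

datatype fml =
    Atom nat "nat list"
  | One
  | Add fml fml
  | Scale rat fml
  | Maxi fml fml
  | Sup_q fml
  | Inf_q fml
  | Sup_c "nat \<Rightarrow> fml"
  | Inf_c "nat \<Rightarrow> fml"

primrec fv :: "fml \<Rightarrow> nat set" where
  "fv (Atom i xs) = set xs"
| "fv One = {}"
| "fv (Add \<phi> \<psi>) = fv \<phi> \<union> fv \<psi>"
| "fv (Scale q \<phi>) = fv \<phi>"
| "fv (Maxi \<phi> \<psi>) = fv \<phi> \<union> fv \<psi>"
| "fv (Sup_q \<phi>) = {v. Suc v \<in> fv \<phi>}"
| "fv (Inf_q \<phi>) = {v. Suc v \<in> fv \<phi>}"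
| "fv (Sup_c \<Phi>) = (\<Union>n. fv (\<Phi> n))"
| "fv (Inf_c \<Phi>) = (\<Union>n. fv (\<Phi> n))"

primrec rename :: "fml \<Rightarrow> (nat \<Rightarrow> nat) \<Rightarrow> fml" where
  "rename (Atom i xs) = (\<lambda>\<rho>. Atom i (map \<rho> xs))"
| "rename One = (\<lambda>\<rho>. One)"
| "rename (Add \<phi> \<psi>) = (\<lambda>\<rho>. Add (rename \<phi> \<rho>) (rename \<psi> \<rho>))"
| "rename (Scale q \<phi>) = (\<lambda>\<rho>. Scale q (rename \<phi> \<rho>))"
| "rename (Maxi \<phi> \<psi>) = (\<lambda>\<rho>. Maxi (rename \<phi> \<rho>) (rename \<psi> \<rho>))"
| "rename (Sup_q \<phi>) = (\<lambda>\<rho>. Sup_q (rename \<phi> (case_nat 0 (\<lambda>v. Suc (\<rho> v)))))"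
| "rename (Inf_q \<phi>) = (\<lambda>\<rho>. Inf_q (rename \<phi> (case_nat 0 (\<lambda>v. Suc (\<rho> v)))))"
| "rename (Sup_c \<Phi>) = (\<lambda>\<rho>. Sup_c (\<lambda>n. rename (\<Phi> n) \<rho>))"
| "rename (Inf_c \<Phi>) = (\<lambda>\<rho>. Inf_c (\<lambda>n. rename (\<Phi> n) \<rho>))"

primrec immediate_subfmls :: "fml \<Rightarrow> fml set" where
  "immediate_subfmls (Atom i xs) = {}"
| "immediate_subfmls One = {}"
| "immediate_subfmls (Add \<phi> \<psi>) = {\<phi>, \<psi>}"
| "immediate_subfmls (Scale q \<phi>) = {\<phi>}"
| "immediate_subfmls (Maxi \<phi> \<psi>) = {\<phi>, \<psi>}"
| "immediate_subfmls (Sup_q \<phi>) = {\<phi>}"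
| "immediate_subfmls (Inf_q \<phi>) = {\<phi>}"
| "immediate_subfmls (Sup_c \<Phi>) = range \<Phi>"
| "immediate_subfmls (Inf_c \<Phi>) = range \<Phi>"

primrec eval :: "'a mstruct \<Rightarrow> fml \<Rightarrow> (nat \<Rightarrow> 'a) \<Rightarrow> real" where
  "eval M (Atom i xs) = (\<lambda>\<sigma>. pred M i (map \<sigma> xs))"
| "eval M One = (\<lambda>\<sigma>. 1)"
| "eval M (Add \<phi> \<psi>) = (\<lambda>\<sigma>. eval M \<phi> \<sigma> + eval M \<psi> \<sigma>)"
| "eval M (Scale q \<phi>) = (\<lambda>\<sigma>. of_rat q * eval M \<phi> \<sigma>)"
| "eval M (Maxi \<phi> \<psi>) = (\<lambda>\<sigma>. max (eval M \<phi> \<sigma>) (eval M \<psi> \<sigma>))"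
| "eval M (Sup_q \<phi>) = (\<lambda>\<sigma>. SUP a\<in>univ M. eval M \<phi> (case_nat a \<sigma>))"
| "eval M (Inf_q \<phi>) = (\<lambda>\<sigma>. INF a\<in>univ M. eval M \<phi> (case_nat a \<sigma>))"
| "eval M (Sup_c \<Phi>) = (\<lambda>\<sigma>. SUP n. eval M (\<Phi> n) \<sigma>)"
| "eval M (Inf_c \<Phi>) = (\<lambda>\<sigma>. INF n. eval M (\<Phi> n) \<sigma>)"

text \<open>A formula respects a modulus (in its free variables, listed increasingly) and a bound if its
  interpretation in every structure does. Here and below, structures have their universe inside
  \<^typ>\<open>real\<close>: up to isomorphism this covers every structure of cardinality at most the continuum,
  in particular every separable one, and by the downward Loewenheim-Skolem theorem it is equivalent
  to consider structures of arbitrary cardinality.\<close>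

definition fml_respects :: "signature \<Rightarrow> (real list \<Rightarrow> real) \<Rightarrow> real \<Rightarrow> real \<Rightarrow> fml \<Rightarrow> bool" where
  "fml_respects L \<Delta> a b \<phi> \<longleftrightarrow>
     (\<forall>M :: real mstruct. is_structure L M \<longrightarrow>
        (\<forall>\<sigma> \<tau>. range \<sigma> \<subseteq> univ M \<and> range \<tau> \<subseteq> univ M \<longrightarrow>
           eval M \<phi> \<sigma> \<in> {a..b} \<and>
           \<bar>eval M \<phi> \<sigma> - eval M \<phi> \<tau>\<bar>
             \<le> \<Delta> (map (\<lambda>v. sdist M (\<sigma> v) (\<tau> v)) (sorted_list_of_set (fv \<phi>)))))"

definition uniform_family :: "signature \<Rightarrow> (nat \<Rightarrow> fml) \<Rightarrow> bool" where
  "uniform_family L \<Phi> \<longleftrightarrow>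
     (\<exists>V \<Delta> a b. finite V \<and> is_modulus (card V) \<Delta> \<and>
        (\<forall>n. fv (\<Phi> n) = V \<and> fml_respects L \<Delta> a b (\<Phi> n)))"

inductive is_formula :: "signature \<Rightarrow> fml \<Rightarrow> bool" for L where
  "i \<in> symbols L \<Longrightarrow> length xs = arity L i \<Longrightarrow> is_formula L (Atom i xs)"
| "is_formula L One"
| "is_formula L \<phi> \<Longrightarrow> is_formula L \<psi> \<Longrightarrow> is_formula L (Add \<phi> \<psi>)"
| "is_formula L \<phi> \<Longrightarrow> is_formula L (Scale q \<phi>)"
| "is_formula L \<phi> \<Longrightarrow> is_formula L \<psi> \<Longrightarrow> is_formula L (Maxi \<phi> \<psi>)"
| "is_formula L \<phi> \<Longrightarrow> is_formula L (Sup_q \<phi>)"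
| "is_formula L \<phi> \<Longrightarrow> is_formula L (Inf_q \<phi>)"
| "(\<And>n. is_formula L (\<Phi> n)) \<Longrightarrow> uniform_family L \<Phi> \<Longrightarrow> is_formula L (Sup_c \<Phi>)"
| "(\<And>n. is_formula L (\<Phi> n)) \<Longrightarrow> uniform_family L \<Phi> \<Longrightarrow> is_formula L (Inf_c \<Phi>)"

definition is_fragment :: "signature \<Rightarrow> fml set \<Rightarrow> bool" where
  "is_fragment L F \<longleftrightarrow>
     countable F \<and> (\<forall>\<phi>\<in>F. is_formula L \<phi>) \<and>
     (\<forall>i xs. i \<in> symbols L \<and> length xs = arity L i \<longrightarrow> Atom i xs \<in> F) \<and>
     One \<in> F \<and>
     (\<forall>\<phi>\<in>F. \<forall>\<psi>\<in>F. Add \<phi> \<psi> \<in> F \<and> Maxi \<phi> \<psi> \<in> F) \<and>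
     (\<forall>\<phi>\<in>F. \<forall>q. Scale q \<phi> \<in> F) \<and>
     (\<forall>\<phi>\<in>F. Sup_q \<phi> \<in> F \<and> Inf_q \<phi> \<in> F) \<and>
     (\<forall>\<phi>\<in>F. immediate_subfmls \<phi> \<subseteq> F) \<and>
     (\<forall>\<phi>\<in>F. \<forall>\<rho>. rename \<phi> \<rho> \<in> F)"

section \<open>Theories and the space of models\<close>

text \<open>The pair \<open>(\<phi>, c)\<close> stands for the condition \<open>\<phi> = c\<close>.\<close>

definition is_theory :: "fml set \<Rightarrow> (fml \<times> real) set \<Rightarrow> bool" where
  "is_theory F T \<longleftrightarrow> countable T \<and> (\<forall>(\<phi>, c)\<in>T. \<phi> \<in> F \<and> fv \<phi> = {})"

definition is_model :: "signature \<Rightarrow> (fml \<times> real) set \<Rightarrow> 'a mstruct \<Rightarrow> bool" where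
  "is_model L T M \<longleftrightarrow>
     is_structure L M \<and>
     (\<forall>(\<phi>, c)\<in>T. \<forall>\<sigma>. range \<sigma> \<subseteq> univ M \<longrightarrow> eval M \<phi> \<sigma> = c)"

definition tail_dense :: "'a mstruct \<Rightarrow> (nat \<Rightarrow> 'a) \<Rightarrow> bool" where
  "tail_dense M a \<longleftrightarrow> range a \<subseteq> univ M \<and> (\<forall>n. structure_topology M closure_of (a ` {n..}) = univ M)"

text \<open>The product of the spaces \<open>\<real>\<^sup>X\<close>, \<open>X = \<nat>\<close>-tuples of length \<open>arity L i\<close>, over the symbols \<open>i\<close>, is
  identified with the closed subspace of the Polish space \<^typ>\<open>nat \<Rightarrow> nat list \<Rightarrow> real\<close> of functions
  vanishing at all irrelevant arguments.\<close>

definition code :: "signature \<Rightarrow> 'a mstruct \<Rightarrow> (nat \<Rightarrow> 'a) \<Rightarrow> nat \<Rightarrow> nat list \<Rightarrow> real" where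
  "code L M a i js =
     (if i \<in> symbols L \<and> length js = arity L i then pred M i (map a js) else 0)"

definition Mod :: "signature \<Rightarrow> (fml \<times> real) set \<Rightarrow> (nat \<Rightarrow> nat list \<Rightarrow> real) set" where
  "Mod L T = {code L M a | (M :: real mstruct) a. is_model L T M \<and> tail_dense M a}"

text \<open>A code determines the structure up to isomorphism, so the choice of \<open>M\<close> and \<open>N\<close> is
  immaterial.\<close>

definition iso_codes ::
  "signature \<Rightarrow> (nat \<Rightarrow> nat list \<Rightarrow> real) \<Rightarrow> (nat \<Rightarrow> nat list \<Rightarrow> real) \<Rightarrow> bool" where
  "iso_codes L \<xi> \<eta> \<longleftrightarrow>
     (\<exists>(M :: real mstruct) a (N :: real mstruct) b.
        is_structure L M \<and> tail_dense M a \<and> \<xi> = code L M a \<and>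
        is_structure L N \<and> tail_dense N b \<and> \<eta> = code L N b \<and>
        isomorphic L M N)"

section \<open>Classical countable structures\<close>

record fo_signature =
  rel_symbols :: "nat set"
  rel_arity :: "nat \<Rightarrow> nat"
  fun_symbols :: "nat set"
  fun_arity :: "nat \<Rightarrow> nat"

text \<open>Structures with universe \<open>\<nat>\<close>, as a closed subspace of the countable power of discrete spaces,
  again with default values at irrelevant arguments. Constants are functions of arity \<open>0\<close>.\<close>

type_synonym fo_structure = "(nat \<Rightarrow> nat list \<Rightarrow> bool) \<times> (nat \<Rightarrow> nat list \<Rightarrow> nat)"

definition fo_structures :: "fo_signature \<Rightarrow> fo_structure set" where
  "fo_structures L' =
     {(R, f). (\<forall>i xs. \<not> (i \<in> rel_symbols L' \<and> length xs = rel_arity L' i) \<longrightarrow> \<not> R i xs) \<and>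
              (\<forall>i xs. \<not> (i \<in> fun_symbols L' \<and> length xs = fun_arity L' i) \<longrightarrow> f i xs = 0)}"

definition fo_isomorphic :: "fo_signature \<Rightarrow> fo_structure \<Rightarrow> fo_structure \<Rightarrow> bool" where
  "fo_isomorphic L' A B \<longleftrightarrow>
     (\<exists>h. bij h \<and>
        (\<forall>i\<in>rel_symbols L'. \<forall>xs. length xs = rel_arity L' i \<longrightarrow>
           fst B i (map h xs) = fst A i xs) \<and>
        (\<forall>i\<in>fun_symbols L'. \<forall>xs. length xs = fun_arity L' i \<longrightarrow>
           snd B i (map h xs) = h (snd A i xs)))"

definition classifiable_by_countable_structures ::
  "'a::topological_space set \<Rightarrow> ('a \<Rightarrow> 'a \<Rightarrow> bool) \<Rightarrow> bool" where
  "classifiable_by_countable_structures X E \<longleftrightarrow>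
     (\<exists>L' f. f \<in> restrict_space borel X \<rightarrow>\<^sub>M restrict_space borel (fo_structures L') \<and>
        (\<forall>x\<in>X. \<forall>y\<in>X. E x y \<longleftrightarrow> fo_isomorphic L' (f x) (f y)))"

end

theory Submission
  imports Defs
begin

text \<open>
  Let \<open>radius x \<le> 1\<close> be the
  supremum of the \<open>r\<close> for which the \<open>r\<close>-ball at \<open>x\<close> is totally bounded, and let \<open>W\<close> range over the
  countably many open sets of tuples defined by finitary formulas in the predicates and \<open>radius\<close>. A
  component of \<open>W\<close> is a class of tuples which can be joined inside \<open>W\<close> by steps that are small compared
  with \<open>radius\<close>. Components are open, so a separable structure has countably many. The components,
  labelled by the formula and related by ``every tuple of \<open>C\<close> is within \<open>e\<close> of a tuple of \<open>C'\<close> on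
  prescribed coordinates'', form a countable structure which does not depend on the dense sequence.

  An isomorphism between two such countable structures yields an isomorphism of the metric
  structures. By compactness of small balls, two tuples with the same finitary type can be extended
  to tuples with the same type by any nearby points. Hence exact type classes are homogeneous, and a
  property of a chain of steps around one tuple holds around all tuples of the class. Given a dense
  sequence \<open>a\<close>, this shows that the projections to the first \<open>j\<close> coordinates of the components of
  \<open>(a 0, \<dots>, a (n - 1))\<close> stabilise up to \<open>e\<close> for large \<open>n\<close>. Points chosen successively in the images of
  such components therefore converge to a sequence of the same type as \<open>a\<close> in the other structure. It
  is dense since balls below \<open>radius\<close> are covered as in the original and every unary component is
  hit.
\<close>

section \<open>Formulas over metric predicates\<close>

text \<open>A model may have uncountably many points, so the countable structure can only consist of
  components of open sets; homogeneity, however, holds inside exact type classes, which are not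
  open. Shadowing bridges the two: by compactness, finitely many conditions from the type of a tuple
  force nearby tuples to lie close to its type class, and a chain through the open set so defined is
  followed by a chain through the class with slightly longer steps. Each use costs some scale, hence
  scales that increase from 1/8 towards 1/4. A component need not be totally bounded, so compactness
  controls a single neighbourhood, and homogeneity repeats the conclusion at every tuple along a
  chain. \<open>radius\<close> belongs to the language because step lengths are measured by it, so
  it has to agree on tuples of the same type; being bounded and 1-Lipschitz, it behaves like one
  more predicate. A component is determined by any of its members, which frees the structure from
  the choice of the dense sequence. Computed on indices, all its quantifiers are countable, which
  makes the map Borel.\<close>

text \<open>Formulas are evaluated at lists. \<open>FInf\<close> prepends the bound variable, and an atom with a
  variable beyond the length of the list has value \<open>0\<close>.\<close>

datatype frm =
    FZero
  | FAtom nat "nat list"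
  | FRad nat
  | FNeg frm
  | FMax frm frm
  | FShift rat frm
  | FInf frm

instance frm :: countable
  by countable_datatype

type_synonym 'a preds = "nat \<Rightarrow> 'a list \<Rightarrow> real"

text \<open>Nets are lists and precisions are \<open>1 / real (Suc n)\<close>, so that over the
  carrier \<open>UNIV :: nat set\<close> all quantifiers are countable. Net points may lie outside
  the ball.\<close>

definition tb_ball :: "'a set \<Rightarrow> 'a preds \<Rightarrow> 'a \<Rightarrow> real \<Rightarrow> bool" where
  "tb_ball S P x r \<longleftrightarrow> (\<forall>n::nat. \<exists>F. set F \<subseteq> S \<and>
     (\<forall>y\<in>S. P 0 [x, y] < r \<longrightarrow> (\<exists>f\<in>set F. P 0 [f, y] < 1 / real (Suc n))))"

text \<open>Rational candidates keep the supremum countable; the bound 1 keeps \<open>radius\<close>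
  bounded even where every ball is totally bounded.\<close>

definition radius :: "'a set \<Rightarrow> 'a preds \<Rightarrow> 'a \<Rightarrow> real" where
  "radius S P x = (SUP r\<in>{0..1::rat}. if tb_ball S P x (of_rat r) then of_rat r else 0)"

definition near :: "'a preds \<Rightarrow> real \<Rightarrow> 'a list \<Rightarrow> 'a list \<Rightarrow> bool" where
  "near P e = list_all2 (\<lambda>x y. P 0 [x, y] < e)"

primrec val :: "'a set \<Rightarrow> 'a preds \<Rightarrow> frm \<Rightarrow> 'a list \<Rightarrow> real" where
  "val S P FZero = (\<lambda>xs. 0)"
| "val S P (FAtom i vs) =
     (\<lambda>xs. if \<forall>v\<in>set vs. v < length xs then P i (map (nth xs) vs) else 0)"
| "val S P (FRad v) = (\<lambda>xs. if v < length xs then radius S P (xs ! v) else 0)"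
| "val S P (FNeg \<phi>) = (\<lambda>xs. - val S P \<phi> xs)"
| "val S P (FMax \<phi> \<psi>) = (\<lambda>xs. max (val S P \<phi> xs) (val S P \<psi> xs))"
| "val S P (FShift q \<phi>) = (\<lambda>xs. of_rat q + val S P \<phi> xs)"
| "val S P (FInf \<phi>) = (\<lambda>xs. INF w\<in>S. val S P \<phi> (w # xs))"

text \<open>A variable beyond \<open>I\<close> becomes \<open>FZero\<close> because
  \<open>val\<close> gives an atom with such a variable the value 0 on the selected sublist.\<close>

primrec subst_vars :: "nat list \<Rightarrow> frm \<Rightarrow> frm" where
  "subst_vars I FZero = FZero"
| "subst_vars I (FAtom i vs) = (if \<forall>v\<in>set vs. v < length I then FAtom i (map (nth I) vs) else FZero)"
| "subst_vars I (FRad v) = (if v < length I then FRad (I ! v) else FZero)"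
| "subst_vars I (FNeg \<phi>) = FNeg (subst_vars I \<phi>)"
| "subst_vars I (FMax \<phi> \<psi>) = FMax (subst_vars I \<phi>) (subst_vars I \<psi>)"
| "subst_vars I (FShift q \<phi>) = FShift q (subst_vars I \<phi>)"
| "subst_vars I (FInf \<phi>) = FInf (subst_vars (0 # map Suc I) \<phi>)"

lemma val_subst_vars:
  "set I \<subseteq> {..<length xs} \<Longrightarrow> val S P (subst_vars I \<phi>) xs = val S P \<phi> (map (nth xs) I)"
proof (induction \<phi> arbitrary: I xs)
  case (FAtom i vs)
  have *: "map (\<lambda>x. xs ! (I ! x)) vs = map ((!) (map ((!) xs) I)) vs"
    if "\<forall>v\<in>set vs. v < length I"
    using that by (intro map_cong) auto
  have "I ! v < length xs" if "v < length I" for v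
    using FAtom that by (metis lessThan_iff nth_mem subset_iff)
  then show ?case
    by (auto simp: * comp_def)
next
  case (FRad v)
  have "I ! v < length xs" if "v < length I" for v
    using FRad that by (metis lessThan_iff nth_mem subset_iff)
  then show ?case by auto
next
  case (FInf \<phi>)
  have "val S P (subst_vars (0 # map Suc I) \<phi>) (w # xs) = val S P \<phi> (w # map ((!) xs) I)" for w
    using FInf.prems by (subst FInf.IH) (auto simp: comp_def)
  then show ?case by simp
qed auto

section \<open>Boundedness and uniform continuity of formulas\<close>

locale metric_preds =
  fixes S :: "'a set" and P :: "'a preds"
  assumes carrier_nonempty: "S \<noteq> {}"
    and dist_nonneg: "x \<in> S \<Longrightarrow> y \<in> S \<Longrightarrow> 0 \<le> P 0 [x, y]"
    and dist_zero: "x \<in> S \<Longrightarrow> y \<in> S \<Longrightarrow> P 0 [x, y] = 0 \<longleftrightarrow> x = y"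
    and dist_sym: "x \<in> S \<Longrightarrow> y \<in> S \<Longrightarrow> P 0 [x, y] = P 0 [y, x]"
    and dist_tri: "x \<in> S \<Longrightarrow> y \<in> S \<Longrightarrow> z \<in> S \<Longrightarrow> P 0 [x, z] \<le> P 0 [x, y] + P 0 [y, z]"
    and bounded_preds: "\<exists>B. \<forall>xs\<in>lists S. \<bar>P i xs\<bar> \<le> B"
    and preds_uc: "0 < e \<Longrightarrow> \<exists>\<delta>>0. \<forall>xs\<in>lists S. \<forall>ys\<in>lists S. length xs = n \<longrightarrow>
      near P \<delta> xs ys \<longrightarrow> \<bar>P i xs - P i ys\<bar> < e"

lemma tb_ball_mono: "tb_ball S P x r \<Longrightarrow> r' \<le> r \<Longrightarrow> tb_ball S P x r'"
  unfolding tb_ball_def by (meson order_less_le_trans)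

lemma radius_bdd: "bdd_above ((\<lambda>r::rat. if tb_ball S P x (of_rat r) then of_rat r else 0::real) ` {0..1})"
  by (rule bdd_aboveI[of _ 1]) auto

lemma radius_le_1: "radius S P x \<le> 1"
  unfolding radius_def by (rule cSUP_least) auto

lemma radius_ge: "tb_ball S P x (of_rat r) \<Longrightarrow> 0 \<le> r \<Longrightarrow> r \<le> 1 \<Longrightarrow> of_rat r \<le> radius S P x"
  unfolding radius_def by (rule cSUP_upper2[OF radius_bdd, of r]) auto

lemma radius_nonneg: "0 \<le> radius S P x"
  unfolding radius_def by (rule cSUP_upper2[OF radius_bdd, of 0]) auto

lemma radius_tb_ball: "r < radius S P x \<Longrightarrow> 0 \<le> r \<Longrightarrow> tb_ball S P x r"
  unfolding radius_def
  by (subst (asm) less_cSUP_iff[OF _ radius_bdd]) (auto split: if_splits intro: tb_ball_mono)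

lemma tb_ball_radius: "tb_ball S P x r \<Longrightarrow> r \<le> 1 \<Longrightarrow> r \<le> radius S P x"
proof (rule ccontr)
  assume a: "tb_ball S P x r" "r \<le> 1" "\<not> r \<le> radius S P x"
  then obtain q where q: "radius S P x < of_rat q" "of_rat q < r"
    using of_rat_dense[of "radius S P x" r] by auto
  then have "0 < (of_rat q::real)" using radius_nonneg[of S P x] by linarith
  then have "0 \<le> q" "q \<le> 1" using q a(2)
    by (auto, smt (verit) of_rat_less_eq of_rat_1)
  with q a tb_ball_mono[of S P x r "of_rat q"] radius_ge[of S P x q] show False by auto
qed

lemma near_nth: "near P e xs ys \<longleftrightarrow> length xs = length ys \<and> (\<forall>i<length xs. P 0 [xs!i, ys!i] < e)"
  by (auto simp: near_def list_all2_conv_all_nth)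

lemma near_mono: "near P e xs ys \<Longrightarrow> e \<le> e' \<Longrightarrow> near P e' xs ys"
  unfolding near_nth by (meson order_less_le_trans)

lemma near_length: "near P e xs ys \<Longrightarrow> length xs = length ys"
  by (simp add: near_nth)

lemma near_Cons [simp]: "near P e (x # xs) (y # ys) \<longleftrightarrow> P 0 [x, y] < e \<and> near P e xs ys"
  by (simp add: near_def)

lemma near_map_nth:
  "near P e xs ys \<Longrightarrow> set I \<subseteq> {..<length xs} \<Longrightarrow> near P e (map (nth xs) I) (map (nth ys) I)"
  unfolding near_nth by (metis (no_types, lifting) length_map lessThan_iff nth_map nth_mem subsetD)

lemma near_take: "near P e xs ys \<Longrightarrow> near P e (take n xs) (take n ys)"
  unfolding near_def by (rule list_all2_takeI)

lemma cINF_abs_le: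
  fixes f g :: "'b \<Rightarrow> real"
  assumes "A \<noteq> {}" "bdd_below (f ` A)" "bdd_below (g ` A)" "\<And>w. w \<in> A \<Longrightarrow> \<bar>f w - g w\<bar> \<le> e"
  shows "\<bar>(INF w\<in>A. f w) - (INF w\<in>A. g w)\<bar> \<le> e"
proof -
  have "(INF w\<in>A. f w) - e \<le> (INF w\<in>A. g w)"
  proof (rule cINF_greatest[OF assms(1)])
    fix w assume "w \<in> A"
    then show "(INF w\<in>A. f w) - e \<le> g w"
      using cINF_lower[OF assms(2), of w] assms(4)[of w] by linarith
  qed
  moreover have "(INF w\<in>A. g w) - e \<le> (INF w\<in>A. f w)"
  proof (rule cINF_greatest[OF assms(1)])
    fix w assume "w \<in> A"
    then show "(INF w\<in>A. g w) - e \<le> f w"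
      using cINF_lower[OF assms(3), of w] assms(4)[of w] by linarith
  qed
  ultimately show ?thesis by linarith
qed

context metric_preds
begin

lemma dist_refl [simp]: "x \<in> S \<Longrightarrow> P 0 [x, x] = 0"
  using dist_zero by blast

lemma near_refl: "xs \<in> lists S \<Longrightarrow> 0 < e \<Longrightarrow> near P e xs xs"
  by (auto simp: near_nth dest!: nth_mem)

lemma nth_S: "xs \<in> lists S \<Longrightarrow> i < length xs \<Longrightarrow> xs ! i \<in> S"
  by (meson in_listsD nth_mem)

lemma map_nth_S: "xs \<in> lists S \<Longrightarrow> set I \<subseteq> {..<length xs} \<Longrightarrow> map (nth xs) I \<in> lists S"
  by (auto simp: subset_iff)

lemma near_sym: "near P e xs ys \<Longrightarrow> xs \<in> lists S \<Longrightarrow> ys \<in> lists S \<Longrightarrow> near P e ys xs"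
  unfolding near_nth by (metis dist_sym nth_S)

lemma near_tri: "near P e xs ys \<Longrightarrow> near P e' ys zs \<Longrightarrow> xs \<in> lists S \<Longrightarrow> ys \<in> lists S \<Longrightarrow> zs \<in> lists S
  \<Longrightarrow> near P (e + e') xs zs"
  unfolding near_nth by (smt (verit) nth_S dist_tri)

text \<open>The ball at \<open>y\<close> is contained in the ball at \<open>x\<close>, so the same
  net serves. This is what makes \<open>radius\<close> 1-Lipschitz.\<close>

lemma tb_ball_shift:
  assumes "tb_ball S P x r" "x \<in> S" "y \<in> S"
  shows "tb_ball S P y (r - P 0 [x, y])"
  using assms(1) unfolding tb_ball_def
proof (intro allI, elim allE exE conjE)
  fix n F assume F: "set F \<subseteq> S"
    "\<forall>y\<in>S. P 0 [x, y] < r \<longrightarrow> (\<exists>f\<in>set F. P 0 [f, y] < 1 / real (Suc n))"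
  show "\<exists>F. set F \<subseteq> S \<and>
             (\<forall>ya\<in>S. P 0 [y, ya] < r - P 0 [x, y] \<longrightarrow> (\<exists>f\<in>set F. P 0 [f, ya] < 1 / real (Suc n)))"
    using F dist_tri[OF assms(2,3)] by (intro exI[of _ F]) fastforce
qed

lemma radius_lip1:
  assumes "x \<in> S" "y \<in> S"
  shows "radius S P x \<le> radius S P y + P 0 [x, y]"
proof (rule ccontr)
  assume n: "\<not> radius S P x \<le> radius S P y + P 0 [x, y]"
  then obtain r where r: "radius S P y + P 0 [x, y] < r" "r < radius S P x"
    using dense not_le by blast
  have d: "0 \<le> P 0 [x, y]" using assms dist_nonneg by blast
  have "0 \<le> r" using r(1) d radius_nonneg[of S P y] by linarith
  then have "tb_ball S P y (r - P 0 [x, y])"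
    by (rule tb_ball_shift[OF radius_tb_ball[OF r(2)] assms])
  then have "r - P 0 [x, y] \<le> radius S P y"
    using r(2) radius_le_1[of S P x] d by (intro tb_ball_radius) auto
  then show False using r by linarith
qed

lemma radius_lip: "x \<in> S \<Longrightarrow> y \<in> S \<Longrightarrow> \<bar>radius S P x - radius S P y\<bar> \<le> P 0 [x, y]"
  using radius_lip1[of x y] radius_lip1[of y x] dist_sym[of x y] by linarith

lemma val_bounded: "\<exists>B. \<forall>xs\<in>lists S. \<bar>val S P \<phi> xs\<bar> \<le> B"
proof (induction \<phi>)
  case (FAtom i vs)
  obtain B where B: "\<forall>xs\<in>lists S. \<bar>P i xs\<bar> \<le> B" using bounded_preds by blast
  have "0 \<le> B" using B[rule_format, of "[]"] by auto
  moreover have "\<bar>P i (map (nth xs) vs)\<bar> \<le> B"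
    if "xs \<in> lists S" "\<forall>v\<in>set vs. v < length xs" for xs
    by (rule B[rule_format], rule map_nth_S) (use that in auto)
  ultimately show ?case by (intro exI[of _ B]) simp
next
  case (FRad v)
  have "\<bar>radius S P x\<bar> \<le> 1" for x
    using radius_nonneg[of S P x] radius_le_1[of S P x] by linarith
  then show ?case by (intro exI[of _ 1]) simp
next
  case (FMax \<phi> \<psi>)
  then obtain B C where "\<forall>xs\<in>lists S. \<bar>val S P \<phi> xs\<bar> \<le> B" "\<forall>xs\<in>lists S. \<bar>val S P \<psi> xs\<bar> \<le> C" by blast
  then have "\<bar>val S P (FMax \<phi> \<psi>) xs\<bar> \<le> max B C" if "xs \<in> lists S" for xs
    using that unfolding val.simps by (smt (verit))
  then show ?case by blast
next
  case (FShift q \<phi>)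
  then obtain B where "\<forall>xs\<in>lists S. \<bar>val S P \<phi> xs\<bar> \<le> B" by blast
  then have "\<bar>val S P (FShift q \<phi>) xs\<bar> \<le> B + \<bar>of_rat q\<bar>" if "xs \<in> lists S" for xs
    using that unfolding val.simps by (smt (verit))
  then show ?case by blast
next
  case (FInf \<phi>)
  then obtain B where B: "\<forall>xs\<in>lists S. \<bar>val S P \<phi> xs\<bar> \<le> B" by blast
  obtain w0 where w0: "w0 \<in> S" using carrier_nonempty by blast
  have "\<bar>val S P (FInf \<phi>) xs\<bar> \<le> B" if xs: "xs \<in> lists S" for xs
  proof -
    have b: "\<bar>val S P \<phi> (w # xs)\<bar> \<le> B" if "w \<in> S" for w using B that xs by auto
    then have "bdd_below ((\<lambda>w. val S P \<phi> (w # xs)) ` S)"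
      by (intro bdd_belowI2[of _ "-B"]) (smt (verit))
    from cINF_lower[OF this w0] b[OF w0] have "val S P (FInf \<phi>) xs \<le> B" by simp
    moreover have "-B \<le> val S P (FInf \<phi>) xs"
      unfolding val.simps by (rule cINF_greatest[OF carrier_nonempty]) (smt (verit) b)
    ultimately show ?thesis by simp
  qed
  then show ?case by blast
qed auto

lemma val_bdd_below:
  assumes "xs \<in> lists S"
  shows "bdd_below ((\<lambda>w. val S P \<phi> (w # xs)) ` S)"
proof -
  obtain B where B: "\<forall>xs\<in>lists S. \<bar>val S P \<phi> xs\<bar> \<le> B" using val_bounded by blast
  show ?thesis
  proof (rule bdd_belowI2[of _ "-B"])
    fix w assume "w \<in> S"
    then have "\<bar>val S P \<phi> (w # xs)\<bar> \<le> B" using B assms by simp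
    then show "- B \<le> val S P \<phi> (w # xs)" by linarith
  qed
qed

lemma val_FInf_less:
  assumes "xs \<in> lists S"
  shows "val S P (FInf \<phi>) xs < q \<longleftrightarrow> (\<exists>w\<in>S. val S P \<phi> (w # xs) < q)"
  using cINF_less_iff[OF carrier_nonempty val_bdd_below[OF assms]] by simp

lemma val_uc:
  "0 < e \<Longrightarrow> \<exists>\<delta>>0. \<forall>xs\<in>lists S. \<forall>ys\<in>lists S. length xs = n \<longrightarrow>
      near P \<delta> xs ys \<longrightarrow> \<bar>val S P \<phi> xs - val S P \<phi> ys\<bar> < e"
proof (induction \<phi> arbitrary: n e)
  case FZero
  then show ?case by (auto intro: exI[of _ 1])
next
  case (FAtom i vs)
  obtain \<delta> where \<delta>: "\<delta> > 0" "\<forall>xs\<in>lists S. \<forall>ys\<in>lists S. length xs = length vs \<longrightarrow>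
      near P \<delta> xs ys \<longrightarrow> \<bar>P i xs - P i ys\<bar> < e" using preds_uc[OF FAtom] by blast
  show ?case
  proof (intro exI[of _ \<delta>] conjI \<delta>(1) ballI impI)
    fix xs ys assume a: "xs \<in> lists S" "ys \<in> lists S" "length xs = n" "near P \<delta> xs ys"
    have l: "length ys = length xs" using a(4) near_length by metis
    show "\<bar>val S P (FAtom i vs) xs - val S P (FAtom i vs) ys\<bar> < e"
    proof (cases "\<forall>v\<in>set vs. v < length xs")
      case True
      then have "set vs \<subseteq> {..<length xs}" "set vs \<subseteq> {..<length ys}" using l by auto
      with \<delta>(2)[rule_format, of "map (nth xs) vs" "map (nth ys) vs"] near_map_nth[OF a(4)]
        a map_nth_S True l show ?thesis by simp
    qed (use FAtom l in auto)
  qed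
next
  case (FRad v)
  show ?case
  proof (intro exI[of _ e] conjI FRad ballI impI)
    fix xs ys assume a: "xs \<in> lists S" "ys \<in> lists S" "length xs = n" "near P e xs ys"
    then show "\<bar>val S P (FRad v) xs - val S P (FRad v) ys\<bar> < e"
      using FRad radius_lip[of "xs ! v" "ys ! v"] nth_S
      by (fastforce simp: near_nth)
  qed
next
  case (FNeg \<phi>)
  then show ?case by (simp add: abs_minus_commute)
next
  case (FMax \<phi> \<psi>)
  obtain \<delta> where \<delta>: "\<delta> > 0" "\<forall>xs\<in>lists S. \<forall>ys\<in>lists S. length xs = n \<longrightarrow>
      near P \<delta> xs ys \<longrightarrow> \<bar>val S P \<phi> xs - val S P \<phi> ys\<bar> < e" using FMax(1)[OF FMax(3)] by blast
  obtain \<delta>' where \<delta>': "\<delta>' > 0" "\<forall>xs\<in>lists S. \<forall>ys\<in>lists S. length xs = n \<longrightarrow>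
      near P \<delta>' xs ys \<longrightarrow> \<bar>val S P \<psi> xs - val S P \<psi> ys\<bar> < e" using FMax(2)[OF FMax(3)] by blast
  show ?case
  proof (intro exI[of _ "min \<delta> \<delta>'"] conjI ballI impI)
    fix xs ys assume a: "xs \<in> lists S" "ys \<in> lists S" "length xs = n" "near P (min \<delta> \<delta>') xs ys"
    have "\<bar>val S P \<phi> xs - val S P \<phi> ys\<bar> < e" "\<bar>val S P \<psi> xs - val S P \<psi> ys\<bar> < e"
      using \<delta>(2) \<delta>'(2) a near_mono[OF a(4), of \<delta>] near_mono[OF a(4), of \<delta>'] by auto
    then show "\<bar>val S P (FMax \<phi> \<psi>) xs - val S P (FMax \<phi> \<psi>) ys\<bar> < e"
      unfolding val.simps by linarith
  qed (use \<delta> \<delta>' in auto)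
next
  case (FShift q \<phi>)
  then show ?case by simp
next
  case (FInf \<phi>)
  \<comment> \<open>Half of \<open>e\<close>, because passing to the infimum turns the strict bound
    into a weak one.\<close>
  from FInf.IH[of "e/2" "Suc n"] FInf.prems obtain \<delta> where \<delta>: "\<delta> > 0"
    "\<forall>xs\<in>lists S. \<forall>ys\<in>lists S. length xs = Suc n \<longrightarrow>
      near P \<delta> xs ys \<longrightarrow> \<bar>val S P \<phi> xs - val S P \<phi> ys\<bar> < e/2" by auto
  show ?case
  proof (intro exI[of _ \<delta>] conjI ballI impI \<delta>(1))
    fix xs ys assume a: "xs \<in> lists S" "ys \<in> lists S" "length xs = n" "near P \<delta> xs ys"
    have "\<bar>val S P \<phi> (w # xs) - val S P \<phi> (w # ys)\<bar> \<le> e/2" if "w \<in> S" for w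
      using \<delta>(2)[rule_format, of "w # xs" "w # ys"] a that \<delta>(1) by simp
    from cINF_abs_le[OF carrier_nonempty val_bdd_below val_bdd_below this] a(1,2)
    have "\<bar>val S P (FInf \<phi>) xs - val S P (FInf \<phi>) ys\<bar> \<le> e/2" by simp
    then show "\<bar>val S P (FInf \<phi>) xs - val S P (FInf \<phi>) ys\<bar> < e" using FInf.prems by linarith
  qed
qed

end

section \<open>Types\<close>

text \<open>A finite conjunction of strict upper bounds becomes one sublevel set at 0; the empty
  conjunction is the constant -1, which is always below 0.\<close>

fun conj_frm :: "(frm \<times> rat) list \<Rightarrow> frm" where
  "conj_frm [] = FShift (-1) FZero"
| "conj_frm ((\<phi>, q) # G) = FMax (FShift (- q) \<phi>) (conj_frm G)"

lemma val_conj_frm: "val S P (conj_frm G) xs < 0 \<longleftrightarrow> (\<forall>(\<phi>, q)\<in>set G. val S P \<phi> xs < of_rat q)"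
  by (induction G rule: conj_frm.induct) (auto simp: of_rat_minus)

definition same_type :: "'a set \<Rightarrow> 'a preds \<Rightarrow> 'a list \<Rightarrow> 'a list \<Rightarrow> bool" where
  "same_type S P xs ys \<longleftrightarrow> xs \<in> lists S \<and> ys \<in> lists S \<and> length xs = length ys \<and>
     (\<forall>\<phi>. val S P \<phi> xs = val S P \<phi> ys)"

text \<open>Formulas and rationals are countable, so \<open>from_nat_into\<close> enumerates these
  conditions, and tuples meeting longer and longer initial segments of the enumeration approximate
  the type of \<open>xs\<close>.\<close>

definition conds :: "'a set \<Rightarrow> 'a preds \<Rightarrow> 'a list \<Rightarrow> (frm \<times> rat) set" where
  "conds S P xs = {(\<phi>, q). val S P \<phi> xs < of_rat q}"

text \<open>Half of the radius stays strictly below it when the radius is positive, so each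
  coordinate ranges over a totally bounded ball, with room left for small errors.\<close>

definition half_near :: "'a set \<Rightarrow> 'a preds \<Rightarrow> 'a list \<Rightarrow> 'a list \<Rightarrow> bool" where
  "half_near S P = list_all2 (\<lambda>x y. P 0 [x, y] < radius S P x / 2)"

lemma same_type_refl: "xs \<in> lists S \<Longrightarrow> same_type S P xs xs"
  by (simp add: same_type_def)

lemma same_type_length: "same_type S P xs ys \<Longrightarrow> length xs = length ys"
  by (simp only: same_type_def)

lemma same_type_lists: "same_type S P xs ys \<Longrightarrow> xs \<in> lists S" "same_type S P xs ys \<Longrightarrow> ys \<in> lists S"
  by (simp_all only: same_type_def)

lemma same_type_sym: "same_type S P xs ys \<Longrightarrow> same_type S P ys xs"
  by (simp add: same_type_def)

lemma same_type_trans: "same_type S P xs ys \<Longrightarrow> same_type S P ys zs \<Longrightarrow> same_type S P xs zs"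
  by (simp add: same_type_def)

text \<open>Rationals are dense, so the weak bounds give one inequality for every formula; applied
  to \<open>FNeg\<close> they give the reverse one. Weak bounds are the form in which conditions
  survive limits.\<close>

lemma eqvI_le:
  assumes "xs \<in> lists S" "ys \<in> lists S" "length xs = length ys"
    and le: "\<And>\<phi> q. (\<phi>, q) \<in> conds S P xs \<Longrightarrow> val S P \<phi> ys \<le> of_rat q"
  shows "same_type S P xs ys"
proof -
  have *: "val S P \<phi> ys \<le> val S P \<phi> xs" for \<phi>
  proof (rule ccontr)
    assume "\<not> val S P \<phi> ys \<le> val S P \<phi> xs"
    then obtain q where "val S P \<phi> xs < of_rat q" "of_rat q < val S P \<phi> ys"
      using of_rat_dense not_le by metis
    then show False using le[of \<phi> q] by (simp add: conds_def)
  qed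
  have "val S P \<phi> xs = val S P \<phi> ys" for \<phi>
    using *[of \<phi>] *[of "FNeg \<phi>"] by simp
  with assms show ?thesis by (simp add: same_type_def)
qed

lemma same_type_map_nth:
  assumes "same_type S P xs ys" "set I \<subseteq> {..<length xs}"
  shows "same_type S P (map (nth xs) I) (map (nth ys) I)"
proof -
  have "val S P \<phi> (map (nth xs) I) = val S P \<phi> (map (nth ys) I)" for \<phi>
    using assms val_subst_vars[of I xs S P \<phi>] val_subst_vars[of I ys S P \<phi>] by (simp add: same_type_def)
  moreover have "map (nth zs) I \<in> lists S" if "zs \<in> lists S" "length zs = length xs" for zs
    using that assms(2) by (auto simp: subset_iff)
  ultimately show ?thesis using assms by (simp add: same_type_def)
qed

lemma map_nth_app1: "map (nth (a @ b)) [0..<length a] = a"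
  by (rule nth_equalityI) (auto simp: nth_append)

lemma map_nth_app2: "map (nth (a @ b)) [length a..<length a + length b] = b"
  by (rule nth_equalityI) (auto simp: nth_append)

lemma same_type_parts:
  assumes "same_type S P (a @ b) (a' @ b')" "length a = length a'"
  shows "same_type S P a a'" "same_type S P b b'" "same_type S P (b @ a) (b' @ a')" "same_type S P (a @ a @ b) (a' @ a' @ b')"
proof -
  let ?A = "[0..<length a]" and ?B = "[length a..<length a + length b]"
  have l: "length b = length b'" using same_type_length[OF assms(1)] assms(2) by simp
  note r = same_type_map_nth[OF assms(1)]
  have A: "map (nth (a @ b)) ?A = a" "map (nth (a' @ b')) ?A = a'"
    "map (nth (a @ b)) ?B = b" "map (nth (a' @ b')) ?B = b'"
    using map_nth_app1[of a b] map_nth_app1[of a' b'] map_nth_app2[of a b] map_nth_app2[of a' b']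
    by (simp_all add: assms(2) l)
  have B: "set ?A \<subseteq> {..<length (a @ b)}" "set ?B \<subseteq> {..<length (a @ b)}" by auto
  show "same_type S P a a'" using r[OF B(1)] A by metis
  show "same_type S P b b'" using r[OF B(2)] A by metis
  show "same_type S P (b @ a) (b' @ a')" using r[of "?B @ ?A"] B A unfolding map_append set_append by auto
  show "same_type S P (a @ a @ b) (a' @ a' @ b')"
    using r[of "?A @ ?A @ ?B"] B A unfolding map_append set_append by auto
qed

lemma same_type_drop_mid:
  assumes "same_type S P (a @ b @ c) (a' @ b' @ c')" "length a = length a'" "length b = length b'"
  shows "same_type S P (a @ c) (a' @ c')"
proof -
  have "same_type S P (b @ c @ a) (b' @ c' @ a')"
    using same_type_parts(3)[OF assms(1,2)] by simp
  from same_type_parts(2)[OF this assms(3)] have "same_type S P (c @ a) (c' @ a')" .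
  moreover have "length c = length c'" using same_type_length[OF assms(1)] assms(2,3) by simp
  ultimately show ?thesis by (rule same_type_parts(3))
qed

lemma same_type_dist:
  assumes "same_type S P xs ys" "i < length xs" "j < length xs"
  shows "P 0 [xs ! i, xs ! j] = P 0 [ys ! i, ys ! j]"
proof -
  have "val S P (FAtom 0 [i, j]) xs = val S P (FAtom 0 [i, j]) ys" "length xs = length ys"
    using assms by (simp_all only: same_type_def)
  then show ?thesis using assms(2,3) by simp
qed

lemma same_type_radius:
  assumes "same_type S P xs ys" "i < length xs"
  shows "radius S P (xs ! i) = radius S P (ys ! i)"
proof -
  have "val S P (FRad i) xs = val S P (FRad i) ys" "length xs = length ys"
    using assms by (simp_all only: same_type_def)
  then show ?thesis using assms(2) by simp
qed

text \<open>Distances and radii are values of atomic formulas, so any coordinatewise relation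
  expressed by them depends on the joint type only.\<close>

lemma same_type_all2:
  assumes "same_type S P (a @ b) (a' @ b')" "length a = length a'"
    and "list_all2 (\<lambda>x y. R (P 0 [x, y]) (radius S P x) (radius S P y)) a b"
  shows "list_all2 (\<lambda>x y. R (P 0 [x, y]) (radius S P x) (radius S P y)) a' b'"
proof -
  have l: "length a = length b" using assms(3) by (rule list_all2_lengthD)
  have l': "length a' = length b'" using same_type_length[OF assms(1)] assms(2) l by simp
  have "P 0 [a ! i, b ! i] = P 0 [a' ! i, b' ! i]" "radius S P (a ! i) = radius S P (a' ! i)"
    "radius S P (b ! i) = radius S P (b' ! i)" if "i < length a" for i
    using same_type_dist[OF assms(1), of i "length a + i"] same_type_radius[OF assms(1), of i]
      same_type_radius[OF assms(1), of "length a + i"] that l assms(2) by (auto simp: nth_append)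
  then show ?thesis using assms(2,3) l l' by (auto simp: list_all2_conv_all_nth)
qed

lemma same_type_near:
  "same_type S P (a @ b) (a' @ b') \<Longrightarrow> length a = length a' \<Longrightarrow> near P e a b \<Longrightarrow> near P e a' b'"
  unfolding near_def by (rule same_type_all2[where R = "\<lambda>d r r'. d < e"])

lemma same_type_half_near:
  "same_type S P (a @ b) (a' @ b') \<Longrightarrow> length a = length a' \<Longrightarrow> half_near S P a b \<Longrightarrow> half_near S P a' b'"
  unfolding half_near_def by (rule same_type_all2[where R = "\<lambda>d r r'. d < r / 2"])

section \<open>Compactness of small balls and extension of types\<close>

locale complete_preds = metric_preds S P for S :: "'a set" and P +
  assumes complete: "(\<And>n. \<sigma> n \<in> S) \<Longrightarrow> (\<And>e. 0 < e \<Longrightarrow> \<exists>N. \<forall>m\<ge>N. \<forall>n\<ge>N. P 0 [\<sigma> m, \<sigma> n] < e)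
      \<Longrightarrow> \<exists>l\<in>S. (\<lambda>n. P 0 [\<sigma> n, l]) \<longlonglongrightarrow> 0"

locale lc_preds = complete_preds S P for S :: "'a set" and P +
  assumes radius_pos: "x \<in> S \<Longrightarrow> 0 < radius S P x"

context metric_preds
begin

lemma val_lim:
  assumes "\<And>n. \<sigma> n \<in> lists S" "l \<in> lists S" "\<And>e. 0 < e \<Longrightarrow> eventually (\<lambda>n. near P e (\<sigma> n) l) F"
  shows "((\<lambda>n. val S P \<phi> (\<sigma> n)) \<longlongrightarrow> val S P \<phi> l) F"
proof (rule tendstoI)
  fix e :: real assume "0 < e"
  then obtain \<delta> where \<delta>: "\<delta> > 0" "\<forall>xs\<in>lists S. \<forall>ys\<in>lists S. length xs = length l \<longrightarrow>
      near P \<delta> xs ys \<longrightarrow> \<bar>val S P \<phi> xs - val S P \<phi> ys\<bar> < e" using val_uc by blast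
  show "eventually (\<lambda>n. dist (val S P \<phi> (\<sigma> n)) (val S P \<phi> l) < e) F"
    using assms(3)[OF \<delta>(1)] \<delta>(2) assms(1,2) by (auto elim!: eventually_mono simp: dist_real_def dest: near_length)
qed

lemma sequential_cpt:
  assumes x: "x \<in> S" and r: "r < radius S P x" and \<sigma>: "\<And>n. \<sigma> n \<in> S" "\<And>n. P 0 [x, \<sigma> n] < r"
  shows "\<exists>k. strict_mono (k::nat\<Rightarrow>nat) \<and> (\<forall>e>0. \<exists>N. \<forall>m\<ge>N. \<forall>n\<ge>N. P 0 [\<sigma> (k m), \<sigma> (k n)] < e)"
proof -
  define d where "d = (\<lambda>x y. if x \<in> S \<and> y \<in> S then P 0 [x, y] else 0)"
  interpret Metric_space S d
    by unfold_locales (auto simp: d_def dist_nonneg dist_zero dist_sym dist_tri)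
  define B where "B = {y\<in>S. P 0 [x, y] < r}"
  have "0 \<le> r" using \<sigma>(2)[of 0] dist_nonneg[OF x \<sigma>(1)[of 0]] by linarith
  then have tb_ball: "tb_ball S P x r" by (rule radius_tb_ball[OF r])
  have "mtotally_bounded B"
    unfolding mtotally_bounded_def
  proof (intro allI impI)
    fix e :: real assume "0 < e"
    then obtain n where n: "1 / real (Suc n) < e / 2"
      by (metis nat_approx_posE half_gt_zero)
    obtain F where F: "set F \<subseteq> S"
      "\<forall>y\<in>S. P 0 [x, y] < r \<longrightarrow> (\<exists>f\<in>set F. P 0 [f, y] < 1 / real (Suc n))"
      using tb_ball unfolding tb_ball_def by blast
    \<comment> \<open>A net point may lie outside \<open>B\<close> and is replaced by a point of
      \<open>B\<close> close to it. This doubles the distances, whence the precision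
      \<open>e / 2\<close>.\<close>
    define g where "g f = (SOME y. y \<in> B \<and> P 0 [f, y] < 1 / real (Suc n))" for f
    define F' where "F' = {f\<in>set F. \<exists>y\<in>B. P 0 [f, y] < 1 / real (Suc n)}"
    have g: "g f \<in> B \<and> P 0 [f, g f] < 1 / real (Suc n)" if "f \<in> F'" for f
      unfolding g_def by (rule someI_ex) (use that in \<open>auto simp: F'_def\<close>)
    show "\<exists>K. finite K \<and> K \<subseteq> B \<and> B \<subseteq> (\<Union>x\<in>K. mball x e)"
    proof (intro exI[of _ "g ` F'"] conjI subsetI)
      show "finite (g ` F')" by (simp add: F'_def)
      show "z \<in> B" if "z \<in> g ` F'" for z using that g by auto
      fix y assume y: "y \<in> B"
      then obtain f where f: "f \<in> set F" "P 0 [f, y] < 1 / real (Suc n)"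
        using F(2) by (auto simp: B_def)
      then have f': "f \<in> F'" "f \<in> S" using y F(1) by (auto simp: F'_def)
      have yS: "y \<in> S" "g f \<in> S" using y g[OF f'(1)] by (auto simp: B_def)
      have "P 0 [g f, y] < e"
        using dist_tri[OF yS(2) f'(2) yS(1)] dist_sym[OF yS(2) f'(2)] g[OF f'(1)] f(2) n by linarith
      then have "d (g f) y < e" using yS by (simp add: d_def)
      then have "y \<in> mball (g f) e" using yS by simp
      then show "y \<in> (\<Union>x\<in>g ` F'. mball x e)" using f'(1) by blast
    qed
  qed
  moreover have "range \<sigma> \<subseteq> B" using \<sigma> by (auto simp: B_def)
  ultimately obtain k where k: "strict_mono (k::nat\<Rightarrow>nat)" "MCauchy (\<sigma> \<circ> k)"
    unfolding mtotally_bounded_sequentially by blast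
  have "\<exists>N. \<forall>m\<ge>N. \<forall>n\<ge>N. P 0 [\<sigma> (k m), \<sigma> (k n)] < e" if e: "0 < e" for e
  proof -
    have "\<forall>\<epsilon>>0. \<exists>N. \<forall>n n'. N \<le> n \<longrightarrow> N \<le> n' \<longrightarrow> d ((\<sigma> \<circ> k) n) ((\<sigma> \<circ> k) n') < \<epsilon>"
      using k(2) unfolding MCauchy_def by (rule conjunct2)
    then obtain N where N: "\<And>n n'. N \<le> n \<Longrightarrow> N \<le> n' \<Longrightarrow> d ((\<sigma> \<circ> k) n) ((\<sigma> \<circ> k) n') < e"
      using e by meson
    have "P 0 [\<sigma> (k m), \<sigma> (k n)] < e" if "N \<le> m" "N \<le> n" for m n
      using N[OF that] \<sigma>(1) by (simp add: d_def)
    then show ?thesis by blast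
  qed
  with k(1) show ?thesis by blast
qed

end

context lc_preds
begin

lemma ball_cpt:
  assumes x: "x \<in> S" and r: "r < radius S P x" and \<sigma>: "\<And>n. \<sigma> n \<in> S" "\<And>n. P 0 [x, \<sigma> n] < r"
  shows "\<exists>l\<in>S. \<exists>k. strict_mono (k::nat\<Rightarrow>nat) \<and> (\<lambda>n. P 0 [\<sigma> (k n), l]) \<longlonglongrightarrow> 0"
proof -
  obtain k where k: "strict_mono (k::nat\<Rightarrow>nat)"
     "\<forall>e>0. \<exists>N. \<forall>m\<ge>N. \<forall>n\<ge>N. P 0 [\<sigma> (k m), \<sigma> (k n)] < e"
    using sequential_cpt[where \<sigma>=\<sigma>, OF x r \<sigma>] by blast
  then show ?thesis using complete[of "\<lambda>n. \<sigma> (k n)"] \<sigma>(1) by blast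
qed

lemma list_cpt:
  assumes "xs \<in> lists S" "\<And>n. \<sigma> n \<in> lists S" "\<And>n. half_near S P xs (\<sigma> n)"
  shows "\<exists>l\<in>lists S. length l = length xs \<and> (\<exists>k. strict_mono (k::nat\<Rightarrow>nat) \<and>
     (\<forall>e>0. eventually (\<lambda>n. near P e (\<sigma> (k n)) l) sequentially))"
  using assms
proof (induction xs arbitrary: \<sigma> rule: list.induct)
  case Nil
  then have "\<sigma> n = []" for n by (simp add: half_near_def)
  then show ?case by (intro bexI[of _ "[]"]) (auto simp: near_def intro: strict_mono_id)
next
  case (Cons x xs)
  have h: "\<sigma> n = hd (\<sigma> n) # tl (\<sigma> n)" for n
    using Cons.prems(3)[of n] by (cases "\<sigma> n") (auto simp: half_near_def)
  have h1: "hd (\<sigma> n) \<in> S" "tl (\<sigma> n) \<in> lists S" "P 0 [x, hd (\<sigma> n)] < radius S P x / 2"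
    "half_near S P xs (tl (\<sigma> n))" for n
    using Cons.prems(2,3)[of n] by (cases "\<sigma> n"; auto simp: half_near_def)+
  have x: "x \<in> S" "xs \<in> lists S" using Cons.prems by auto
  have "radius S P x / 2 < radius S P x" using radius_pos[OF x(1)] by simp
  from ball_cpt[where \<sigma>="\<lambda>n. hd (\<sigma> n)", OF x(1) this h1(1,3)] obtain l1 k1 where
    1: "l1 \<in> S" "strict_mono (k1::nat\<Rightarrow>nat)" "(\<lambda>n. P 0 [hd (\<sigma> (k1 n)), l1]) \<longlonglongrightarrow> 0" by blast
  from Cons.IH[OF x(2), of "\<lambda>n. tl (\<sigma> (k1 n))"] h1 obtain l2 k2 where
    2: "l2 \<in> lists S" "length l2 = length xs" "strict_mono (k2::nat\<Rightarrow>nat)"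
    "\<forall>e>0. eventually (\<lambda>n. near P e (tl (\<sigma> (k1 (k2 n)))) l2) sequentially" by blast
  have "eventually (\<lambda>n. near P e (\<sigma> (k1 (k2 n))) (l1 # l2)) sequentially" if e: "0 < e" for e
  proof -
    have "(\<lambda>n. P 0 [hd (\<sigma> (k1 (k2 n))), l1]) \<longlonglongrightarrow> 0"
      using LIMSEQ_subseq_LIMSEQ[OF 1(3) 2(3)] by (simp add: comp_def)
    from order_tendstoD(2)[OF this e]
    have "eventually (\<lambda>n. P 0 [hd (\<sigma> (k1 (k2 n))), l1] < e) sequentially" .
    with 2(4)[rule_format, OF e] show ?thesis
      by eventually_elim (subst h, simp)
  qed
  then show ?case using 1 2 x
    by (intro bexI[of _ "l1 # l2"] conjI exI[of _ "\<lambda>n. k1 (k2 n)"])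
       (auto simp: strict_mono_def)
qed

text \<open>Since \<open>k n \<ge> n\<close>, each condition of \<open>xs\<close> holds along a tail
  of the sequence. In the limit it survives as a weak inequality, which \<open>eqvI_le\<close>
  accepts.\<close>

lemma conds_limit:
  assumes \<sigma>: "\<And>n. \<sigma> n \<in> lists S" "l \<in> lists S" "\<And>e. 0 < e \<Longrightarrow> eventually (\<lambda>n. near P e (\<sigma> n) l) sequentially"
    and xs: "xs \<in> lists S" "length xs = length l" and k: "strict_mono (k::nat\<Rightarrow>nat)"
    and G: "\<And>n. \<forall>t<k n. val S P (fst (from_nat_into (conds S P xs) t)) (\<sigma> n)
               < of_rat (snd (from_nat_into (conds S P xs) t))"
  shows "same_type S P xs l"
proof (rule eqvI_le[OF xs(1) \<sigma>(2) xs(2)])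
  fix \<phi> q assume "(\<phi>, q) \<in> conds S P xs"
  then obtain t where t: "from_nat_into (conds S P xs) t = (\<phi>, q)"
    by (metis countableI_type from_nat_into_surj)
  have "eventually (\<lambda>n. val S P \<phi> (\<sigma> n) \<le> of_rat q) sequentially"
    using eventually_gt_at_top[of t]
  proof eventually_elim
    case (elim n)
    then have "t < k n" using seq_suble[OF k, of n] by linarith
    then show ?case using G[of n] t by fastforce
  qed
  from tendsto_upperbound[OF val_lim[where \<sigma>=\<sigma>, OF \<sigma>] this sequentially_bot]
  show "val S P \<phi> l \<le> of_rat q" by simp
qed

lemma conds_nonempty: "conds S P xs \<noteq> {}"
proof -
  have "(FZero, 1) \<in> conds S P xs" by (simp add: conds_def)
  then show ?thesis by blast
qed

lemma from_nat_conds: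
  "val S P (fst (from_nat_into (conds S P xs) t)) xs < of_rat (snd (from_nat_into (conds S P xs) t))"
  using from_nat_into[OF conds_nonempty, of xs t] by (auto simp: conds_def split: prod.splits)

text \<open>That some point satisfies finitely many conditions of \<open>w # xs\<close> is expressed
  by an \<open>FInf\<close> formula, hence transfers from \<open>xs\<close> to \<open>ys\<close>.
  The witnesses for longer and longer lists of conditions stay in one ball below the radius and
  accumulate at a point satisfying all of them. This is the one-point step behind all homogeneity
  arguments.\<close>

lemma Ext:
  assumes e: "same_type S P xs ys" and i: "i < length xs" and w: "w \<in> S" "P 0 [xs ! i, w] < radius S P (xs ! i)"
  shows "\<exists>w'\<in>S. same_type S P (w # xs) (w' # ys)"
proof -
  have xy: "xs \<in> lists S" "ys \<in> lists S" "length ys = length xs" using e by (simp_all only: same_type_def)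
  obtain r where r: "P 0 [xs ! i, w] < of_rat r" "of_rat r < radius S P (xs ! i)"
    using of_rat_dense[OF w(2)] by blast
  \<comment> \<open>The first condition confines the witnesses to the \<open>r\<close>-ball at
    \<open>ys ! i\<close>; \<open>Suc i\<close> skips the bound variable, which is prepended as
    variable 0.\<close>
  define G where "G n = (FAtom 0 [Suc i, 0], r) # map (from_nat_into (conds S P (w # xs))) [0..<n]" for n
  have "\<exists>w'\<in>S. val S P (conj_frm (G n)) (w' # ys) < 0" for n
  proof -
    have "val S P (conj_frm (G n)) (w # xs) < 0"
      unfolding val_conj_frm using r(1) i from_nat_conds by (auto simp: G_def split: prod.splits) (metis fst_conv snd_conv)
    then have "val S P (FInf (conj_frm (G n))) xs < 0" using val_FInf_less[OF xy(1)] w by blast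
    then have "val S P (FInf (conj_frm (G n))) ys < 0" using e unfolding same_type_def by metis
    then show ?thesis using val_FInf_less[OF xy(2)] by blast
  qed
  then obtain f where f: "\<And>n. f n \<in> S" "\<And>n. val S P (conj_frm (G n)) (f n # ys) < 0" by metis
  have y: "ys ! i \<in> S" using xy i nth_S by metis
  have fd: "P 0 [ys ! i, f n] < of_rat r" for n
    using f(2)[of n] i xy by (auto simp: val_conj_frm G_def of_rat_minus)
  have "of_rat r < radius S P (ys ! i)" using r(2) same_type_radius[OF e i] by simp
  from ball_cpt[where \<sigma>=f, OF y this f(1) fd] obtain w' k where
    k: "w' \<in> S" "strict_mono (k::nat\<Rightarrow>nat)" "(\<lambda>n. P 0 [f (k n), w']) \<longlonglongrightarrow> 0" by blast
  have "same_type S P (w # xs) (w' # ys)"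
  proof (rule conds_limit[where \<sigma>="\<lambda>n. f (k n) # ys" and k=k])
    show "eventually (\<lambda>n. near P e (f (k n) # ys) (w' # ys)) sequentially" if "0 < e" for e
      using order_tendstoD(2)[OF k(3) that] by eventually_elim (simp add: near_refl xy that)
    fix n
    have "val S P (conj_frm (G (k n))) (f (k n) # ys) < 0" by (rule f)
    then show "\<forall>t<k n. val S P (fst (from_nat_into (conds S P (w # xs)) t)) (f (k n) # ys)
               < of_rat (snd (from_nat_into (conds S P (w # xs)) t))"
      by (auto simp: val_conj_frm G_def split: prod.splits)
  qed (use f k w xy in auto)
  with k(1) show ?thesis by blast
qed

lemma Ext_list:
  assumes "same_type S P xs ys" "u \<in> lists S" "\<forall>x\<in>set u. \<exists>y\<in>set xs. P 0 [y, x] < radius S P y"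
  shows "\<exists>u'. length u' = length u \<and> same_type S P (u @ xs) (u' @ ys)"
  using assms
proof (induction u)
  case (Cons a u)
  then obtain u' where u': "length u' = length u" "same_type S P (u @ xs) (u' @ ys)" by auto
  obtain y where y: "y \<in> set xs" "P 0 [y, a] < radius S P y" using Cons.prems by auto
  then obtain i where i: "i < length (u @ xs)" "(u @ xs) ! i = y"
    by (metis in_set_conv_nth Un_iff set_append)
  from Ext[OF u'(2) i(1), of a] Cons.prems y i obtain a' where "same_type S P (a # u @ xs) (a' # u' @ ys)"
    by auto
  with u' show ?case by (intro exI[of _ "a' # u'"]) auto
qed auto

end

section \<open>Chains\<close>

text \<open>The minimum makes the relation symmetric on the carrier, and for
  \<open>s \<le> 1\<close> each point stays within the radius of the other, as \<open>Ext\<close>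
  demands.\<close>

definition linked :: "'a set \<Rightarrow> 'a preds \<Rightarrow> real \<Rightarrow> 'a \<Rightarrow> 'a \<Rightarrow> bool" where
  "linked S P s x y \<longleftrightarrow> P 0 [x, y] < s * min (radius S P x) (radius S P y)"

text \<open>Membership in \<open>W\<close> is imposed on the steps only, so every list is chained to
  itself; a chain stays in \<open>W\<close> once its start lies there.\<close>

definition chained :: "'a set \<Rightarrow> 'a preds \<Rightarrow> real \<Rightarrow> 'a list set \<Rightarrow> 'a list \<Rightarrow> 'a list \<Rightarrow> bool" where
  "chained S P s W = (\<lambda>u v. u \<in> W \<and> v \<in> W \<and> list_all2 (linked S P s) u v)\<^sup>*\<^sup>*"

definition type_fibre :: "'a set \<Rightarrow> 'a preds \<Rightarrow> 'a list \<Rightarrow> 'a list set" where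
  "type_fibre S P xs = {u. same_type S P xs u}"

text \<open>Sublevel sets of formulas and exact type classes both have this property, so chains in
  either are transferred by one lemma.\<close>

definition type_closed :: "'a set \<Rightarrow> 'a preds \<Rightarrow> 'a list set \<Rightarrow> bool" where
  "type_closed S P W \<longleftrightarrow> W \<subseteq> lists S \<and> (\<forall>u\<in>W. \<forall>v. same_type S P u v \<longrightarrow> v \<in> W)"

lemma chained_refl: "chained S P s W u u"
  by (simp add: chained_def)

lemma chained_trans: "chained S P s W u v \<Longrightarrow> chained S P s W v w \<Longrightarrow> chained S P s W u w"
  unfolding chained_def by (rule rtranclp_trans)

lemma chained_step: "chained S P s W u v \<Longrightarrow> v \<in> W \<Longrightarrow> w \<in> W \<Longrightarrow> list_all2 (linked S P s) v w \<Longrightarrow> chained S P s W u w"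
  unfolding chained_def by (rule rtranclp.rtrancl_into_rtrancl) auto

lemma chained_induct [consumes 1, case_names base step]:
  assumes "chained S P s W u v" "Q u"
    "\<And>v w. chained S P s W u v \<Longrightarrow> v \<in> W \<Longrightarrow> w \<in> W \<Longrightarrow> list_all2 (linked S P s) v w \<Longrightarrow> Q v \<Longrightarrow> Q w"
  shows "Q v"
  using assms(1) unfolding chained_def
  by (induction rule: rtranclp_induct) (use assms(2,3) in \<open>auto simp: chained_def\<close>)

lemma chained_in: "chained S P s W u v \<Longrightarrow> u \<in> W \<Longrightarrow> v \<in> W"
  by (induction rule: chained_induct) auto

lemma chained_length: "chained S P s W u v \<Longrightarrow> length v = length u"
  by (induction rule: chained_induct) (auto dest: list_all2_lengthD)

lemma chained_map_nth:
  assumes "chained S P s W u v" "\<And>w. w \<in> W \<Longrightarrow> length w = length u \<Longrightarrow> map (nth w) I \<in> W'" "set I \<subseteq> {..<length u}"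
  shows "chained S P s W' (map (nth u) I) (map (nth v) I)"
  using assms(1)
proof (induction rule: chained_induct)
  case (step v w)
  have l: "length v = length u" "length w = length u"
    using step.hyps chained_length list_all2_lengthD by metis+
  then have "list_all2 (linked S P s) (map (nth v) I) (map (nth w) I)"
    using step.hyps(4) assms(3) by (auto simp: list_all2_conv_all_nth subset_iff)
  with step assms(2) l show ?case by (blast intro: chained_step)
qed (rule chained_refl)

lemma type_closed_type_fibre: "type_closed S P (type_fibre S P xs)"
  unfolding type_closed_def type_fibre_def using same_type_trans same_type_lists by blast

lemma type_fibre_lists: "u \<in> type_fibre S P xs \<Longrightarrow> u \<in> lists S"
  unfolding type_fibre_def using same_type_lists(2) by blast

lemma type_closed_lists: "type_closed S P W \<Longrightarrow> u \<in> W \<Longrightarrow> u \<in> lists S"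
  unfolding type_closed_def by blast

lemma same_type_take: "same_type S P u v \<Longrightarrow> same_type S P (take n u) (take n v)"
  using same_type_parts(1)[of S P "take n u" "drop n u" "take n v" "drop n v"] same_type_length[of S P u v]
  by simp

lemma same_type_takes:
  assumes "same_type S P (a @ b) (a' @ b')" "length a = length a'"
  shows "same_type S P (take i a @ take j b) (take i a' @ take j b')"
proof -
  have "same_type S P (take i a @ drop i a @ b) (take i a' @ drop i a' @ b')"
    using assms(1) by (metis append.assoc append_take_drop_id)
  then have "same_type S P (take i a @ b) (take i a' @ b')"
    by (rule same_type_drop_mid) (use assms(2) in auto)
  moreover have "take (length c + j) (c @ d) = c @ take j d" for c d :: "'a list"
    by simp
  moreover have "length (take i a) = length (take i a')" using assms(2) by simp
  ultimately show ?thesis using same_type_take[of S P _ _ "length (take i a) + j"] by metis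
qed

context lc_preds
begin

lemma list_all2_linked_sym:
  "list_all2 (linked S P s) u v \<Longrightarrow> u \<in> lists S \<Longrightarrow> v \<in> lists S \<Longrightarrow> list_all2 (linked S P s) v u"
  unfolding list_all2_conv_all_nth linked_def by (metis dist_sym min.commute nth_S)

lemma chained_sym:
  assumes "chained S P s W u v" "W \<subseteq> lists S"
  shows "chained S P s W v u"
  using assms(1)
proof (induction rule: chained_induct)
  case (step v w)
  have "chained S P s W w v"
    by (rule chained_step[OF chained_refl]) (use step assms(2) in \<open>auto intro: list_all2_linked_sym\<close>)
  then show ?case using step chained_trans by blast
qed (rule chained_refl)

lemma chained_mono:
  assumes "chained S P s W u v" "W \<subseteq> W'" "s \<le> s'"
  shows "chained S P s' W' u v"
  using assms(1)
proof (induction rule: chained_induct)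
  case (step v w)
  have "linked S P s' x y" if "linked S P s x y" for x y
    using that assms(3) mult_right_mono[of s s' "min (radius S P x) (radius S P y)"]
      radius_nonneg[of S P x] radius_nonneg[of S P y] by (simp add: linked_def)
  then have "list_all2 (linked S P s') v w" using step.hyps(4) list_all2_mono by blast
  then show ?case using step assms(2) by (blast intro: chained_step)
qed (rule chained_refl)

text \<open>Every step of the chain is shorter than the radius, so \<open>Ext_list\<close> copies it
  to the other side. The parameters \<open>z @ r\<close> are carried along to preserve the position
  of the end of the chain relative to them.\<close>

lemma chained_transfer:
  assumes e: "same_type S P (z @ r) (z' @ r')" "length z = length z'" and W: "type_closed S P W"
    and s: "0 \<le> s" "s \<le> 1" and c: "chained S P s W z v"
  shows "\<exists>v'. length v' = length v \<and> chained S P s W z' v' \<and> same_type S P (v @ z @ r) (v' @ z' @ r')"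
  using c
proof (induction rule: chained_induct)
  case base
  show ?case using chained_refl same_type_parts(4)[OF e] e(2) by metis
next
  case (step v u)
  then obtain v' where v': "length v' = length v" "chained S P s W z' v'"
    "same_type S P (v @ z @ r) (v' @ z' @ r')" by blast
  have l: "length v = length u" using step by (auto dest: list_all2_lengthD)
  have "P 0 [v ! i, u ! i] < radius S P (v ! i)" if "i < length u" for i
  proof -
    have "P 0 [v ! i, u ! i] < s * min (radius S P (v ! i)) (radius S P (u ! i))"
      using step.hyps(4) that by (auto simp: list_all2_conv_all_nth linked_def)
    also have "\<dots> \<le> 1 * radius S P (v ! i)"
      using s radius_nonneg[of S P] by (intro mult_mono) auto
    finally show ?thesis by simp
  qed
  then have "\<forall>x\<in>set u. \<exists>y\<in>set (v @ z @ r). P 0 [y, x] < radius S P y"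
    using l by (metis Un_iff in_set_conv_nth set_append)
  moreover have "u \<in> lists S" using W step.hyps(3) by (auto simp: type_closed_def)
  ultimately obtain u' where u': "length u' = length u"
    "same_type S P (u @ v @ z @ r) (u' @ v' @ z' @ r')" using Ext_list[OF v'(3)] by blast
  have "same_type S P ((u @ v) @ z @ r) ((u' @ v') @ z' @ r')" using u' by simp
  from same_type_parts(1)[OF this] have uv: "same_type S P (u @ v) (u' @ v')" using u' v' by simp
  from same_type_parts(3)[OF this] u' have vu: "same_type S P (v @ u) (v' @ u')" by simp
  have "same_type S P u u'" using same_type_parts(1)[OF uv] u' by simp
  then have u'W: "u' \<in> W" using W step.hyps(3) by (auto simp: type_closed_def)
  have "same_type S P v v'" using same_type_parts(1)[OF vu] v' by simp
  then have v'W: "v' \<in> W" using W step.hyps(2) by (auto simp: type_closed_def)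
  have "list_all2 (linked S P s) v' u'"
    using same_type_all2[OF vu, where R = "\<lambda>d r r'. d < s * min r r'"] step.hyps(4) v'(1)
    unfolding linked_def[abs_def] by simp
  then have "chained S P s W z' u'" using v'(2) v'W u'W chained_step by blast
  \<comment> \<open>The previous tuple \<open>v\<close> was needed to anchor \<open>u\<close>; it is
    now dropped to restore the invariant.\<close>
  moreover have "same_type S P (u @ z @ r) (u' @ z' @ r')"
    using same_type_drop_mid[OF u'(2)] u'(1) v'(1) by simp
  ultimately show ?case using u'(1) by blast
qed

lemma finite_net:
  assumes "xs \<in> lists S" "0 < e"
  shows "\<exists>F. finite F \<and> F \<subseteq> lists S \<and> (\<forall>v\<in>lists S. half_near S P xs v \<longrightarrow> (\<exists>f\<in>F. near P e f v))"
  using assms(1)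
proof (induction xs rule: list.induct)
  case Nil
  show ?case by (intro exI[of _ "{[]}"]) (auto simp: half_near_def near_def)
next
  case (Cons x xs)
  then obtain F where F: "finite F" "F \<subseteq> lists S"
    "\<And>v. v\<in>lists S \<Longrightarrow> half_near S P xs v \<Longrightarrow> (\<exists>f\<in>F. near P e f v)" by auto
  obtain n where n: "1 / real (Suc n) < e" using assms(2) nat_approx_posE by blast
  have "radius S P x / 2 < radius S P x" using radius_pos Cons.prems by auto
  from radius_tb_ball[OF this] radius_nonneg[of S P x] have "tb_ball S P x (radius S P x / 2)" by simp
  then obtain F0 where F0: "set F0 \<subseteq> S"
    "\<And>y. y \<in> S \<Longrightarrow> P 0 [x, y] < radius S P x / 2 \<Longrightarrow> (\<exists>f\<in>set F0. P 0 [f, y] < 1 / real (Suc n))"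
    unfolding tb_ball_def by meson
  show ?case
  proof (intro exI[of _ "(\<lambda>(f, g). f # g) ` (set F0 \<times> F)"] conjI ballI impI)
    show "finite ((\<lambda>(f, g). f # g) ` (set F0 \<times> F))" using F by simp
    show "(\<lambda>(f, g). f # g) ` (set F0 \<times> F) \<subseteq> lists S" using F(2) F0(1) by fastforce
    fix v assume v: "v \<in> lists S" "half_near S P (x # xs) v"
    then obtain y w where yw: "v = y # w" "P 0 [x, y] < radius S P x / 2" "half_near S P xs w"
      unfolding half_near_def list_all2_Cons1 by blast
    then have yw': "y \<in> S" "w \<in> lists S" using v(1) by auto
    obtain f where "f \<in> set F0" "P 0 [f, y] < 1 / real (Suc n)" using F0(2)[OF yw'(1) yw(2)] by blast
    moreover obtain g where "g \<in> F" "near P e g w" using F(3)[OF yw'(2) yw(3)] by blast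
    ultimately show "\<exists>f\<in>(\<lambda>(f, g). f # g) ` (set F0 \<times> F). near P e f v"
      using n yw(1) by (intro bexI[of _ "f # g"]) auto
  qed
qed

text \<open>Compactness: counterexamples meeting longer and longer lists of conditions would
  accumulate at a tuple of the type of \<open>xs\<close>, and would then be close to the type class
  after all. Thus finitely many open conditions can replace a type locally.\<close>

lemma near_type_fibre:
  assumes xs: "xs \<in> lists S" and e: "0 < e"
  shows "\<exists>G. set G \<subseteq> conds S P xs \<and> (\<forall>v\<in>lists S. half_near S P xs v \<longrightarrow>
     (\<forall>(\<phi>, q)\<in>set G. val S P \<phi> v < of_rat q) \<longrightarrow> (\<exists>u\<in>type_fibre S P xs. near P e v u))"
proof (rule ccontr)
  assume neg: "\<not> ?thesis"
  define G where "G n = map (from_nat_into (conds S P xs)) [0..<n]" for n :: nat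
  have "\<exists>v\<in>lists S. half_near S P xs v \<and> (\<forall>(\<phi>, q)\<in>set (G n). val S P \<phi> v < of_rat q) \<and>
    \<not> (\<exists>u\<in>type_fibre S P xs. near P e v u)" for n
  proof -
    have "set (G n) \<subseteq> conds S P xs" using from_nat_into[OF conds_nonempty] by (auto simp: G_def)
    then show ?thesis using neg by blast
  qed
  then obtain v where v: "\<And>n. v n \<in> lists S" "\<And>n. half_near S P xs (v n)"
    "\<And>n. \<forall>(\<phi>, q)\<in>set (G n). val S P \<phi> (v n) < of_rat q"
    "\<And>n. \<not> (\<exists>u\<in>type_fibre S P xs. near P e (v n) u)" by metis
  from list_cpt[where \<sigma>=v, OF xs v(1,2)] obtain l k where l: "l \<in> lists S" "length l = length xs"
    "strict_mono (k::nat\<Rightarrow>nat)" "\<forall>e>0. eventually (\<lambda>n. near P e (v (k n)) l) sequentially" by blast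
  have "same_type S P xs l"
  proof (rule conds_limit[where \<sigma>="\<lambda>n. v (k n)" and k=k])
    fix n
    show "\<forall>t<k n. val S P (fst (from_nat_into (conds S P xs) t)) (v (k n))
               < of_rat (snd (from_nat_into (conds S P xs) t))"
      using v(3)[of "k n"] by (auto simp: G_def split: prod.splits)
  qed (use l v xs in auto)
  then have "l \<in> type_fibre S P xs" by (simp add: type_fibre_def)
  moreover obtain n where "near P e (v (k n)) l"
    using l(4) e by (meson eventually_sequentially order_refl)
  ultimately show False using v(4) by blast
qed

text \<open>Homogeneity: \<open>v\<close> is copied from \<open>z\<close> over to \<open>xs\<close>,
  the hypothesis at \<open>xs\<close> is applied, and the point found is copied back to
  \<open>z\<close>. The way back is possible because half a radius plus \<open>e\<close> is still
  less than the radius.\<close>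

lemma near_type_fibre_hom:
  assumes W: "type_closed S P W"
    and H: "\<And>v. v \<in> W \<Longrightarrow> half_near S P xs v \<Longrightarrow> \<exists>u\<in>type_fibre S P xs. near P e v u"
    and e: "\<And>x. x \<in> set xs \<Longrightarrow> e \<le> radius S P x / 4"
    and z: "z \<in> type_fibre S P xs" and v: "v \<in> W" "half_near S P z v"
  shows "\<exists>u\<in>type_fibre S P xs. near P e v u"
proof -
  have xz: "same_type S P xs z" "xs \<in> lists S" "z \<in> lists S" using z same_type_lists[of S P xs z] by (simp_all add: type_fibre_def)
  have vS: "v \<in> lists S" using W v(1) by (auto simp: type_closed_def)
  have lz: "length z = length v" "length xs = length z" using v(2) same_type_length[OF xz(1)]
    by (auto simp: half_near_def dest: list_all2_lengthD)
  have pos: "0 < radius S P x" if "x \<in> S" for x using that radius_pos by blast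
  have "P 0 [z ! i, v ! i] < radius S P (z ! i)" if "i < length v" for i
  proof -
    have "P 0 [z ! i, v ! i] < radius S P (z ! i) / 2"
      using v(2) that lz by (auto simp: half_near_def list_all2_conv_all_nth)
    then show ?thesis using radius_nonneg[of S P "z ! i"] by linarith
  qed
  then have "\<forall>x\<in>set v. \<exists>y\<in>set z. P 0 [y, x] < radius S P y"
    using lz(1) by (metis in_set_conv_nth)
  from Ext_list[OF same_type_sym[OF xz(1)] vS this] obtain v' where
    v': "length v' = length v" "same_type S P (v @ z) (v' @ xs)" by blast
  have "half_near S P xs v'"
    using same_type_half_near[OF same_type_parts(3)[OF v'(2)]] v'(1) lz v(2) by simp
  moreover have "same_type S P v v'" using same_type_parts(1)[OF v'(2)] v'(1) by simp
  then have v'W: "v' \<in> W" using W v(1) by (auto simp: type_closed_def)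
  ultimately obtain u' where u': "u' \<in> type_fibre S P xs" "near P e v' u'" using H by blast
  have v'S: "v' \<in> lists S" "u' \<in> lists S" using type_closed_lists[OF W v'W] type_fibre_lists[OF u'(1)] .
  have lu: "length u' = length xs" using u'(1) same_type_length[of S P xs u'] by (simp add: type_fibre_def)
  have "P 0 [xs ! i, u' ! i] < radius S P (xs ! i)" if i: "i < length u'" for i
  proof -
    have "P 0 [xs ! i, v' ! i] < radius S P (xs ! i) / 2"
      using \<open>half_near S P xs v'\<close> i lu by (auto simp: half_near_def list_all2_conv_all_nth)
    moreover have "P 0 [v' ! i, u' ! i] < e"
      using u'(2) i lu lz v'(1) by (auto simp: near_nth)
    moreover have "e \<le> radius S P (xs ! i) / 4" using e i lu by auto
    moreover have "P 0 [xs ! i, u' ! i] \<le> P 0 [xs ! i, v' ! i] + P 0 [v' ! i, u' ! i]"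
      using i lu lz v'(1) v'S xz(2) by (intro dist_tri nth_S) auto
    moreover have "0 \<le> radius S P (xs ! i)" by (rule radius_nonneg)
    ultimately show ?thesis by linarith
  qed
  then have "\<forall>x\<in>set u'. \<exists>y\<in>set (v' @ xs). P 0 [y, x] < radius S P y"
    using lu by (metis Un_iff in_set_conv_nth set_append)
  from Ext_list[OF same_type_sym[OF v'(2)] v'S(2) this] obtain u where
    u: "length u = length u'" "same_type S P (u' @ v' @ xs) (u @ v @ z)" by blast
  have "same_type S P ((u' @ v') @ xs) ((u @ v) @ z)" using u by simp
  from same_type_parts(1)[OF this] have uv: "same_type S P (u' @ v') (u @ v)" using u v' by simp
  have "near P e v u" using same_type_near[OF same_type_parts(3)[OF uv]] u u'(2) v'(1) by simp
  moreover have "u \<in> type_fibre S P xs"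
    using same_type_parts(1)[OF uv] u(1) u'(1) type_closed_type_fibre[of S P xs] by (auto simp: type_closed_def)
  ultimately show ?thesis by blast
qed

text \<open>Shadowing, by induction along the chain. Of the \<open>3 * e\<close>, one pays for the
  displacement of each end of a step and one for the change of radius between \<open>v\<close> and
  its shadow; radii are constant on the type class.\<close>

lemma chained_near_type_fibre:
  assumes W: "type_closed S P W" and xs: "xs \<in> W"
    and H: "\<And>v. v \<in> W \<Longrightarrow> half_near S P xs v \<Longrightarrow> \<exists>u\<in>type_fibre S P xs. near P e v u"
    and s: "0 < s" "s < s'" "s' \<le> 1/4"
    and e: "0 < e" "\<And>x. x \<in> set xs \<Longrightarrow> 3 * e \<le> (s' - s) * radius S P x"
    and c: "chained S P s W xs v"
  shows "\<exists>u. chained S P s' (type_fibre S P xs) xs u \<and> near P e v u"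
  using c
proof (induction rule: chained_induct)
  case base
  have "xs \<in> lists S" using xs W by (auto simp: type_closed_def)
  then show ?case using chained_refl near_refl[OF _ e(1)] by blast
next
  case (step v w)
  then obtain z where z: "chained S P s' (type_fibre S P xs) xs z" "near P e v z" by blast
  have xc: "xs \<in> type_fibre S P xs" using xs W same_type_refl[of xs S P] by (auto simp: type_fibre_def type_closed_def)
  then have zc: "z \<in> type_fibre S P xs" using chained_in z(1) by blast
  have S: "xs \<in> lists S" "v \<in> lists S" "w \<in> lists S" "z \<in> lists S"
    using type_closed_lists[OF W] xs step.hyps type_fibre_lists[OF zc] by blast+
  have "length v = length xs" using chained_length[OF step.hyps(1)] .
  then have l: "length z = length xs" "length v = length xs" "length w = length xs"
    using chained_length[OF z(1)] list_all2_lengthD[OF step.hyps(4)] by auto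
  have rz: "radius S P (z ! i) = radius S P (xs ! i)" if "i < length xs" for i
    using same_type_radius[of S P xs z i] zc that by (simp add: type_fibre_def)
  have e1: "3 * e \<le> (s' - s) * radius S P (xs ! i)" if "i < length xs" for i using e(2) that by auto
  have e4: "e \<le> radius S P (xs ! i) / 4 / 3" if "i < length xs" for i
  proof -
    have "(s' - s) * radius S P (xs ! i) \<le> 1/4 * radius S P (xs ! i)"
      using s radius_nonneg[of S P] by (intro mult_right_mono) auto
    then show ?thesis using e1[OF that] by linarith
  qed
  have d: "P 0 [z ! i, w ! i] < 2 * e + s * radius S P (xs ! i)" if i: "i < length xs" for i
  proof -
    have iS: "z ! i \<in> S" "v ! i \<in> S" "w ! i \<in> S" using i l S nth_S by metis+
    have "P 0 [z ! i, v ! i] < e"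
      using z(2) i l dist_sym[OF iS(1,2)] by (auto simp: near_nth)
    moreover have "P 0 [v ! i, w ! i] < s * min (radius S P (v ! i)) (radius S P (w ! i))"
      using step.hyps(4) i l by (auto simp: list_all2_conv_all_nth linked_def)
    moreover have "s * min (radius S P (v ! i)) (radius S P (w ! i)) \<le> s * (radius S P (xs ! i) + e)"
      using s(1) radius_lip[OF iS(1,2)] calculation(1) rz[OF i] by (intro mult_left_mono) auto
    moreover have "s * e \<le> 1 * e" using s e(1) by (intro mult_right_mono) auto
    moreover have "s * (radius S P (xs ! i) + e) = s * radius S P (xs ! i) + s * e" by (simp add: algebra_simps)
    moreover note dist_tri[OF iS]
    ultimately show ?thesis by linarith
  qed
  have sm: "s * radius S P (xs ! i) \<le> 1/4 * radius S P (xs ! i)" for i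
    using s radius_nonneg[of S P] by (intro mult_right_mono) auto
  \<comment> \<open>Here \<open>2 * e\<close> is at most a sixth and \<open>s\<close> at most a
    quarter of the radius, which together stay below one half.\<close>
  have "half_near S P z w"
    unfolding half_near_def list_all2_conv_all_nth
  proof (intro conjI allI impI)
    fix i assume "i < length z"
    then have i: "i < length xs" using l by simp
    show "P 0 [z ! i, w ! i] < radius S P (z ! i) / 2"
      using d[OF i] e4[OF i] sm[of i] rz[OF i] radius_nonneg[of S P "xs ! i"] by linarith
  qed (use l in simp)
  moreover have "e \<le> radius S P x / 4" if x: "x \<in> set xs" for x
  proof -
    obtain i where i: "i < length xs" "xs ! i = x" using x unfolding in_set_conv_nth by blast
    show ?thesis using e4[OF i(1)] radius_nonneg[of S P x] unfolding i(2) by linarith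
  qed
  ultimately obtain u where u: "u \<in> type_fibre S P xs" "near P e w u"
    using near_type_fibre_hom[OF W H _ zc step.hyps(3)] by blast
  have lu: "length u = length xs" using u(2) l near_length by metis
  have uS: "u \<in> lists S" using type_fibre_lists[OF u(1)] .
  have "list_all2 (linked S P s') z u"
    unfolding list_all2_conv_all_nth
  proof (intro conjI allI impI)
    fix i assume "i < length z"
    then have i: "i < length xs" using l by simp
    have iS: "z ! i \<in> S" "w ! i \<in> S" "u ! i \<in> S" using i l lu S uS nth_S by metis+
    have "P 0 [w ! i, u ! i] < e" using u(2) i l by (auto simp: near_nth)
    then have "P 0 [z ! i, u ! i] < 3 * e + s * radius S P (xs ! i)"
      using d[OF i] dist_tri[OF iS] by linarith
    also have "\<dots> \<le> s' * radius S P (xs ! i)" using e1[OF i] by (simp add: algebra_simps)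
    finally have "P 0 [z ! i, u ! i] < s' * radius S P (xs ! i)" .
    moreover have "radius S P (u ! i) = radius S P (xs ! i)"
      using same_type_radius[of S P xs u i] u(1) i by (simp add: type_fibre_def)
    ultimately show "linked S P s' (z ! i) (u ! i)" using rz[OF i] by (simp add: linked_def)
  qed (use l lu in simp)
  then have "chained S P s' (type_fibre S P xs) xs u" using chained_step[OF z(1) zc u(1)] by blast
  with u(2) show ?case by blast
qed

end

section \<open>Stabilisation of projected components along a dense sequence\<close>

locale dense_preds = lc_preds S P for S :: "'a set" and P +
  fixes a :: "nat \<Rightarrow> 'a"
  assumes a_S: "a i \<in> S"
    and a_dense: "x \<in> S \<Longrightarrow> 0 < e \<Longrightarrow> \<exists>i. P 0 [a i, x] < e"
begin

abbreviation initial :: "nat \<Rightarrow> 'a list" where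
  "initial n \<equiv> map a [0..<n]"

text \<open>The component is taken inside the exact type class, where homogeneity is available;
  \<open>reach_absorbs\<close> compares it with components of open sets.\<close>

definition reach :: "real \<Rightarrow> nat \<Rightarrow> 'a list set" where
  "reach s n = {v. chained S P s (type_fibre S P (initial n)) (initial n) v}"

lemma initial_S [simp]: "map a I \<in> lists S"
  using a_S by auto

lemma take_initial: "n \<le> m \<Longrightarrow> take n (initial m) = initial n"
  by (simp add: take_map)

lemma initial_reach: "initial n \<in> reach s n"
  by (simp add: reach_def chained_refl)

lemma initial_type_fibre: "initial n \<in> type_fibre S P (initial n)"
  by (simp add: type_fibre_def same_type_refl del: in_lists_conv_set)

lemma reach_type_fibre: "v \<in> reach s n \<Longrightarrow> v \<in> type_fibre S P (initial n)"
  unfolding reach_def using chained_in[OF _ initial_type_fibre] by blast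

lemma reach_length: "v \<in> reach s n \<Longrightarrow> length v = n"
  using chained_length by (fastforce simp: reach_def)

lemma reach_radius: "v \<in> reach s n \<Longrightarrow> i < n \<Longrightarrow> radius S P (v ! i) = radius S P (a i)"
  using reach_type_fibre[of v s n] same_type_radius[of S P "initial n" v i] by (simp add: type_fibre_def)

lemma reach_take:
  assumes "v \<in> reach s m" "n \<le> m"
  shows "take n v \<in> reach s n"
proof -
  have "map (nth w) [0..<n] = take n w" if "length w = m" for w :: "'a list"
    using that assms(2) by (intro nth_equalityI) auto
  moreover have "take n w \<in> type_fibre S P (initial n)" if "w \<in> type_fibre S P (initial m)" for w
    using that same_type_take[of S P "initial m" w n] assms(2) by (simp add: type_fibre_def take_map)
  moreover have "length w = m" if "w \<in> type_fibre S P (initial m)" for w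
    using that same_type_length[of S P "initial m" w] by (simp add: type_fibre_def)
  moreover have "{0..<n} \<subseteq> {..<m}" using assms(2) by auto
  ultimately have "chained S P s (type_fibre S P (initial n)) (take n (initial m)) (take n v)"
    using chained_map_nth[of S P s "type_fibre S P (initial m)" "initial m" v "[0..<n]" "type_fibre S P (initial n)"]
      assms reach_length[OF assms(1)] by (simp add: reach_def)
  then show ?thesis using take_initial[OF assms(2)] by (simp add: reach_def)
qed

text \<open>The sets \<open>take j ` reach s n\<close> decrease with \<open>n\<close> and all contain \<open>initial j\<close>, so near the totally
  bounded neighbourhood \<open>half_near S P (initial j)\<close> they stabilise up to \<open>e\<close>.\<close>

lemma reach_stable:
  assumes j: "j \<le> n1" and e: "0 < e"
  shows "\<exists>n\<ge>n1. \<forall>m\<ge>n. \<forall>v\<in>reach s n. half_near S P (initial j) (take j v) \<longrightarrow>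
     (\<exists>w\<in>reach s m. near P e (take j w) (take j v))"
proof -
  obtain F where F: "finite F" "F \<subseteq> lists S"
    "\<And>v. v\<in>lists S \<Longrightarrow> half_near S P (initial j) v \<Longrightarrow> \<exists>f\<in>F. near P (e/2) f v"
    using finite_net[OF initial_S, of "e/2" "[0..<j]"] e by (metis half_gt_zero)
  define Q where "Q f m \<longleftrightarrow> (\<exists>w\<in>reach s m. near P (e/2) f (take j w))" for f m
  \<comment> \<open>If the net point \<open>f\<close> is missed at some stage from \<open>n1\<close>
    on, \<open>N f\<close> is such a stage. Beyond all \<open>N f\<close>, a net point that is still
    met stays met forever, because the projections decrease.\<close>
  define N where "N f = (if \<exists>m\<ge>n1. \<not> Q f m then SOME m. m \<ge> n1 \<and> \<not> Q f m else n1)" for f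
  define n where "n = Max (insert n1 (N ` F))"
  have n1: "n1 \<le> n" using F(1) by (simp add: n_def)
  have Nn: "N f \<le> n" if "f \<in> F" for f using F(1) that by (simp add: n_def)
  have N: "N f \<ge> n1 \<and> \<not> Q f (N f)" if "\<exists>m\<ge>n1. \<not> Q f m" for f
  proof -
    have "N f = (SOME m. m \<ge> n1 \<and> \<not> Q f m)" using that by (simp add: N_def)
    then show ?thesis using someI_ex[of "\<lambda>m. m \<ge> n1 \<and> \<not> Q f m"] that by auto
  qed
  have "\<exists>w\<in>reach s m. near P e (take j w) (take j v)"
    if m: "n \<le> m" and v: "v \<in> reach s n" "half_near S P (initial j) (take j v)" for m v
  proof -
    have vS: "v \<in> lists S" using type_fibre_lists[OF reach_type_fibre[OF v(1)]] .
    then have tvS: "take j v \<in> lists S" by (auto dest: in_set_takeD)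
    obtain f where f: "f \<in> F" "near P (e/2) f (take j v)" using F(3)[OF tvS v(2)] by blast
    have "Q f m"
    proof (rule ccontr)
      assume "\<not> Q f m"
      then have *: "n1 \<le> N f" "\<not> Q f (N f)" using N[of f] m n1 by (meson le_trans)+
      have "take (N f) v \<in> reach s (N f)" using reach_take[OF v(1) Nn[OF f(1)]] .
      moreover have "take j (take (N f) v) = take j v" using *(1) j by simp
      ultimately show False using *(2) f(2) unfolding Q_def by metis
    qed
    then obtain z where z: "z \<in> reach s m" "near P (e/2) f (take j z)" by (auto simp: Q_def)
    have "take j z \<in> lists S" using type_fibre_lists[OF reach_type_fibre[OF z(1)]] by (auto dest: in_set_takeD)
    moreover have "f \<in> lists S" using f F by blast
    ultimately have "near P (e/2 + e/2) (take j z) (take j v)"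
      using near_tri[OF near_sym[OF z(2)] f(2)] tvS by blast
    then show ?thesis using z(1) by (metis field_sum_of_halves)
  qed
  with n1 show ?thesis by blast
qed

text \<open>The stabilisation known at \<open>initial m\<close> holds at every \<open>z\<close> of
  its component: the chain from \<open>take n z\<close> to \<open>v\<close> is transferred to the
  base point, the hypothesis is applied there, and the chain found is transferred back to
  \<open>z\<close>.\<close>

lemma reach_hom:
  assumes nm: "j \<le> n" "n \<le> m" and s: "0 < s" "s \<le> 1"
    and H: "\<And>v. v \<in> reach s n \<Longrightarrow> half_near S P (initial j) (take j v) \<Longrightarrow> \<exists>w\<in>reach s m. near P e (take j w) (take j v)"
    and z: "z \<in> reach s m" and v: "v \<in> reach s n" and zv: "half_near S P (take j z) (take j v)"
  shows "\<exists>w\<in>reach s m. near P e (take j w) (take j v)"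
proof -
  have zS: "z \<in> lists S" using type_fibre_lists[OF reach_type_fibre[OF z]] .
  have lz: "length z = m" "length v = n" using z v reach_length by auto
  have zn: "take n z \<in> reach s n" using reach_take[OF z nm(2)] .
  have c: "chained S P s (type_fibre S P (initial n)) (take n z) v"
    using zn v chained_trans chained_sym[of s _ "initial n" "take n z"] type_fibre_lists unfolding reach_def by blast
  have e: "same_type S P z (initial m)" using reach_type_fibre[OF z] same_type_sym by (auto simp: type_fibre_def)
  then have "same_type S P (take n z @ drop n z) (initial n @ drop n (initial m))"
    using take_initial[OF nm(2)] by (metis append_take_drop_id)
  from chained_transfer[OF this _ type_closed_type_fibre _ s(2) c] s(1) lz nm obtain v' where
    v': "length v' = length v" "chained S P s (type_fibre S P (initial n)) (initial n) v'"
    "same_type S P (v @ take n z @ drop n z) (v' @ initial n @ drop n (initial m))" by auto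
  have vz: "same_type S P (v @ z) (v' @ initial m)"
    using v'(3) take_initial[OF nm(2)] by (metis append_take_drop_id)
  from same_type_parts(3)[OF this] v'(1) have zv': "same_type S P (z @ v) (initial m @ v')" by simp
  have "half_near S P (take j (initial m)) (take j v')"
    by (rule same_type_half_near[OF same_type_takes[OF zv'] _ zv]) (use lz nm in auto)
  then have "half_near S P (initial j) (take j v')" using take_initial[of j m] nm by simp
  then obtain z' where z': "z' \<in> reach s m" "near P e (take j z') (take j v')"
    using H[of v'] v'(2) by (auto simp: reach_def)
  from chained_transfer[OF same_type_sym[OF zv'] _ type_closed_type_fibre _ s(2), of "initial m" z'] z'(1) s(1) lz
  obtain w where w: "length w = length z'" "chained S P s (type_fibre S P (initial m)) z w"
    "same_type S P (z' @ initial m @ v') (w @ z @ v)" by (auto simp: reach_def)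
  have "same_type S P (z' @ v') (w @ v)" using same_type_drop_mid[OF w(3)] w(1) lz by simp
  from same_type_near[OF same_type_takes[OF this] _ z'(2)] w(1) have "near P e (take j w) (take j v)" by simp
  moreover have "w \<in> reach s m" using z w(2) chained_trans unfolding reach_def by blast
  ultimately show ?thesis by blast
qed

text \<open>Induction along the chain frees \<open>v\<close> from staying near the base point. An
  error of a quarter radius plus a step of a quarter radius stays within half a radius of the
  current approximation \<open>z\<close>, so \<open>reach_hom\<close> applies with \<open>z\<close>
  as new base point.\<close>

lemma reach_near:
  assumes nm: "j \<le> n" "n \<le> m" and s: "0 < s" "s \<le> 1/4"
    and H: "\<And>v. v \<in> reach s n \<Longrightarrow> half_near S P (initial j) (take j v) \<Longrightarrow> \<exists>w\<in>reach s m. near P e (take j w) (take j v)"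
    and e: "0 < e" "\<And>i. i < j \<Longrightarrow> e \<le> radius S P (a i) / 4"
    and v: "v \<in> reach s n"
  shows "\<exists>w\<in>reach s m. near P e (take j w) (take j v)"
proof -
  have "chained S P s (type_fibre S P (initial n)) (initial n) v" using v by (simp add: reach_def)
  then show ?thesis
  proof (induction rule: chained_induct)
    case base
    have "near P e (take j (initial m)) (take j (initial n))"
      using take_initial[of j m] take_initial[of j n] nm near_refl[OF initial_S e(1)] by simp
    then show ?case using initial_reach by blast
  next
    case (step v u)
    then obtain z where z: "z \<in> reach s m" "near P e (take j z) (take j v)" by blast
    have v: "v \<in> reach s n" using step by (simp add: reach_def)
    have u: "u \<in> reach s n" using step chained_step by (simp add: reach_def) blast
    have l: "length z = m" "length v = n" "length u = n" using z v u reach_length by auto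
    have S: "z \<in> lists S" "v \<in> lists S" "u \<in> lists S" using z v u reach_type_fibre type_fibre_lists by blast+
    have "half_near S P (take j z) (take j u)"
      unfolding half_near_def list_all2_conv_all_nth
    proof (intro conjI allI impI)
      show "length (take j z) = length (take j u)" using l nm by simp
      fix i assume "i < length (take j z)"
      then have i: "i < j" "i < m" "i < n" using l nm by auto
      have iS: "z ! i \<in> S" "v ! i \<in> S" "u ! i \<in> S" using i l S nth_S by metis+
      have "P 0 [z ! i, v ! i] < e" using z(2) i l by (auto simp: near_nth)
      moreover have "P 0 [v ! i, u ! i] < s * min (radius S P (v ! i)) (radius S P (u ! i))"
        using step.hyps(4) i l by (auto simp: list_all2_conv_all_nth linked_def)
      moreover have "s * min (radius S P (v ! i)) (radius S P (u ! i)) \<le> 1/4 * radius S P (a i)"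
        using s radius_nonneg[of S P] reach_radius[OF v i(3)] by (intro mult_mono) auto
      moreover note dist_tri[OF iS] e(2)[OF i(1)]
      ultimately show "P 0 [take j z ! i, take j u ! i] < radius S P (take j z ! i) / 2"
        using reach_radius[OF z(1) i(2)] i by simp
    qed
    from reach_hom[OF nm s(1) _ H z(1) u this] s(2) show ?case by simp
  qed
qed

lemma min_radius: "\<exists>c>0. \<forall>i<n. c \<le> radius S P (a i)"
proof (induction n)
  case (Suc n)
  then obtain c where c: "c > 0" "\<And>i. i < n \<Longrightarrow> c \<le> radius S P (a i)" by blast
  then show ?case
    using radius_pos[OF a_S] by (intro exI[of _ "min c (radius S P (a n))"]) (auto simp: less_Suc_eq min_le_iff_disj)
qed (auto intro: exI[of _ 1])

text \<open>A chain in \<open>W\<close> is first shadowed in the type class of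
  \<open>initial n\<close>, then its end is approximated from \<open>reach s' m\<close> by
  stabilisation; each costs at most \<open>e / 2\<close>. A finite \<open>G\<close> suffices
  although \<open>m\<close> is arbitrary.\<close>

lemma reach_absorbs:
  assumes j: "j \<le> n1" and e: "0 < e" and s: "0 < s" "s < s'" "s' \<le> 1/4"
  shows "\<exists>n\<ge>n1. \<exists>G. set G \<subseteq> conds S P (initial n) \<and>
     (\<forall>W. type_closed S P W \<longrightarrow> initial n \<in> W \<longrightarrow> (\<forall>v\<in>W. \<forall>(\<phi>, q)\<in>set G. val S P \<phi> v < of_rat q) \<longrightarrow>
       (\<forall>m\<ge>n. \<forall>v. chained S P s W (initial n) v \<longrightarrow>
         (\<exists>w\<in>reach s' m. near P e (take j v) (take j w))))"
proof -
  obtain c where c: "c > 0" "\<And>i. i < j \<Longrightarrow> c \<le> radius S P (a i)" using min_radius by blast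
  define e1 where "e1 = min (e/2) (c/4)"
  have e1': "0 < e1" "e1 \<le> e/2" "e1 \<le> c/4" using c e by (auto simp: e1_def)
  have e1: "e1 \<le> radius S P (a i) / 4" if "i < j" for i
    using e1' c(2)[OF that] by linarith
  obtain n where n: "n1 \<le> n" "\<And>m v. n \<le> m \<Longrightarrow> v \<in> reach s' n \<Longrightarrow> half_near S P (initial j) (take j v) \<Longrightarrow>
     (\<exists>w\<in>reach s' m. near P e1 (take j w) (take j v))"
    using reach_stable[OF j e1'(1), of s'] by blast
  obtain c' where c': "c' > 0" "\<And>i. i < n \<Longrightarrow> c' \<le> radius S P (a i)" using min_radius by blast
  \<comment> \<open>The precision of the shadowing may depend on \<open>n\<close>, since
    \<open>n\<close> was fixed by stabilisation at scale \<open>s'\<close> beforehand.\<close>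
  define e2 where "e2 = min (e/2) ((s' - s) * c' / 3)"
  have e2: "0 < e2" "e2 \<le> e/2" "3 * e2 \<le> (s' - s) * c'"
    using c' e s by (auto simp: e2_def)
  have e2': "3 * e2 \<le> (s' - s) * radius S P x" if x: "x \<in> set (initial n)" for x
  proof -
    have "(s' - s) * c' \<le> (s' - s) * radius S P x" using c'(2) s x by (intro mult_left_mono) auto
    then show ?thesis using e2 by linarith
  qed
  obtain G where G: "set G \<subseteq> conds S P (initial n)"
    "\<And>v. v\<in>lists S \<Longrightarrow> half_near S P (initial n) v \<Longrightarrow> (\<forall>(\<phi>, q)\<in>set G. val S P \<phi> v < of_rat q) \<Longrightarrow>
       (\<exists>u\<in>type_fibre S P (initial n). near P e2 v u)"
    using near_type_fibre[OF initial_S e2(1), of "[0..<n]"] by blast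
  have "\<exists>w\<in>reach s' m. near P e (take j v) (take j w)"
    if W: "type_closed S P W" "initial n \<in> W" "\<forall>v\<in>W. \<forall>(\<phi>, q)\<in>set G. val S P \<phi> v < of_rat q"
      and m: "n \<le> m" and v: "chained S P s W (initial n) v" for W m v
  proof -
    have "\<exists>u\<in>type_fibre S P (initial n). near P e2 v u" if "v \<in> W" "half_near S P (initial n) v" for v
      using G(2)[of v] that W(3) type_closed_lists[OF W(1)] by blast
    from chained_near_type_fibre[OF W(1,2) this s e2(1) e2' v]
    obtain u where u: "u \<in> reach s' n" "near P e2 v u" by (auto simp: reach_def)
    have "\<exists>w\<in>reach s' m. near P e1 (take j w) (take j u)"
      using reach_near[of j n m s' e1 u] n(2)[OF m] j n(1) m s e1' e1 u(1) by auto
    then obtain z where z: "z \<in> reach s' m" "near P e1 (take j z) (take j u)" by blast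
    have S: "v \<in> lists S" "u \<in> lists S" "z \<in> lists S"
      using type_closed_lists[OF W(1) chained_in[OF v W(2)]] reach_type_fibre[OF u(1)] reach_type_fibre[OF z(1)] type_fibre_lists by blast+
    then have S': "take j v \<in> lists S" "take j u \<in> lists S" "take j z \<in> lists S"
      by (auto dest: in_set_takeD)
    have "near P (e2 + e1) (take j v) (take j z)"
      by (rule near_tri[OF near_take[OF u(2)] near_sym[OF z(2)] S'(1,2,3)]) (use S' in auto)
    then have "near P e (take j v) (take j z)"
      by (rule near_mono) (use e1'(2) e2(2) in linarith)
    with z(1) show ?thesis by blast
  qed
  with n(1) G(1) show ?thesis by blast
qed

end

section \<open>The countable structure of components\<close>

text \<open>The second component of the decoded pair is ignored, so that every fibre of \<open>decode\<close> is infinite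
  and a bijection of components lifts to a bijection of the universe \<open>\<nat>\<close>.\<close>

definition decode :: "nat \<Rightarrow> frm \<times> rat \<times> rat \<times> nat list" where
  "decode x = fst (from_nat x :: (frm \<times> rat \<times> rat \<times> nat list) \<times> nat)"

definition sat :: "'a set \<Rightarrow> 'a preds \<Rightarrow> frm \<Rightarrow> rat \<Rightarrow> 'a list set" where
  "sat S P \<phi> q = {xs \<in> lists S. val S P \<phi> xs < of_rat q}"

text \<open>The base point \<open>js\<close> names the component but is absent from the label, so
  the value is the same for every member of the component taken as base point. \<open>None\<close>
  marks codes that name no component.\<close>

definition comp_of :: "'a set \<Rightarrow> 'a preds \<Rightarrow> (nat \<Rightarrow> 'a) \<Rightarrow> nat \<Rightarrow> ((nat \<times> frm \<times> rat \<times> rat) \<times> 'a list set) option" where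
  "comp_of S P a x = (case decode x of (\<phi>, q, s, js) \<Rightarrow>
     if 0 < s \<and> val S P \<phi> (map a js) < of_rat q
     then Some ((length js, \<phi>, q, s), {v. chained S P (of_rat s) (sat S P \<phi> q) (map a js) v}) else None)"

text \<open>Quantifying over \<open>t > e\<close> instead of using \<open>e\<close> itself makes the relation insensitive to
  replacing the points of \<open>C\<close> and \<open>C'\<close> by nearby points of a dense sequence.\<close>

definition covered :: "'a preds \<Rightarrow> nat list \<Rightarrow> rat \<Rightarrow> 'a list set \<Rightarrow> 'a list set \<Rightarrow> bool" where
  "covered P I e C C' \<longleftrightarrow> (\<forall>v\<in>C. \<forall>t>e. \<exists>w\<in>C'. near P (of_rat t) (map (nth v) I) (take (length I) w))"

text \<open>The natural number \<open>r\<close> decodes to a relation symbol, unary for labels and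
  binary for coverings. The bounds involving \<open>I\<close> exclude \<open>nth\<close> and
  \<open>take\<close> beyond the lengths of the tuples.\<close>

definition coded_rel :: "'a set \<Rightarrow> 'a preds \<Rightarrow> (nat \<Rightarrow> 'a) \<Rightarrow> nat \<Rightarrow> nat list \<Rightarrow> bool" where
  "coded_rel S P a r xs = (case from_nat r :: (nat \<times> frm \<times> rat \<times> rat) + (nat list \<times> rat) of
     Inl l \<Rightarrow> \<exists>x C. xs = [x] \<and> comp_of S P a x = Some (l, C)
   | Inr (I, e) \<Rightarrow> \<exists>x y l l' C C'. xs = [x, y] \<and> comp_of S P a x = Some (l, C) \<and>
       comp_of S P a y = Some (l', C') \<and> set I \<subseteq> {..<fst l} \<and> length I \<le> fst l' \<and> covered P I e C C')"

text \<open>This is the code of a structure, viewed as predicates on indices. Distinct indices may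
  name one point and limits may be missing, so it is studied by comparison with \<open>P\<close> on
  \<open>S\<close>, not by interpreting the locales for it.\<close>

definition pullback :: "'a preds \<Rightarrow> (nat \<Rightarrow> 'a) \<Rightarrow> nat preds" where
  "pullback P a i js = P i (map a js)"

lemma infinite_decode: "infinite {x. decode x = e}"
proof -
  have "inj (\<lambda>k::nat. to_nat (e, k))" by (auto intro!: injI)
  then have "infinite (range (\<lambda>k::nat. to_nat (e, k)))" using finite_imageD by blast
  moreover have "range (\<lambda>k::nat. to_nat (e, k)) \<subseteq> {x. decode x = e}" by (auto simp: decode_def)
  ultimately show ?thesis using finite_subset by blast
qed

lemma decode_surj: "\<exists>x. decode x = e"
  using infinite_decode[of e] by (metis (mono_tags) Collect_empty_eq finite.emptyI)

lemma infinite_comp_of: "infinite {x. comp_of S P a x = comp_of S P a y}"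
proof -
  have "{x. decode x = decode y} \<subseteq> {x. comp_of S P a x = comp_of S P a y}" by (auto simp: comp_of_def)
  then show ?thesis using infinite_decode finite_subset by blast
qed

text \<open>Corresponding fibres are infinite sets of natural numbers, hence in bijection; the
  bijections are glued over the common range.\<close>

lemma bij_of_fibres:
  fixes f g :: "nat \<Rightarrow> 'c"
  assumes r: "range f = range g" and inf: "\<And>y. infinite {x. f x = f y}" "\<And>y. infinite {x. g x = g y}"
  shows "\<exists>h. bij h \<and> (\<forall>x. g (h x) = f x)"
proof -
  have "\<exists>k. bij_betw k {x. f x = c} {x. g x = c}" if "c \<in> range f" for c
  proof -
    have "infinite {x. f x = c}" using that inf(1) by auto
    moreover have "c \<in> range g" using that r by simp
    then have "infinite {x. g x = c}" using inf(2) by auto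
    ultimately show ?thesis
      using bij_betw_trans[OF bij_betw_inv_into[OF bij_enumerate] bij_enumerate] by blast
  qed
  then obtain k where k: "\<And>c. c \<in> range f \<Longrightarrow> bij_betw (k c) {x. f x = c} {x. g x = c}" by metis
  define h where "h x = k (f x) x" for x
  have gh: "g (h x) = f x" for x
    using bij_betw_apply[OF k[of "f x"], of x] by (simp add: h_def)
  have "bij h"
  proof (rule bijI)
    show "inj h"
    proof (rule injI)
      fix x y assume e: "h x = h y"
      then have "f x = f y" using gh by metis
      then show "x = y"
        using e bij_betw_imp_inj_on[OF k[of "f x"]] by (auto simp: h_def inj_on_def)
    qed
    show "surj h"
      unfolding surj_def
    proof
      fix y
      have "g y \<in> range f" using r by simp
      from bij_betw_imp_surj_on[OF k[OF this]] have "y \<in> k (g y) ` {x. f x = g y}" by simp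
      then obtain x where "f x = g y" "k (g y) x = y" by auto
      then show "\<exists>x. y = h x" by (metis h_def)
    qed
  qed
  with gh show ?thesis by blast
qed

lemma near_pullback: "near (pullback P a) e js ks = near P e (map a js) (map a ks)"
  by (simp add: near_def pullback_def list_all2_map1 list_all2_map2)

section \<open>Openness of sublevel sets and of chain steps\<close>

context lc_preds
begin

lemma sat_lists: "sat S P \<phi> q \<subseteq> lists S"
  by (auto simp: sat_def)

lemma sat_type_closed: "type_closed S P (sat S P \<phi> q)"
  unfolding type_closed_def sat_def same_type_def by auto

lemma sat_open:
  assumes "v \<in> sat S P \<phi> q"
  shows "\<exists>\<eta>>0. \<forall>u\<in>lists S. near P \<eta> u v \<longrightarrow> u \<in> sat S P \<phi> q"
proof -
  have v: "v \<in> lists S" "0 < of_rat q - val S P \<phi> v" using assms by (auto simp: sat_def)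
  from val_uc[OF v(2)] obtain \<delta> where \<delta>: "\<delta> > 0" "\<forall>xs\<in>lists S. \<forall>ys\<in>lists S. length xs = length v \<longrightarrow>
      near P \<delta> xs ys \<longrightarrow> \<bar>val S P \<phi> xs - val S P \<phi> ys\<bar> < of_rat q - val S P \<phi> v" by blast
  have "u \<in> sat S P \<phi> q" if u: "u \<in> lists S" "near P \<delta> u v" for u
  proof -
    have "\<bar>val S P \<phi> u - val S P \<phi> v\<bar> < of_rat q - val S P \<phi> v"
      using \<delta>(2) u v near_length by blast
    then show ?thesis using u by (auto simp: sat_def)
  qed
  with \<delta>(1) show ?thesis by blast
qed

lemma linked_open:
  assumes "0 < s" "linked S P s x y" "x \<in> S" "y \<in> S"
  shows "\<exists>\<eta>>0. \<forall>x'\<in>S. \<forall>y'\<in>S. P 0 [x', x] < \<eta> \<longrightarrow> P 0 [y', y] < \<eta> \<longrightarrow> linked S P s x' y'"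
proof -
  define m where "m = min (radius S P x) (radius S P y)"
  \<comment> \<open>Moving both ends costs \<open>2 * \<eta>\<close> in distance and
    \<open>s * \<eta>\<close> in the bound; the third \<open>\<eta>\<close> is slack.\<close>
  define \<eta> where "\<eta> = (s * m - P 0 [x, y]) / (3 + s)"
  have g: "0 < s * m - P 0 [x, y]" using assms by (simp add: linked_def m_def)
  have \<eta>: "0 < \<eta>" using g assms(1) by (simp add: \<eta>_def)
  have \<eta>2: "3 * \<eta> + s * \<eta> = s * m - P 0 [x, y]"
  proof -
    have "(3 + s) * \<eta> = s * m - P 0 [x, y]" using assms(1) by (simp add: \<eta>_def)
    then show ?thesis by (simp add: algebra_simps)
  qed
  have "linked S P s x' y'" if a: "x' \<in> S" "y' \<in> S" "P 0 [x', x] < \<eta>" "P 0 [y', y] < \<eta>" for x' y'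
  proof -
    have "P 0 [x', y'] \<le> P 0 [x', x] + P 0 [x, y] + P 0 [y, y']"
      using dist_tri[OF a(1) assms(3) a(2)] dist_tri[OF assms(3,4) a(2)] by linarith
    then have 1: "P 0 [x', y'] < 2 * \<eta> + P 0 [x, y]" using a dist_sym[of y y'] assms by simp
    have "m - \<eta> \<le> min (radius S P x') (radius S P y')"
      using radius_lip[OF a(1) assms(3)] radius_lip[OF a(2) assms(4)] a by (auto simp: m_def)
    then have "s * (m - \<eta>) \<le> s * min (radius S P x') (radius S P y')"
      using assms(1) by (intro mult_left_mono) auto
    then show ?thesis using 1 \<eta>2 \<eta> unfolding linked_def by (simp add: algebra_simps)
  qed
  with \<eta> show ?thesis by blast
qed

lemma list_linked_open:
  assumes "0 < s" "list_all2 (linked S P s) u v" "u \<in> lists S" "v \<in> lists S"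
  shows "\<exists>\<eta>>0. \<forall>u'\<in>lists S. \<forall>v'\<in>lists S. near P \<eta> u' u \<longrightarrow> near P \<eta> v' v \<longrightarrow> list_all2 (linked S P s) u' v'"
  using assms(2-4)
proof (induction u v rule: list_all2_induct)
  case Nil
  then show ?case by (intro exI[of _ 1]) (auto simp: near_def)
next
  case (Cons x u y v)
  then obtain \<eta> where \<eta>: "\<eta>>0" "\<And>u' v'. u'\<in>lists S \<Longrightarrow> v'\<in>lists S \<Longrightarrow> near P \<eta> u' u \<Longrightarrow>
     near P \<eta> v' v \<Longrightarrow> list_all2 (linked S P s) u' v'" by auto
  obtain \<eta>' where \<eta>': "\<eta>'>0" "\<And>x' y'. x'\<in>S \<Longrightarrow> y'\<in>S \<Longrightarrow> P 0 [x', x] < \<eta>' \<Longrightarrow> P 0 [y', y] < \<eta>' \<Longrightarrow> linked S P s x' y'"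
    using linked_open[OF assms(1), of x y] Cons by auto
  have "list_all2 (linked S P s) u' v'" if uv: "u' \<in> lists S" "v' \<in> lists S"
    "near P (min \<eta> \<eta>') u' (x # u)" "near P (min \<eta> \<eta>') v' (y # v)" for u' v'
  proof -
    obtain x' u'' where 1: "u' = x' # u''" using uv(3) by (auto simp: near_def list_all2_Cons2)
    obtain y' v'' where 2: "v' = y' # v''" using uv(4) by (auto simp: near_def list_all2_Cons2)
    have "linked S P s x' y'" using uv 1 2 by (intro \<eta>'(2)) auto
    moreover have "list_all2 (linked S P s) u'' v''"
      using uv 1 2 by (intro \<eta>(2)) (auto intro: near_mono)
    ultimately show ?thesis using 1 2 by simp
  qed
  then show ?case using \<eta>(1) \<eta>'(1) by (intro exI[of _ "min \<eta> \<eta>'"]) auto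
qed

lemma list_linked_refl: "0 < s \<Longrightarrow> u \<in> lists S \<Longrightarrow> list_all2 (linked S P s) u u"
  unfolding list_all2_conv_all_nth linked_def using radius_pos nth_S by simp

lemma chained_open_base:
  assumes s: "0 < s" and v: "v \<in> sat S P \<phi> q"
  shows "\<exists>\<eta>>0. \<forall>u\<in>lists S. near P \<eta> u v \<longrightarrow> u \<in> sat S P \<phi> q \<and> list_all2 (linked S P s) v u"
proof -
  have vS: "v \<in> lists S" using v sat_lists by blast
  obtain \<eta> where \<eta>: "\<eta>>0" "\<And>u. u\<in>lists S \<Longrightarrow> near P \<eta> u v \<Longrightarrow> u \<in> sat S P \<phi> q"
    using sat_open[OF v] by blast
  obtain \<eta>' where \<eta>': "\<eta>'>0" "\<And>u' v'. u'\<in>lists S \<Longrightarrow> v'\<in>lists S \<Longrightarrow> near P \<eta>' u' v \<Longrightarrow>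
     near P \<eta>' v' v \<Longrightarrow> list_all2 (linked S P s) u' v'"
    using list_linked_open[OF s list_linked_refl[OF s vS] vS vS] by blast
  show ?thesis
  proof (intro exI[of _ "min \<eta> \<eta>'"] conjI ballI impI)
    fix u assume u: "u \<in> lists S" "near P (min \<eta> \<eta>') u v"
    show "u \<in> sat S P \<phi> q" by (rule \<eta>(2)[OF u(1) near_mono[OF u(2)]]) simp
    show "list_all2 (linked S P s) v u"
      by (rule \<eta>'(2)[OF vS u(1) near_refl[OF vS \<eta>'(1)] near_mono[OF u(2)]]) simp
  qed (use \<eta> \<eta>' in auto)
qed

end

section \<open>Reading components off the indices of a dense sequence\<close>

context dense_preds
begin

lemma tb_ball_pullback: "tb_ball UNIV (pullback P a) i r = tb_ball S P (a i) r"
proof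
  assume t: "tb_ball UNIV (pullback P a) i r"
  show "tb_ball S P (a i) r"
    unfolding tb_ball_def
  proof
    fix n :: nat
    \<comment> \<open>\<open>Suc (2 * n + 1)\<close> is twice \<open>Suc n\<close>, so two errors of
      this size add up to \<open>1 / real (Suc n)\<close>.\<close>
    obtain F where F: "\<And>j. P 0 [a i, a j] < r \<Longrightarrow> \<exists>f\<in>set F. P 0 [a f, a j] < 1 / real (Suc (2 * n + 1))"
      using t unfolding tb_ball_def pullback_def by (metis UNIV_I list.simps(8,9))
    have "\<exists>f\<in>set (map a F). P 0 [f, y] < 1 / real (Suc n)" if y: "y \<in> S" "P 0 [a i, y] < r" for y
    proof -
      have "0 < min (r - P 0 [a i, y]) (1 / real (Suc (2 * n + 1)))" using y by simp
      from a_dense[OF y(1) this] obtain j where j: "P 0 [a j, y] < r - P 0 [a i, y]"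
        "P 0 [a j, y] < 1 / real (Suc (2 * n + 1))" by auto
      have "P 0 [a i, a j] < r" using dist_tri[OF a_S y(1) a_S, of i j] j(1) dist_sym[OF a_S y(1), of j] by linarith
      then obtain f where f: "f \<in> set F" "P 0 [a f, a j] < 1 / real (Suc (2 * n + 1))" using F by blast
      have "1 / real (Suc (2 * n + 1)) + 1 / real (Suc (2 * n + 1)) = 1 / real (Suc n)"
        by (simp add: field_simps)
      then have "P 0 [a f, y] < 1 / real (Suc n)" using dist_tri[OF a_S a_S y(1), of f j] f(2) j(2) by linarith
      then show ?thesis using f(1) by auto
    qed
    then show "\<exists>F. set F \<subseteq> S \<and> (\<forall>y\<in>S. P 0 [a i, y] < r \<longrightarrow> (\<exists>f\<in>set F. P 0 [f, y] < 1 / real (Suc n)))"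
      using a_S by (intro exI[of _ "map a F"]) auto
  qed
next
  assume t: "tb_ball S P (a i) r"
  show "tb_ball UNIV (pullback P a) i r"
    unfolding tb_ball_def
  proof
    fix n :: nat
    obtain F where F: "set F \<subseteq> S" "\<And>y. y \<in> S \<Longrightarrow> P 0 [a i, y] < r \<Longrightarrow> \<exists>f\<in>set F. P 0 [f, y] < 1 / real (Suc (2 * n + 1))"
      using t unfolding tb_ball_def by meson
    have "\<exists>k. P 0 [a k, f] < 1 / real (Suc (2 * n + 1))" if "f \<in> set F" for f
      using a_dense[of f "1 / real (Suc (2 * n + 1))"] that F(1) by auto
    then obtain k where k: "\<And>f. f \<in> set F \<Longrightarrow> P 0 [a (k f), f] < 1 / real (Suc (2 * n + 1))" by metis
    have "\<exists>f\<in>set (map k F). P 0 [a f, a j] < 1 / real (Suc n)" if y: "P 0 [a i, a j] < r" for j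
    proof -
      obtain f where f: "f \<in> set F" "P 0 [f, a j] < 1 / real (Suc (2 * n + 1))" using F(2)[OF a_S y] by blast
      have "1 / real (Suc (2 * n + 1)) + 1 / real (Suc (2 * n + 1)) = 1 / real (Suc n)"
        by (simp add: field_simps)
      then have "P 0 [a (k f), a j] < 1 / real (Suc n)" using dist_tri[of "a (k f)" f "a j"] a_S f k[OF f(1)] F(1) by fastforce
      then show ?thesis using f(1) by auto
    qed
    then show "\<exists>F. set F \<subseteq> UNIV \<and> (\<forall>y\<in>UNIV. pullback P a 0 [i, y] < r \<longrightarrow> (\<exists>f\<in>set F. pullback P a 0 [f, y] < 1 / real (Suc n)))"
      by (intro exI[of _ "map k F"]) (auto simp: pullback_def)
  qed
qed

lemma radius_pullback: "radius UNIV (pullback P a) i = radius S P (a i)"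
  by (simp add: radius_def tb_ball_pullback)

lemma INF_dense:
  assumes "xs \<in> lists S"
  shows "(INF i. val S P \<phi> (a i # xs)) = (INF w\<in>S. val S P \<phi> (w # xs))"
proof (rule antisym)
  have b: "bdd_below (range (\<lambda>i. val S P \<phi> (a i # xs)))"
    by (rule bdd_below_mono[OF val_bdd_below[OF assms]]) (use a_S in auto)
  show "(INF i. val S P \<phi> (a i # xs)) \<le> (INF w\<in>S. val S P \<phi> (w # xs))"
  proof (rule cINF_greatest[OF carrier_nonempty])
    fix w assume w: "w \<in> S"
    show "(INF i. val S P \<phi> (a i # xs)) \<le> val S P \<phi> (w # xs)"
    proof (rule field_le_epsilon)
      fix e :: real assume "0 < e"
      then obtain \<delta> where \<delta>: "\<delta> > 0" "\<forall>us\<in>lists S. \<forall>ys\<in>lists S. length us = Suc (length xs) \<longrightarrow>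
        near P \<delta> us ys \<longrightarrow> \<bar>val S P \<phi> us - val S P \<phi> ys\<bar> < e" using val_uc by blast
      obtain i where i: "P 0 [a i, w] < \<delta>" using a_dense[OF w \<delta>(1)] by blast
      have "\<bar>val S P \<phi> (a i # xs) - val S P \<phi> (w # xs)\<bar> < e"
        using \<delta>(2)[rule_format, of "a i # xs" "w # xs"] a_S w assms i near_refl[OF assms \<delta>(1)] by simp
      then show "(INF i. val S P \<phi> (a i # xs)) \<le> val S P \<phi> (w # xs) + e"
        using cINF_lower[OF b, of i] by simp
    qed
  qed
  show "(INF w\<in>S. val S P \<phi> (w # xs)) \<le> (INF i. val S P \<phi> (a i # xs))"
    by (rule cINF_greatest) (auto intro!: cINF_lower[OF val_bdd_below[OF assms]] a_S simp del: in_lists_conv_set)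
qed

lemma val_pullback: "val UNIV (pullback P a) \<phi> js = val S P \<phi> (map a js)"
proof (induction \<phi> arbitrary: js)
  case (FAtom i vs)
  have *: "map (a \<circ> (!) js) vs = map ((!) (map a js)) vs" if "\<forall>v\<in>set vs. v < length js"
    using that by auto
  show ?case by (auto simp: pullback_def *)
next
  case (FInf \<phi>)
  then show ?case using INF_dense[OF initial_S, of \<phi> js] by simp
qed (auto simp: radius_pullback)

lemma sat_pullback: "js \<in> sat UNIV (pullback P a) \<phi> q \<longleftrightarrow> map a js \<in> sat S P \<phi> q"
  unfolding sat_def using initial_S by (simp add: val_pullback)

lemma linked_pullback: "list_all2 (linked UNIV (pullback P a) s) js ks = list_all2 (linked S P s) (map a js) (map a ks)"
  unfolding list_all2_map1 list_all2_map2 linked_def[abs_def] radius_pullback by (simp add: pullback_def)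

lemma list_dense: "v \<in> lists S \<Longrightarrow> 0 < e \<Longrightarrow> \<exists>ks. near P e (map a ks) v"
proof (induction v rule: list.induct)
  case (Cons x v)
  then obtain ks where "near P e (map a ks) v" by auto
  moreover obtain i where "P 0 [a i, x] < e" using a_dense Cons by force
  ultimately show ?case by (intro exI[of _ "i # ks"]) simp
qed (auto simp: near_def)

text \<open>Steps and sublevel sets are open, so a chain can be rerouted through tuples of the dense
  sequence. Claiming this for all index tuples near \<open>v\<close> lets the induction pick any
  intermediate tuple close enough to \<open>v\<close>.\<close>

lemma chained_approx:
  assumes s: "0 < s" and js: "map a js \<in> sat S P \<phi> q" and c: "chained S P s (sat S P \<phi> q) (map a js) v"
  shows "\<exists>\<eta>>0. \<forall>ks. near P \<eta> (map a ks) v \<longrightarrow> map a ks \<in> sat S P \<phi> q \<and>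
     chained UNIV (pullback P a) s (sat UNIV (pullback P a) \<phi> q) js ks"
  using c
proof (induction rule: chained_induct)
  case base
  obtain \<eta> where \<eta>: "\<eta>>0" "\<And>u. u \<in> lists S \<Longrightarrow> near P \<eta> u (map a js) \<Longrightarrow>
     u \<in> sat S P \<phi> q \<and> list_all2 (linked S P s) (map a js) u" using chained_open_base[OF s js] by blast
  show ?case
  proof (intro exI[of _ \<eta>] conjI \<eta>(1) allI impI)
    fix ks assume "near P \<eta> (map a ks) (map a js)"
    note * = \<eta>(2)[OF initial_S this]
    show "map a ks \<in> sat S P \<phi> q" using * by blast
    show "chained UNIV (pullback P a) s (sat UNIV (pullback P a) \<phi> q) js ks"
      by (rule chained_step[OF chained_refl]) (use * js sat_pullback linked_pullback in blast)+
  qed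
next
  case (step v w)
  then obtain \<eta> where \<eta>: "\<eta>>0" "\<And>ks. near P \<eta> (map a ks) v \<Longrightarrow> map a ks \<in> sat S P \<phi> q \<and>
     chained UNIV (pullback P a) s (sat UNIV (pullback P a) \<phi> q) js ks" by blast
  have S: "v \<in> lists S" "w \<in> lists S" using step sat_lists by blast+
  obtain \<eta>1 where \<eta>1: "\<eta>1>0" "\<And>u' v'. u'\<in>lists S \<Longrightarrow> v'\<in>lists S \<Longrightarrow> near P \<eta>1 u' v \<Longrightarrow>
     near P \<eta>1 v' w \<Longrightarrow> list_all2 (linked S P s) u' v'"
    using list_linked_open[OF s step.hyps(4) S] by blast
  obtain \<eta>2 where \<eta>2: "\<eta>2>0" "\<And>u. u\<in>lists S \<Longrightarrow> near P \<eta>2 u w \<Longrightarrow> u \<in> sat S P \<phi> q"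
    using sat_open[OF step.hyps(3)] by blast
  obtain k0 where k0: "near P (min \<eta> \<eta>1) (map a k0) v" using list_dense[OF S(1)] \<eta>(1) \<eta>1(1) by (metis min_less_iff_conj)
  have k0': "near P \<eta> (map a k0) v" "near P \<eta>1 (map a k0) v" using k0 by (auto elim: near_mono)
  note k0V = \<eta>(2)[OF k0'(1)]
  show ?case
  proof (intro exI[of _ "min \<eta>1 \<eta>2"] conjI allI impI)
    fix ks assume "near P (min \<eta>1 \<eta>2) (map a ks) w"
    then have k: "near P \<eta>1 (map a ks) w" "near P \<eta>2 (map a ks) w" by (auto elim: near_mono)
    show kV: "map a ks \<in> sat S P \<phi> q" by (rule \<eta>2(2)[OF initial_S k(2)])
    have "list_all2 (linked S P s) (map a k0) (map a ks)" by (rule \<eta>1(2)[OF initial_S initial_S k0'(2) k(1)])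
    then show "chained UNIV (pullback P a) s (sat UNIV (pullback P a) \<phi> q) js ks"
      using k0V kV sat_pullback linked_pullback by (blast intro: chained_step)
  qed (use \<eta>1 \<eta>2 in auto)
qed

lemma chained_pullback:
  assumes s: "0 < s" and js: "map a js \<in> sat S P \<phi> q"
  shows "chained UNIV (pullback P a) s (sat UNIV (pullback P a) \<phi> q) js ks \<longleftrightarrow> chained S P s (sat S P \<phi> q) (map a js) (map a ks)"
proof
  assume "chained UNIV (pullback P a) s (sat UNIV (pullback P a) \<phi> q) js ks"
  then show "chained S P s (sat S P \<phi> q) (map a js) (map a ks)"
    by (induction rule: chained_induct) (auto simp: sat_pullback linked_pullback intro: chained_step chained_refl)
next
  assume "chained S P s (sat S P \<phi> q) (map a js) (map a ks)"
  from chained_approx[OF s js this] show "chained UNIV (pullback P a) s (sat UNIV (pullback P a) \<phi> q) js ks"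
    using near_refl[OF initial_S] by blast
qed

lemma comp_of_pullback:
  "comp_of UNIV (pullback P a) id x = map_option (\<lambda>(l, C). (l, {ks. map a ks \<in> C})) (comp_of S P a x)"
proof -
  obtain \<phi> q s js where d: "decode x = (\<phi>, q, s, js)" by (metis prod_cases4)
  have "map a js \<in> sat S P \<phi> q" if "val S P \<phi> (map a js) < of_rat q"
    using that unfolding sat_def using initial_S by blast
  then show ?thesis by (auto simp: comp_of_def d val_pullback chained_pullback)
qed

lemma comp_of_SomeD:
  assumes "comp_of S P a x = Some (l, C)"
  shows "\<exists>\<phi> q s js. 0 < s \<and> decode x = (\<phi>, q, s, js) \<and> l = (length js, \<phi>, q, s) \<and> map a js \<in> sat S P \<phi> q \<and>
     C = {v. chained S P (of_rat s) (sat S P \<phi> q) (map a js) v}"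
  using assms unfolding comp_of_def sat_def using initial_S by (auto split: prod.splits if_splits simp del: in_lists_conv_set)

lemma comp_of_open:
  assumes "comp_of S P a x = Some (l, C)" "v \<in> C"
  shows "v \<in> lists S \<and> length v = fst l \<and> (\<exists>\<eta>>0. \<forall>ks. near P \<eta> (map a ks) v \<longrightarrow> map a ks \<in> C)"
proof -
  obtain \<phi> q s js where d: "0 < s" "l = (length js, \<phi>, q, s)" "map a js \<in> sat S P \<phi> q"
    "C = {v. chained S P (of_rat s) (sat S P \<phi> q) (map a js) v}" using comp_of_SomeD[OF assms(1)] by blast
  have s: "0 < (of_rat s :: real)" using d(1) by simp
  have c: "chained S P (of_rat s) (sat S P \<phi> q) (map a js) v" using d assms by blast
  have "v \<in> lists S" using chained_in[OF c d(3)] sat_lists by blast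
  moreover have "length v = fst l" using chained_length[OF c] d(2) by simp
  moreover have "\<exists>\<eta>>0. \<forall>ks. near P \<eta> (map a ks) v \<longrightarrow> map a ks \<in> C"
    using chained_approx[OF s d(3) c] chained_pullback[OF s d(3)] d(4) by blast
  ultimately show ?thesis by blast
qed

lemma covered_pullback:
  assumes C: "comp_of S P a x = Some (l, C)" and C': "comp_of S P a y = Some (l', C')"
    and I: "set I \<subseteq> {..<fst l}" "length I \<le> fst l'"
  shows "covered (pullback P a) I e {ks. map a ks \<in> C} {ks. map a ks \<in> C'} = covered P I e C C'"
proof
  have mp: "map a (map ((!) ks) I) = map ((!) (map a ks)) I" if "length ks = fst l" for ks
    using that I(1) by (auto simp: subset_iff)
  assume L: "covered (pullback P a) I e {ks. map a ks \<in> C} {ks. map a ks \<in> C'}"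
  show "covered P I e C C'"
    unfolding covered_def
  proof (intro ballI allI impI)
    fix v t assume v: "v \<in> C" and t: "e < t"
    obtain t0 where t0: "e < t0" "t0 < t" using dense t by blast
    have vS: "v \<in> lists S" "length v = fst l" using comp_of_open[OF C v] by blast+
    obtain \<eta> where \<eta>: "\<eta> > 0" "\<And>ks. near P \<eta> (map a ks) v \<Longrightarrow> map a ks \<in> C" using comp_of_open[OF C v] by blast
    have r: "0 < (of_rat t - of_rat t0 :: real)" using t0(2) by (simp add: of_rat_less)
    obtain ks where ks: "near P (min \<eta> (of_rat t - of_rat t0)) (map a ks) v"
      using list_dense[OF vS(1)] \<eta>(1) r by (metis min_less_iff_conj)
    have ks': "near P \<eta> (map a ks) v" "near P (of_rat t - of_rat t0) (map a ks) v"
      using ks by (auto elim: near_mono)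
    have lk: "length ks = fst l" using near_length[OF ks] vS by simp
    obtain w where w: "map a w \<in> C'" "near (pullback P a) (of_rat t0) (map ((!) ks) I) (take (length I) w)"
      using L \<eta>(2)[OF ks'(1)] t0(1) unfolding covered_def by blast
    have n1: "near P (of_rat t0) (map ((!) (map a ks)) I) (take (length I) (map a w))"
      using w(2) unfolding near_pullback mp[OF lk] take_map .
    have n2: "near P (of_rat t - of_rat t0) (map ((!) v) I) (map ((!) (map a ks)) I)"
      by (rule near_map_nth[OF near_sym[OF ks'(2) initial_S vS(1)]]) (use I vS in auto)
    have S: "map ((!) v) I \<in> lists S" "map ((!) (map a ks)) I \<in> lists S" "take (length I) (map a w) \<in> lists S"
      using map_nth_S[OF vS(1)] map_nth_S[OF initial_S] I vS lk by (auto simp: take_map a_S)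
    have "near P (of_rat t) (map ((!) v) I) (take (length I) (map a w))"
      using near_tri[OF n2 n1 S] by simp
    then show "\<exists>w\<in>C'. near P (of_rat t) (map ((!) v) I) (take (length I) w)" using w(1) by blast
  qed
next
  have mp: "map a (map ((!) ks) I) = map ((!) (map a ks)) I" if "length ks = fst l" for ks
    using that I(1) by (auto simp: subset_iff)
  assume R: "covered P I e C C'"
  show "covered (pullback P a) I e {ks. map a ks \<in> C} {ks. map a ks \<in> C'}"
    unfolding covered_def
  proof (intro ballI allI impI)
    fix v t assume "v \<in> {ks. map a ks \<in> C}" and t: "e < t"
    then have v: "map a v \<in> C" by simp
    obtain t0 where t0: "e < t0" "t0 < t" using dense t by blast
    have lv: "length v = fst l" using comp_of_open[OF C v] by simp
    obtain w where w: "w \<in> C'" "near P (of_rat t0) (map ((!) (map a v)) I) (take (length I) w)"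
      using R v t0(1) unfolding covered_def by blast
    have wS: "w \<in> lists S" "length w = fst l'" using comp_of_open[OF C' w(1)] by blast+
    obtain \<eta> where \<eta>: "\<eta> > 0" "\<And>ks. near P \<eta> (map a ks) w \<Longrightarrow> map a ks \<in> C'" using comp_of_open[OF C' w(1)] by blast
    have r: "0 < (of_rat t - of_rat t0 :: real)" using t0(2) by (simp add: of_rat_less)
    obtain ks where ks: "near P (min \<eta> (of_rat t - of_rat t0)) (map a ks) w"
      using list_dense[OF wS(1)] \<eta>(1) r by (metis min_less_iff_conj)
    have ks': "near P \<eta> (map a ks) w" "near P (of_rat t - of_rat t0) (map a ks) w"
      using ks by (auto elim: near_mono)
    have n2: "near P (of_rat t - of_rat t0) (take (length I) w) (take (length I) (map a ks))"
      by (rule near_take[OF near_sym[OF ks'(2) initial_S wS(1)]])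
    have S: "map ((!) (map a v)) I \<in> lists S" "take (length I) w \<in> lists S" "take (length I) (map a ks) \<in> lists S"
      using map_nth_S[OF initial_S] I lv wS by (auto simp: take_map a_S dest: in_set_takeD)
    have "near P (of_rat t) (map ((!) (map a v)) I) (take (length I) (map a ks))"
      using near_tri[OF w(2) n2 S] by simp
    then have "near (pullback P a) (of_rat t) (map ((!) v) I) (take (length I) ks)"
      unfolding near_pullback mp[OF lv] take_map .
    then show "\<exists>w\<in>{ks. map a ks \<in> C'}. near (pullback P a) (of_rat t) (map ((!) v) I) (take (length I) w)"
      using \<eta>(2)[OF ks'(1)] by blast
  qed
qed

lemma coded_rel_pullback: "coded_rel UNIV (pullback P a) id r xs = coded_rel S P a r xs"
proof (cases "from_nat r :: (nat \<times> frm \<times> rat \<times> rat) + (nat list \<times> rat)")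
  case (Inl l)
  then show ?thesis by (cases l rule: prod_cases4) (auto simp: coded_rel_def comp_of_pullback)
next
  case (Inr p)
  then obtain I e where p: "from_nat r = (Inr (I, e) :: (nat \<times> frm \<times> rat \<times> rat) + (nat list \<times> rat))"
    by (cases p) auto
  show ?thesis
    unfolding coded_rel_def p sum.case prod.case comp_of_pullback
    using covered_pullback by (auto simp del: in_lists_conv_set; metis)
qed

end

text \<open>Components are open, so every component meets both dense sequences and has a name from
  each. Hence \<open>comp_of\<close> has the same range for both, and \<open>bij_of_fibres\<close>
  matches the names.\<close>

lemma coded_rel_same:
  assumes "dense_preds S P a" "dense_preds S P b"
  shows "\<exists>h. bij h \<and> (\<forall>r xs. coded_rel S P b r (map h xs) = coded_rel S P a r xs)"
proof -
  have sub: "range (comp_of S P a) \<subseteq> range (comp_of S P b)" if "dense_preds S P a" "dense_preds S P b" for a b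
  proof
    interpret A: dense_preds S P a by fact
    interpret B: dense_preds S P b by fact
    fix c assume "c \<in> range (comp_of S P a)"
    then obtain x where x: "c = comp_of S P a x" by blast
    show "c \<in> range (comp_of S P b)"
    proof (cases c)
      case None
      \<comment> \<open>Scale 0 names no component, so \<open>None\<close> is always
        attained.\<close>
      obtain y where "decode y = (FZero, 0, 0, [])" using decode_surj by blast
      then have "comp_of S P b y = None" by (simp add: comp_of_def)
      then show ?thesis using None by (metis rangeI)
    next
      case (Some lC)
      obtain l C where lC: "lC = (l, C)" by (cases lC)
      obtain \<phi> q s js where d: "0 < s" "l = (length js, \<phi>, q, s)" "map a js \<in> sat S P \<phi> q"
        "C = {v. chained S P (of_rat s) (sat S P \<phi> q) (map a js) v}"
        using A.comp_of_SomeD[of x l C] x Some lC by auto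
      have s: "0 < (of_rat s :: real)" using d(1) by simp
      obtain \<eta> where \<eta>: "\<eta>>0" "\<And>u. u \<in> lists S \<Longrightarrow> near P \<eta> u (map a js) \<Longrightarrow>
        u \<in> sat S P \<phi> q \<and> list_all2 (linked S P (of_rat s)) (map a js) u"
        using A.chained_open_base[OF s d(3)] by blast
      obtain ks where ks: "near P \<eta> (map b ks) (map a js)" using B.list_dense[OF A.initial_S \<eta>(1)] by blast
      note k = \<eta>(2)[OF B.initial_S ks]
      have c1: "chained S P (of_rat s) (sat S P \<phi> q) (map a js) (map b ks)"
        by (rule chained_step[OF chained_refl]) (use k d in auto)
      have c2: "chained S P (of_rat s) (sat S P \<phi> q) (map b ks) (map a js)" by (rule A.chained_sym[OF c1 A.sat_lists])
      have C: "C = {v. chained S P (of_rat s) (sat S P \<phi> q) (map b ks) v}"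
        using c1 c2 chained_trans d(4) by blast
      have l: "length ks = length js" using near_length[OF ks] by simp
      obtain y where "decode y = (\<phi>, q, s, ks)" using decode_surj by blast
      then have "comp_of S P b y = Some (l, C)" using k d(1,2) C l by (simp add: comp_of_def sat_def)
      then show ?thesis using Some lC by (metis rangeI)
    qed
  qed
  have "range (comp_of S P a) = range (comp_of S P b)" using sub assms by blast
  from bij_of_fibres[OF this infinite_comp_of infinite_comp_of] obtain h where
    h: "bij h" "\<And>x. comp_of S P b (h x) = comp_of S P a x" by blast
  have e1: "(\<exists>x C. map h xs = [x] \<and> comp_of S P b x = Some (l, C)) = (\<exists>x C. xs = [x] \<and> comp_of S P a x = Some (l, C))" for xs l
    using h(2) by (auto simp: map_eq_Cons_conv)
  have "coded_rel S P b r (map h xs) = coded_rel S P a r xs" for r xs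
    unfolding coded_rel_def e1 using h(2) by (auto split: sum.splits simp: map_eq_Cons_conv)
  with h(1) show ?thesis by blast
qed

section \<open>Recovering a metric structure\<close>

text \<open>The scales increase because an approximating chain needs slightly longer steps.\<close>

definition scale :: "nat \<Rightarrow> rat" where
  "scale j = 1/4 - (1/2) ^ (j + 3)"

lemma scale: "0 < scale j" "scale j < scale (Suc j)" "scale j \<le> 1/4"
proof -
  have "(1/2::rat) ^ j \<le> 1" by (simp add: power_le_one)
  moreover have "(1/2::rat) ^ (j + 3) = (1/2) ^ j * (1/8)" unfolding power_add by (simp add: power3_eq_cube)
  ultimately have "(1/2::rat) ^ (j + 3) \<le> 1/8" by simp
  then show "0 < scale j" unfolding scale_def by linarith
qed (auto simp: scale_def)

lemma scale_le: "(of_rat (scale j) :: real) \<le> 1/4"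
proof -
  have "(of_rat (scale j) :: real) \<le> of_rat (1/4)" using scale(3) by (simp only: of_rat_less_eq)
  then show ?thesis by (simp add: of_rat_divide)
qed

text \<open>Conditions are upper bounds only; the lower bounds come from conditions on
  \<open>FNeg\<close>.\<close>

lemma approx_list:
  assumes "0 < (e::real)"
  shows "\<exists>G. set G \<subseteq> conds S P xs \<and> (\<forall>t<j. \<exists>q q'. (from_nat t, q) \<in> set G \<and> (FNeg (from_nat t), q') \<in> set G \<and>
     of_rat q < val S P (from_nat t) xs + e \<and> of_rat q' < - val S P (from_nat t) xs + e)"
proof (induction j)
  case (Suc j)
  then obtain G where G: "set G \<subseteq> conds S P xs" "\<And>t. t < j \<Longrightarrow> \<exists>q q'. (from_nat t, q) \<in> set G \<and> (FNeg (from_nat t), q') \<in> set G \<and>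
     of_rat q < val S P (from_nat t) xs + e \<and> of_rat q' < - val S P (from_nat t) xs + e" by auto
  obtain q where q: "val S P (from_nat j) xs < of_rat q" "of_rat q < val S P (from_nat j) xs + e"
    using of_rat_dense[of "val S P (from_nat j) xs" "val S P (from_nat j) xs + e"] assms by auto
  obtain q' where q': "- val S P (from_nat j) xs < of_rat q'" "of_rat q' < - val S P (from_nat j) xs + e"
    using of_rat_dense[of "- val S P (from_nat j) xs" "- val S P (from_nat j) xs + e"] assms by auto
  let ?G = "(from_nat j, q) # (FNeg (from_nat j), q') # G"
  have "set ?G \<subseteq> conds S P xs" using G(1) q q' by (auto simp: conds_def)
  moreover have "\<exists>q q'. (from_nat t, q) \<in> set ?G \<and> (FNeg (from_nat t), q') \<in> set ?G \<and>
     of_rat q < val S P (from_nat t) xs + e \<and> of_rat q' < - val S P (from_nat t) xs + e" if "t < Suc j" for t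
  proof (cases "t = j")
    case True
    then show ?thesis using q q' by auto
  next
    case False
    then have "t < j" using that by simp
    from G(2)[OF this] show ?thesis by auto
  qed
  ultimately show ?case by blast
qed (auto intro: exI[of _ "[]"])

text \<open>The formula pins the first \<open>j\<close> formulas up to
  \<open>1 / real (Suc j)\<close>. The approximation is required for all \<open>m \<ge> n\<close>,
  so that the length of the next stage can be chosen afterwards.\<close>

definition (in dense_preds) stage :: "nat \<Rightarrow> nat \<Rightarrow> frm \<Rightarrow> bool" where
  "stage j n \<phi> \<longleftrightarrow> j \<le> n \<and> val S P \<phi> (initial n) < 0 \<and>
     (\<exists>G. \<phi> = conj_frm G \<and>
       (\<forall>t<j. \<exists>q q'. (from_nat t, q) \<in> set G \<and> (FNeg (from_nat t), q') \<in> set G \<and>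
         of_rat q < val S P (from_nat t) (initial n) + 1 / real (Suc j) \<and>
         of_rat q' < - val S P (from_nat t) (initial n) + 1 / real (Suc j))) \<and>
     (\<forall>m\<ge>n. \<forall>v. chained S P (of_rat (scale j)) (sat S P \<phi> 0) (initial n) v \<longrightarrow>
         (\<exists>w\<in>reach (of_rat (scale (Suc j))) m. near P ((1/2)^j) (take j v) (take j w)))"

lemma (in dense_preds) stage_ex: "\<exists>n\<ge>N. \<exists>\<phi>. stage j n \<phi>"
proof -
  have s: "0 < (of_rat (scale j)::real)" "of_rat (scale j) < (of_rat (scale (Suc j))::real)"
    "of_rat (scale (Suc j)) \<le> (1/4::real)"
    using scale(1,2)[of j] scale_le by (simp_all add: of_rat_less)
  obtain n G where n: "max N j \<le> n" and G: "set G \<subseteq> conds S P (initial n)"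
    and K: "\<And>W m v. type_closed S P W \<Longrightarrow> initial n \<in> W \<Longrightarrow> (\<forall>v\<in>W. \<forall>(\<phi>, q)\<in>set G. val S P \<phi> v < of_rat q) \<Longrightarrow>
       n \<le> m \<Longrightarrow> chained S P (of_rat (scale j)) W (initial n) v \<Longrightarrow>
         (\<exists>w\<in>reach (of_rat (scale (Suc j))) m. near P ((1/2)^j) (take j v) (take j w))"
    using reach_absorbs[of j "max N j" "(1/2)^j", OF _ _ s] by auto
  obtain G0 where G0: "set G0 \<subseteq> conds S P (initial n)"
     "\<forall>t<j. \<exists>q q'. (from_nat t, q) \<in> set G0 \<and> (FNeg (from_nat t), q') \<in> set G0 \<and>
         of_rat q < val S P (from_nat t) (initial n) + 1 / real (Suc j) \<and>
         of_rat q' < - val S P (from_nat t) (initial n) + 1 / real (Suc j)"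
    using approx_list[of "1 / real (Suc j)" S P "initial n" j] by auto
  define \<phi> where "\<phi> = conj_frm (G0 @ G)"
  have x: "val S P \<phi> (initial n) < 0" using G G0(1) by (auto simp: \<phi>_def val_conj_frm conds_def)
  have "stage j n \<phi>"
    unfolding stage_def
  proof (intro conjI allI impI)
    show "j \<le> n" using n by simp
    show "val S P \<phi> (initial n) < 0" by (rule x)
    show "\<exists>G. \<phi> = conj_frm G \<and>
       (\<forall>t<j. \<exists>q q'. (from_nat t, q) \<in> set G \<and> (FNeg (from_nat t), q') \<in> set G \<and>
         of_rat q < val S P (from_nat t) (initial n) + 1 / real (Suc j) \<and>
         of_rat q' < - val S P (from_nat t) (initial n) + 1 / real (Suc j))"
      using G0(2) by (intro exI[of _ "G0 @ G"]) (auto simp: \<phi>_def, blast)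
    fix m v assume m: "n \<le> m" and v: "chained S P (of_rat (scale j)) (sat S P \<phi> 0) (initial n) v"
    show "\<exists>w\<in>reach (of_rat (scale (Suc j))) m. near P ((1/2)^j) (take j v) (take j w)"
    proof (rule K[OF sat_type_closed _ _ m v])
      show "initial n \<in> sat S P \<phi> 0" using x initial_S unfolding sat_def by simp
      show "\<forall>v\<in>sat S P \<phi> 0. \<forall>(\<phi>, q)\<in>set G. val S P \<phi> v < of_rat q"
        by (auto simp: sat_def \<phi>_def val_conj_frm)
    qed
  qed
  with n show ?thesis by auto
qed

lemma (in lc_preds) geometric_limit:
  assumes \<sigma>: "\<And>n. \<sigma> n \<in> S" and d: "\<And>n. P 0 [\<sigma> n, \<sigma> (Suc n)] < 2 * (1/2) ^ n"
  shows "\<exists>l\<in>S. (\<lambda>n. P 0 [\<sigma> n, l]) \<longlonglongrightarrow> 0"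
proof (rule complete[OF \<sigma>])
  \<comment> \<open>The right-hand side is the exact sum of the geometric bounds for the
    \<open>k\<close> steps.\<close>
  have le: "P 0 [\<sigma> m, \<sigma> (m + k)] \<le> 4 * ((1/2) ^ m - (1/2) ^ (m + k))" for m k
  proof (induction k)
    case (Suc k)
    have "P 0 [\<sigma> m, \<sigma> (m + Suc k)] \<le> P 0 [\<sigma> m, \<sigma> (m + k)] + P 0 [\<sigma> (m + k), \<sigma> (Suc (m + k))]"
      using dist_tri[OF \<sigma> \<sigma> \<sigma>] by simp
    also have "\<dots> \<le> 4 * ((1/2) ^ m - (1/2) ^ (m + k)) + 2 * (1/2) ^ (m + k)"
      using Suc d[of "m + k"] by linarith
    finally show ?case by simp
  qed (simp add: \<sigma>)
  have le': "P 0 [\<sigma> m, \<sigma> n] \<le> 4 * (1/2) ^ m" if "m \<le> n" for m n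
  proof -
    have "P 0 [\<sigma> m, \<sigma> n] \<le> 4 * ((1/2) ^ m - (1/2) ^ n)" using le[of m "n - m"] that by simp
    also have "\<dots> \<le> 4 * (1/2) ^ m" by simp
    finally show ?thesis .
  qed
  fix e :: real assume "0 < e"
  then obtain N where N: "(1/2) ^ N < e / 4" using real_arch_pow_inv[of "e/4" "1/2"] by auto
  have "P 0 [\<sigma> m, \<sigma> n] < e" if "N \<le> m" "N \<le> n" for m n
  proof -
    have p: "(1/2::real) ^ m \<le> (1/2) ^ N" "(1/2::real) ^ n \<le> (1/2) ^ N"
      using that by (auto intro!: power_decreasing)
    show ?thesis
    proof (cases "m \<le> n")
      case True
      then show ?thesis using le'[OF True] p(1) N by linarith
    next
      case False
      then have "P 0 [\<sigma> m, \<sigma> n] \<le> 4 * (1/2) ^ n" using le'[of n m] dist_sym[OF \<sigma> \<sigma>] by simp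
      then show ?thesis using p(2) N by linarith
    qed
  qed
  then show "\<exists>N. \<forall>m\<ge>N. \<forall>n\<ge>N. P 0 [\<sigma> m, \<sigma> n] < e" by blast
qed

section \<open>From an isomorphism of component structures to a dense sequence of the same
  type\<close>

locale iso_pair = A: dense_preds S P a + B: dense_preds S' P' b
  for S :: "'a set" and P a and S' :: "'b set" and P' b +
  fixes h :: "nat \<Rightarrow> nat"
  assumes bij_h: "bij h" and coded_rel_h: "coded_rel S' P' b r (map h xs) = coded_rel S P a r xs"
begin

lemma comp_of_h: "(\<exists>D. comp_of S' P' b (h x) = Some (l, D)) \<longleftrightarrow> (\<exists>C. comp_of S P a x = Some (l, C))"
  using coded_rel_h[of "to_nat (Inl l :: (nat \<times> frm \<times> rat \<times> rat) + (nat list \<times> rat))" "[x]"]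
  by (cases l rule: prod_cases4) (simp add: coded_rel_def)

lemma covered_h:
  assumes "comp_of S P a x = Some (l, C)" "comp_of S P a y = Some (l1, C1)" "set I \<subseteq> {..<fst l}" "length I \<le> fst l1"
    "covered P I e C C1" "comp_of S' P' b (h x) = Some (l, D)" "comp_of S' P' b (h y) = Some (l1, D1)"
  shows "covered P' I e D D1"
proof -
  have "coded_rel S P a (to_nat (Inr (I, e) :: (nat \<times> frm \<times> rat \<times> rat) + (nat list \<times> rat))) [x, y]"
    using assms by (cases l rule: prod_cases4, cases l1 rule: prod_cases4) (simp add: coded_rel_def)
  then have "coded_rel S' P' b (to_nat (Inr (I, e) :: (nat \<times> frm \<times> rat \<times> rat) + (nat list \<times> rat))) (map h [x, y])"
    unfolding coded_rel_h .
  then show ?thesis using assms(6,7) by (auto simp: coded_rel_def)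
qed

text \<open>Consecutive components \<open>C j\<close> are chosen so that \<open>C j\<close> lies in a neighbourhood of
  \<open>C (Suc j)\<close> in the first \<open>j\<close> coordinates. Points chosen one after the other from the images of
  the \<open>C j\<close> under \<open>h\<close> then converge in every coordinate.\<close>

lemma elementary_sequence:
  "\<exists>z. (\<forall>i. z i \<in> S') \<and> (\<forall>n \<phi>. val S' P' \<phi> (map z [0..<n]) = val S P \<phi> (map a [0..<n])) \<and>
     (\<forall>i y t D l. 0 < t \<longrightarrow> comp_of S P a y = Some ((1, FZero, 1, 1/4), {v. chained S P (1/4) (sat S P FZero 1) [a i] v}) \<longrightarrow>
        comp_of S' P' b (h y) = Some (l, D) \<longrightarrow> (\<exists>w. [w] \<in> D \<and> w \<in> S' \<and> P' 0 [z i, w] < t))"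
proof -
  have "\<exists>f. \<forall>j. A.stage j (fst (f j)) (snd (f j)) \<and> fst (f j) \<le> fst (f (Suc j))"
  proof (rule dependent_nat_choice)
    obtain n \<phi> where "A.stage 0 n \<phi>" using A.stage_ex by blast
    then show "\<exists>p. A.stage 0 (fst p) (snd p)" by (intro exI[of _ "(n, \<phi>)"]) simp
  next
    fix p :: "nat \<times> frm" and j
    obtain n \<phi> where "fst p \<le> n" "A.stage (Suc j) n \<phi>" using A.stage_ex by blast
    then show "\<exists>q. A.stage (Suc j) (fst q) (snd q) \<and> fst p \<le> fst q" by (intro exI[of _ "(n, \<phi>)"]) simp
  qed
  then obtain f where f: "\<And>j. A.stage j (fst (f j)) (snd (f j))" "\<And>j. fst (f j) \<le> fst (f (Suc j))" by blast
  define n \<phi> where "n j = fst (f j)" and "\<phi> j = snd (f j)" for j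
  have st: "A.stage j (n j) (\<phi> j)" and nS: "n j \<le> n (Suc j)" for j
    using f by (simp_all add: n_def \<phi>_def)
  have nj: "j \<le> n j" for j using st[of j] by (simp add: A.stage_def)
  define C where "C j = {v. chained S P (of_rat (scale j)) (sat S P (\<phi> j) 0) (A.initial (n j)) v}" for j
  have xV: "A.initial (n j) \<in> sat S P (\<phi> j) 0" for j
    using st[of j] A.initial_S unfolding sat_def by (simp add: A.stage_def)
  have "\<exists>x. decode x = (\<phi> j, 0, scale j, [0..<n j])" for j by (rule decode_surj)
  then obtain x where x: "\<And>j. decode (x j) = (\<phi> j, 0, scale j, [0..<n j])" by metis
  define l where "l j = (n j, \<phi> j, 0::rat, scale j)" for j
  have clx: "comp_of S P a (x j) = Some (l j, C j)" for j
    using xV[of j] scale(1)[of j] by (simp add: comp_of_def x C_def l_def sat_def)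
  then have "\<exists>D. comp_of S' P' b (h (x j)) = Some (l j, D)" for j using comp_of_h by blast
  then obtain D where D: "\<And>j. comp_of S' P' b (h (x j)) = Some (l j, D j)" by metis
  have Clen: "length v = n j" "v \<in> lists S" if "v \<in> C j" for v j
    using A.comp_of_open[OF clx that] by (simp_all add: l_def)
  have Dlen: "length v = n j" "v \<in> lists S'" if "v \<in> D j" for v j
    using B.comp_of_open[OF D that] by (simp_all add: l_def)
  have covC: "covered P [0..<j] ((1/2)^j) (C j) (C (Suc j))" for j
    unfolding covered_def
  proof (intro ballI allI impI)
    fix v and t :: rat assume v: "v \<in> C j" and t: "(1/2)^j < t"
    obtain w where w: "w \<in> A.reach (of_rat (scale (Suc j))) (n (Suc j))" "near P ((1/2)^j) (take j v) (take j w)"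
      using st[of j] nS[of j] v unfolding A.stage_def C_def by blast
    \<comment> \<open>A sublevel set contains whole type classes, so \<open>reach\<close> at scale
      \<open>Suc j\<close> lies inside \<open>C (Suc j)\<close>.\<close>
    have "type_fibre S P (A.initial (n (Suc j))) \<subseteq> sat S P (\<phi> (Suc j)) 0"
      using A.sat_type_closed[of "\<phi> (Suc j)" 0] xV[of "Suc j"] by (auto simp: type_closed_def type_fibre_def)
    then have "w \<in> C (Suc j)"
      using w(1) A.chained_mono unfolding C_def A.reach_def by blast
    moreover have "map ((!) v) [0..<j] = take j v"
      using Clen(1)[OF v] nj[of j] by (intro nth_equalityI) auto
    moreover have "(1/2)^j \<le> (of_rat t :: real)"
    proof -
      have "of_rat ((1/2)^j) < (of_rat t :: real)" using t by (simp only: of_rat_less)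
      then show ?thesis by (simp add: of_rat_power of_rat_divide)
    qed
    ultimately show "\<exists>w\<in>C (Suc j). near P (of_rat t) (map ((!) v) [0..<j]) (take (length [0..<j]) w)"
      using near_mono[OF w(2)] by (intro bexI[of _ w]) auto
  qed
  have covD: "covered P' [0..<j] ((1/2)^j) (D j) (D (Suc j))" for j
    by (rule covered_h[OF clx clx _ _ covC D D])
       (use nj[of j] nj[of "Suc j"] in \<open>auto simp: l_def\<close>)
  have D0: "\<exists>v. v \<in> D 0"
    using B.comp_of_SomeD[OF D[of 0]] chained_refl by fastforce
  have "\<exists>w. w \<in> D (Suc j) \<and> near P' (2 * (1/2)^j) (take j v) (take j w)" if v: "v \<in> D j" for v j
  proof -
    \<comment> \<open>\<open>covered\<close> provides witnesses only above its bound, hence the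
      factor 2.\<close>
    have "(1/2)^j < 2 * (1/2::rat)^j" by simp
    then obtain w where w: "w \<in> D (Suc j)" "near P' (of_rat (2 * (1/2)^j)) (map ((!) v) [0..<j]) (take j w)"
      using covD[of j] v unfolding covered_def by fastforce
    moreover have "map ((!) v) [0..<j] = take j v"
      using Dlen(1)[OF v] nj[of j] by (intro nth_equalityI) auto
    moreover have "(of_rat (2 * (1/2)^j) :: real) = 2 * (1/2)^j"
      by (simp add: of_rat_power of_rat_divide of_rat_mult)
    ultimately show ?thesis by auto
  qed
  then have "\<exists>Z. \<forall>j. Z j \<in> D j \<and> near P' (2 * (1/2)^j) (take j (Z j)) (take j (Z (Suc j)))"
    using D0 by (intro dependent_nat_choice) auto
  then obtain Z where Z: "\<And>j. Z j \<in> D j" "\<And>j. near P' (2 * (1/2)^j) (take j (Z j)) (take j (Z (Suc j)))" by blast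
  have lZ: "length (Z j) = n j" "Z j \<in> lists S'" for j using Dlen[OF Z(1)] by auto
  have ZS: "Z j ! i \<in> S'" if "i < j" for i j
    by (rule B.nth_S) (use lZ[of j] nj[of j] that in auto)
  have "\<exists>zi\<in>S'. (\<lambda>j. P' 0 [Z j ! i, zi]) \<longlonglongrightarrow> 0" for i
  proof -
    \<comment> \<open>Stage \<open>j\<close> controls coordinates below \<open>j\<close> only, so
      coordinate \<open>i\<close> is followed from stage \<open>Suc i\<close> on.\<close>
    have "\<exists>zi\<in>S'. (\<lambda>k. P' 0 [Z (k + Suc i) ! i, zi]) \<longlonglongrightarrow> 0"
    proof (rule B.geometric_limit)
      fix k show "Z (k + Suc i) ! i \<in> S'" by (rule ZS) simp
      have "P' 0 [Z (k + Suc i) ! i, Z (Suc k + Suc i) ! i] < 2 * (1/2) ^ (k + Suc i)"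
        using Z(2)[of "k + Suc i"] lZ[of "k + Suc i"] nj[of "k + Suc i"] by (auto simp: near_nth)
      also have "\<dots> \<le> 2 * (1/2) ^ k" by (intro mult_left_mono power_decreasing) auto
      finally show "P' 0 [Z (k + Suc i) ! i, Z (Suc k + Suc i) ! i] < 2 * (1/2) ^ k" .
    qed
    then obtain zi where "zi \<in> S'" "(\<lambda>k. P' 0 [Z (k + Suc i) ! i, zi]) \<longlonglongrightarrow> 0" by blast
    then show ?thesis using LIMSEQ_offset[of "\<lambda>j. P' 0 [Z j ! i, zi]" "Suc i"] by blast
  qed
  then obtain z where z: "\<And>i. z i \<in> S'" "\<And>i. (\<lambda>j. P' 0 [Z j ! i, z i]) \<longlonglongrightarrow> 0" by metis
  have znear: "eventually (\<lambda>j. near P' e (take k (Z j)) (map z [0..<k])) sequentially" if e: "0 < e" for e k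
  proof -
    have "eventually (\<lambda>j. \<forall>i\<in>{..<k}. P' 0 [Z j ! i, z i] < e) sequentially"
      using order_tendstoD(2)[OF z(2) e] by (intro eventually_ball_finite) auto
    then show ?thesis using eventually_ge_at_top[of k]
    proof eventually_elim
      case (elim j)
      then show ?case using lZ[of j] nj[of j] by (auto simp: near_nth)
    qed
  qed
  have el: "val S' P' \<psi> (map z [0..<k]) = val S P \<psi> (map a [0..<k])" for k \<psi>
  proof -
    have lim: "(\<lambda>j. val S' P' \<psi> (take k (Z j))) \<longlonglongrightarrow> val S' P' \<psi> (map z [0..<k])"
    proof (rule B.val_lim)
      show "take k (Z j) \<in> lists S'" for j using lZ(2)[of j] by (auto dest: in_set_takeD)
    qed (use z(1) znear in auto)
    \<comment> \<open>\<open>subst_vars\<close> turns a formula about the first \<open>k\<close>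
      coordinates into one about the longer tuples. Its number \<open>t\<close> is eventually below
      \<open>j\<close>, from where on its value is pinned.\<close>
    define t where "t = to_nat (subst_vars [0..<k] \<psi>)"
    have ft: "from_nat t = subst_vars [0..<k] \<psi>" by (simp add: t_def)
    have "\<bar>val S' P' \<psi> (take k (Z j)) - val S P \<psi> (map a [0..<k])\<bar> < 1 / real (Suc j)"
      if j: "max k (Suc t) \<le> j" for j
    proof -
      obtain G where G: "\<phi> j = conj_frm G" "\<forall>t<j. \<exists>q q'. (from_nat t, q) \<in> set G \<and> (FNeg (from_nat t), q') \<in> set G \<and>
         of_rat q < val S P (from_nat t) (A.initial (n j)) + 1 / real (Suc j) \<and>
         of_rat q' < - val S P (from_nat t) (A.initial (n j)) + 1 / real (Suc j)"
        using st[of j] unfolding A.stage_def by blast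
      have "Z j \<in> sat S' P' (\<phi> j) 0"
        using B.comp_of_SomeD[OF D[of j]] Z(1)[of j] chained_in by (fastforce simp: l_def)
      then have "val S' P' (conj_frm G) (Z j) < 0" using G(1) by (simp add: sat_def)
      then have c: "val S' P' \<theta> (Z j) < of_rat q" if "(\<theta>, q) \<in> set G" for \<theta> q
        using that unfolding val_conj_frm by blast
      obtain q q' where q: "(from_nat t, q) \<in> set G" "(FNeg (from_nat t), q') \<in> set G"
         "of_rat q < val S P (from_nat t) (A.initial (n j)) + 1 / real (Suc j)"
         "of_rat q' < - val S P (from_nat t) (A.initial (n j)) + 1 / real (Suc j)"
        using G(2) j by (metis Suc_le_eq max.bounded_iff)
      have "\<bar>val S' P' (from_nat t) (Z j) - val S P (from_nat t) (A.initial (n j))\<bar> < 1 / real (Suc j)"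
        using c[OF q(1)] c[OF q(2)] q(3,4) by simp
      moreover have k: "k \<le> n j" using j nj[of j] by simp
      have "val S' P' (from_nat t) (Z j) = val S' P' \<psi> (take k (Z j))"
      proof -
        have "map ((!) (Z j)) [0..<k] = take k (Z j)" using lZ(1)[of j] k by (intro nth_equalityI) auto
        moreover have "set [0..<k] \<subseteq> {..<length (Z j)}" using lZ(1)[of j] k by auto
        ultimately show ?thesis unfolding ft by (simp only: val_subst_vars)
      qed
      moreover have "val S P (from_nat t) (A.initial (n j)) = val S P \<psi> (map a [0..<k])"
      proof -
        have "map ((!) (A.initial (n j))) [0..<k] = map a [0..<k]" using k by (intro nth_equalityI) auto
        moreover have "set [0..<k] \<subseteq> {..<length (A.initial (n j))}" using k by auto
        ultimately show ?thesis unfolding ft by (simp only: val_subst_vars)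
      qed
      ultimately show ?thesis by simp
    qed
    then have "eventually (\<lambda>j. norm (val S' P' \<psi> (take k (Z j)) - val S P \<psi> (map a [0..<k])) \<le> 1 / real (Suc j)) sequentially"
      unfolding eventually_sequentially real_norm_def by (meson less_imp_le)
    then have "(\<lambda>j. val S' P' \<psi> (take k (Z j)) - val S P \<psi> (map a [0..<k])) \<longlonglongrightarrow> 0"
      by (rule Lim_null_comparison) (rule LIMSEQ_Suc[OF lim_1_over_n])
    then have "(\<lambda>j. val S' P' \<psi> (take k (Z j))) \<longlonglongrightarrow> val S P \<psi> (map a [0..<k])"
      by (rule LIM_zero_cancel)
    with lim show ?thesis by (rule LIMSEQ_unique)
  qed
  have hit: "\<exists>w. [w] \<in> D' \<and> w \<in> S' \<and> P' 0 [z i, w] < t"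
    if t: "0 < t" and y: "comp_of S P a y = Some ((1, FZero, 1, 1/4), {v. chained S P (1/4) (sat S P FZero 1) [a i] v})"
      and D': "comp_of S' P' b (h y) = Some (l', D')" for i y t D' l'
  proof -
    have l': "l' = (1, FZero, 1, 1/4)" using comp_of_h[of y l'] y D' by auto
    have t2: "0 < t / 2" using t by simp
    obtain N where N: "\<And>j. N \<le> j \<Longrightarrow> P' 0 [Z j ! i, z i] < t / 2"
      using order_tendstoD(2)[OF z(2) t2] unfolding eventually_sequentially by blast
    define j where "j = max N (Suc i)"
    have j: "i < j" "P' 0 [Z j ! i, z i] < t / 2" using N[of j] by (auto simp: j_def)
    \<comment> \<open>Every list over \<open>S\<close> satisfies \<open>FZero < 1\<close>, so
      coordinate \<open>i\<close> of a chain from \<open>initial (n j)\<close> is itself a chain of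
      the unary component of \<open>a i\<close>; the bound is therefore 0.\<close>
    have "covered P [i] 0 (C j) {v. chained S P (1/4) (sat S P FZero 1) [a i] v}"
      unfolding covered_def
    proof (intro ballI allI impI)
      fix v and r :: rat assume v: "v \<in> C j" and r: "0 < r"
      have vS: "v ! i \<in> S" using A.nth_S[OF Clen(2)[OF v]] Clen(1)[OF v] nj[of j] j(1) by simp
      have I: "set [i] \<subseteq> {..<length (A.initial (n j))}" using nj[of j] j(1) by simp
      have "chained S P (of_rat (scale j)) (sat S P FZero 1) (map ((!) (A.initial (n j))) [i]) (map ((!) v) [i])"
        using v unfolding C_def mem_Collect_eq
      proof (rule chained_map_nth[OF _ _ I])
        fix w assume "w \<in> sat S P (\<phi> j) 0" "length w = length (A.initial (n j))"
        then show "map ((!) w) [i] \<in> sat S P FZero 1"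
          using A.nth_S[of w i] nj[of j] j(1) by (auto simp: sat_def)
      qed
      moreover have "map ((!) (A.initial (n j))) [i] = [a i]" using nj[of j] j(1) by simp
      moreover note scale_le[of j]
      ultimately have "chained S P (1/4) (sat S P FZero 1) [a i] [v ! i]"
        using A.chained_mono[of "of_rat (scale j)" "sat S P FZero 1" "[a i]" "[v ! i]" "sat S P FZero 1" "1/4"] by simp
      then show "\<exists>w\<in>{v. chained S P (1/4) (sat S P FZero 1) [a i] v}. near P (of_rat r) (map ((!) v) [i]) (take (length [i]) w)"
        using vS r by (intro bexI[of _ "[v ! i]"]) (auto simp: near_def)
    qed
    from covered_h[OF clx y _ _ this D D'[unfolded l']] have "covered P' [i] 0 (D j) D'"
      using nj[of j] j(1) by (simp add: l_def)
    moreover obtain r where r: "0 < (of_rat r :: real)" "of_rat r < t / 2" using of_rat_dense[of 0 "t/2"] t by auto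
    ultimately obtain w where w: "w \<in> D'" "near P' (of_rat r) [Z j ! i] (take 1 w)"
      using Z(1)[of j] unfolding covered_def by fastforce
    have "w \<in> lists S'" "length w = 1" using B.comp_of_open[OF D' w(1)] l' by simp_all
    then obtain w0 where w0: "w = [w0]" "w0 \<in> S'" by (auto simp: length_Suc_conv)
    have "P' 0 [Z j ! i, w0] < t / 2" using w(2) w0 r by simp
    then have "P' 0 [z i, w0] < t"
      using j(2) B.dist_tri[OF z(1) ZS[OF j(1)] w0(2), of i] B.dist_sym[OF z(1) ZS[OF j(1)], of i] by linarith
    then show ?thesis using w w0 by blast
  qed
  show ?thesis using z(1) el hit by blast
qed

text \<open>The closure \<open>K\<close> of \<open>z\<close> contains the ball below the radius at
  each \<open>z i\<close>, since finite nets of such balls, taken from \<open>a\<close>, are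
  expressible by formulas. Hence \<open>K\<close> is closed under unary chain steps. The component
  of any \<open>b k\<close> corresponds under \<open>h\<close> to that of some \<open>a i\<close>,
  so it contains points arbitrarily close to \<open>z i\<close>, and a chain from such a point leads
  to \<open>b k\<close> inside \<open>K\<close>.\<close>

lemma dense_elementary_sequence:
  "\<exists>z. (\<forall>i. z i \<in> S') \<and> (\<forall>n \<phi>. val S' P' \<phi> (map z [0..<n]) = val S P \<phi> (map a [0..<n])) \<and>
     (\<forall>y\<in>S'. \<forall>e>0. \<exists>i. P' 0 [z i, y] < e)"
proof -
  obtain z where z: "\<And>i. z i \<in> S'" and el: "\<And>n \<phi>. val S' P' \<phi> (map z [0..<n]) = val S P \<phi> (map a [0..<n])"
    and hit: "\<And>i y t D l. 0 < t \<Longrightarrow> comp_of S P a y = Some ((1, FZero, 1, 1/4), {v. chained S P (1/4) (sat S P FZero 1) [a i] v}) \<Longrightarrow>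
        comp_of S' P' b (h y) = Some (l, D) \<Longrightarrow> (\<exists>w. [w] \<in> D \<and> w \<in> S' \<and> P' 0 [z i, w] < t)"
    using elementary_sequence by blast
  define K where "K = {y\<in>S'. \<forall>e>0. \<exists>i. P' 0 [z i, y] < e}"
  have zK: "z i \<in> K" for i
  proof -
    have "\<exists>k. P' 0 [z k, z i] < e" if "0 < e" for e
      by (rule exI[of _ i]) (simp add: z that)
    then show ?thesis using z by (simp add: K_def)
  qed
  have rz: "radius S' P' (z i) = radius S P (a i)" for i
    using el[of "FRad i" "Suc i"] by (simp add: nth_append del: upt_Suc)
  have K1: "y \<in> K" if y: "y \<in> S'" "P' 0 [z i, y] < radius S' P' (z i)" for i y
  proof -
    obtain r where r: "P' 0 [z i, y] < of_rat r" "of_rat r < radius S P (a i)"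
      using of_rat_dense[OF y(2)] rz by auto
    have r0: "0 \<le> (of_rat r :: real)" using r(1) B.dist_nonneg[OF z y(1), of i] by linarith
    have "\<exists>k. P' 0 [z k, y] < e" if e: "0 < e" for e
    proof -
      obtain e1 where e1: "0 < (of_rat e1 :: real)" "of_rat e1 < e" using of_rat_dense[OF e] by blast
      obtain m where m: "1 / real (Suc m) < of_rat e1 / 2" using nat_approx_posE[of "of_rat e1 / 2"] e1 by auto
      obtain F where F: "set F \<subseteq> S" "\<And>w. w\<in>S \<Longrightarrow> P 0 [a i, w] < of_rat r \<Longrightarrow> \<exists>f\<in>set F. P 0 [f, w] < 1 / real (Suc m)"
        using radius_tb_ball[OF r(2) r0] unfolding tb_ball_def by meson
      have "\<exists>j. P 0 [a j, f] < of_rat e1 / 2" if "f \<in> set F" for f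
        using A.a_dense[of f "of_rat e1 / 2"] F(1) e1(1) that by auto
      then obtain g where g: "\<And>f. f \<in> set F \<Longrightarrow> P 0 [a (g f), f] < of_rat e1 / 2" by metis
      define k where "k = Suc (Max (insert i (g ` set F)))"
      have ik: "i < k" "\<And>f. f \<in> set F \<Longrightarrow> g f < k" by (auto simp: k_def less_Suc_eq_le)
      \<comment> \<open>Under \<open>FInf\<close> this says that some point of the
        \<open>r\<close>-ball at coordinate \<open>i\<close> has distance greater than
        \<open>e1\<close> from the first \<open>k\<close> points. The net makes it fail at
        \<open>a\<close>, hence it fails at \<open>z\<close>.\<close>
      define G where "G = (FAtom 0 [Suc i, 0], r) # map (\<lambda>l. (FNeg (FAtom 0 [Suc l, 0]), - e1)) [0..<k]"
      have "\<not> val S P (FInf (conj_frm G)) (map a [0..<k]) < 0"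
      proof
        assume "val S P (FInf (conj_frm G)) (map a [0..<k]) < 0"
        then obtain w where w: "w \<in> S" "val S P (conj_frm G) (w # map a [0..<k]) < 0"
          using A.val_FInf_less[OF A.initial_S] by blast
        then have w1: "P 0 [a i, w] < of_rat r" "\<And>l. l < k \<Longrightarrow> - P 0 [a l, w] < - of_rat e1"
          using ik(1) by (auto simp: val_conj_frm G_def of_rat_minus)
        obtain f where f: "f \<in> set F" "P 0 [f, w] < 1 / real (Suc m)" using F(2)[OF w(1) w1(1)] by blast
        have "P 0 [a (g f), w] < of_rat e1"
          using A.dist_tri[of "a (g f)" f w] A.a_S F(1) f w(1) g[OF f(1)] m by fastforce
        then show False using w1(2)[OF ik(2)[OF f(1)]] by simp
      qed
      then have "\<not> val S' P' (FInf (conj_frm G)) (map z [0..<k]) < 0" unfolding el .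
      moreover have zl: "map z [0..<k] \<in> lists S'" using z by auto
      ultimately have "\<not> val S' P' (conj_frm G) (y # map z [0..<k]) < 0"
        using B.val_FInf_less[OF zl] y(1) by blast
      then obtain l where "l < k" "\<not> - P' 0 [z l, y] < - of_rat e1"
        using ik(1) r(1) by (auto simp: val_conj_frm G_def of_rat_minus)
      then show ?thesis using e1(2) by (intro exI[of _ l]) simp
    qed
    then show ?thesis using y(1) by (simp add: K_def)
  qed
  have K2: "v \<in> K" if y: "y \<in> K" and v: "v \<in> S'" "P' 0 [y, v] < radius S' P' y" for y v
  proof -
    have yS: "y \<in> S'" using y by (simp add: K_def)
    \<comment> \<open>Replacing \<open>y\<close> by \<open>z i\<close> costs
      \<open>P' 0 [z i, y]\<close> twice, once in the distance to \<open>v\<close> and once in the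
      radius, hence the half.\<close>
    have "0 < (radius S' P' y - P' 0 [y, v]) / 2" using v(2) by simp
    then obtain i where i: "P' 0 [z i, y] < (radius S' P' y - P' 0 [y, v]) / 2"
      using y unfolding K_def by blast
    have "P' 0 [z i, v] < radius S' P' (z i)"
      using i B.dist_tri[OF z yS v(1), of i] B.radius_lip1[OF yS z, of i] B.dist_sym[OF yS z, of i] by argo
    then show ?thesis by (rule K1[OF v(1)])
  qed
  have bK: "b k \<in> K" for k
  proof -
    \<comment> \<open>\<open>FZero < 1\<close> holds everywhere, so this code names the unary
      component of \<open>b k\<close> in the whole carrier.\<close>
    obtain e where e: "decode e = (FZero, 1, 1/4, [k])" using decode_surj by blast
    obtain y where y: "e = h y" using bij_h by (metis bij_pointE)
    define D where "D = {v. chained S' P' (1/4) (sat S' P' FZero 1) [b k] v}"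
    have r4: "(of_rat (1/4) :: real) = 1/4" by (simp add: of_rat_divide)
    have D: "comp_of S' P' b (h y) = Some ((1, FZero, 1, 1/4), D)"
      unfolding y[symmetric] by (simp add: comp_of_def e D_def r4)
    then obtain C where C: "comp_of S P a y = Some ((1, FZero, 1, 1/4), C)" using comp_of_h by blast
    obtain \<phi> q s js where js: "(1, FZero, 1, 1/4) = (length js, \<phi>, q, s)"
       "C = {v. chained S P (of_rat s) (sat S P \<phi> q) (map a js) v}" using A.comp_of_SomeD[OF C] by blast
    have q: "length js = 1" "\<phi> = FZero" "q = 1" "s = 1/4" using js(1) by (metis prod.inject)+
    then obtain i where "js = [i]" by (cases js) auto
    then have Ci: "C = {v. chained S P (1/4) (sat S P FZero 1) [a i] v}"
      unfolding js(2) q r4 by simp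
    obtain w where w: "[w] \<in> D" "w \<in> S'" "P' 0 [z i, w] < radius S' P' (z i)"
      using hit[OF B.radius_pos[OF z] C[unfolded Ci] D] by blast
    have "chained S' P' (1/4) (sat S' P' FZero 1) [w] [b k]"
      using B.chained_sym[OF _ B.sat_lists] w(1) by (simp add: D_def)
    then have "hd [b k] \<in> K"
    proof (induction rule: chained_induct)
      case base
      then show ?case using K2[OF zK w(2,3)] by simp
    next
      case (step v u)
      obtain v0 u0 where vu: "v = [v0]" "u = [u0]"
        using chained_length[OF step.hyps(1)] list_all2_lengthD[OF step.hyps(4)] by (auto simp: length_Suc_conv)
      have uS: "u0 \<in> S'" using step.hyps(3) B.sat_lists vu by fastforce
      have "P' 0 [v0, u0] < 1/4 * min (radius S' P' v0) (radius S' P' u0)" using step.hyps(4) vu by (simp add: linked_def)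
      also have "\<dots> \<le> radius S' P' v0" using radius_nonneg[of S' P' v0] by (auto simp: min_def)
      finally show ?case using K2[OF _ uS, of v0] step.IH vu by simp
    qed
    then show ?thesis by simp
  qed
  have "\<exists>i. P' 0 [z i, y] < e" if y: "y \<in> S'" "0 < e" for y e
  proof -
    obtain k where k: "P' 0 [b k, y] < e / 2" using B.a_dense[OF y(1), of "e/2"] y(2) by auto
    obtain i where "P' 0 [z i, b k] < e / 2" using bK[of k] y(2) unfolding K_def by (auto dest: spec[of _ "e/2"])
    then show ?thesis using k B.dist_tri[OF z B.a_S y(1), of i k] by (intro exI[of _ i]) linarith
  qed
  with z el show ?thesis by blast
qed

end

section \<open>Structures and their codes\<close>

text \<open>Irrelevant arguments get the default value used by \<open>code\<close>, so that a code
  is literally a \<open>pullback\<close>.\<close>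

definition predc :: "signature \<Rightarrow> 'a mstruct \<Rightarrow> 'a preds" where
  "predc L M i xs = (if i \<in> symbols L \<and> length xs = arity L i then pred M i xs else 0)"

lemma code_pullback: "code L M a = pullback (predc L M) a"
  by (simp add: fun_eq_iff code_def pullback_def predc_def)

section \<open>Isomorphisms from matching dense sequences\<close>

lemma complete_preds_limit:
  assumes "complete_preds S P" "complete_preds S' P'"
    and a: "\<And>i. a i \<in> S" "\<And>x e. x \<in> S \<Longrightarrow> 0 < e \<Longrightarrow> \<exists>i. P 0 [a i, x] < e"
    and z: "\<And>i. z i \<in> S'" and eq: "\<And>i js. P i (map a js) = P' i (map z js)" and x: "x \<in> S"
  shows "\<exists>y\<in>S'. \<forall>i. P 0 [a i, x] = P' 0 [z i, y]"
proof -
  interpret A: complete_preds S P by fact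
  interpret B: complete_preds S' P' by fact
  have eq2: "P 0 [a i, a j] = P' 0 [z i, z j]" for i j using eq[of 0 "[i, j]"] by simp
  have "\<exists>i. P 0 [a i, x] < 1 / real (Suc n)" for n using a(2)[OF x, of "1 / real (Suc n)"] by simp
  then obtain k where k: "\<And>n. P 0 [a (k n), x] < 1 / real (Suc n)" by metis
  have "(\<lambda>n. P 0 [a (k n), x]) \<longlonglongrightarrow> 0"
    by (rule tendsto_sandwich[OF _ _ tendsto_const LIMSEQ_Suc[OF lim_1_over_n]])
       (use k A.dist_nonneg[OF a(1) x] in \<open>auto intro: always_eventually less_imp_le\<close>)
  have "\<exists>y\<in>S'. (\<lambda>n. P' 0 [z (k n), y]) \<longlonglongrightarrow> 0"
  proof (rule B.complete)
    fix e :: real assume "0 < e"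
    then obtain N where N: "1 / real (Suc N) < e / 2" using nat_approx_posE[of "e/2"] by auto
    have s: "P 0 [a (k m), x] < e / 2" if "N \<le> m" for m
    proof -
      have "1 / real (Suc m) \<le> 1 / real (Suc N)" using that by (simp add: frac_le)
      then show ?thesis using k[of m] N by linarith
    qed
    have "P' 0 [z (k m), z (k n)] < e" if "N \<le> m" "N \<le> n" for m n
      using s[OF that(1)] s[OF that(2)] A.dist_tri[OF a(1) x a(1), of "k m" "k n"]
        A.dist_sym[OF a(1) x, of "k n"] eq2[of "k m" "k n"] by linarith
    then show "\<exists>N. \<forall>m\<ge>N. \<forall>n\<ge>N. P' 0 [z (k m), z (k n)] < e" by blast
  qed (rule z)
  then obtain y where y: "y \<in> S'" "(\<lambda>n. P' 0 [z (k n), y]) \<longlonglongrightarrow> 0" by blast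
  have "P 0 [a i, x] = P' 0 [z i, y]" for i
  proof -
    have "(\<lambda>n. P 0 [a (k n), x] + P' 0 [z (k n), y]) \<longlonglongrightarrow> 0 + 0"
      by (rule tendsto_add) fact+
    moreover have "\<bar>P 0 [a i, x] - P' 0 [z i, y]\<bar> \<le> P 0 [a (k n), x] + P' 0 [z (k n), y]" for n
      using A.dist_tri[OF a(1) a(1) x, of i "k n"] A.dist_tri[OF a(1) x a(1), of i "k n"] A.dist_sym[OF a(1) x, of "k n"]
        B.dist_tri[OF z z y(1), of i "k n"] B.dist_tri[OF z y(1) z, of i "k n"] B.dist_sym[OF z y(1), of "k n"]
        eq2[of i "k n"] by linarith
    ultimately have "\<bar>P 0 [a i, x] - P' 0 [z i, y]\<bar> \<le> 0"
      by (intro LIMSEQ_le_const[where X = "\<lambda>n. P 0 [a (k n), x] + P' 0 [z (k n), y]"]) auto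
    then show ?thesis by simp
  qed
  with y(1) show ?thesis by blast
qed

text \<open>A point is sent to the one with the same distances to the dense sequence, which exists
  by completeness. Agreement of the predicates extends from the dense sequences by uniform
  continuity.\<close>

lemma iso_of_dense:
  assumes A: "complete_preds S P" and B: "complete_preds S' P'"
    and a: "\<And>i. a i \<in> S" "\<And>x e. x \<in> S \<Longrightarrow> 0 < e \<Longrightarrow> \<exists>i. P 0 [a i, x] < e"
    and z: "\<And>i. z i \<in> S'" "\<And>x e. x \<in> S' \<Longrightarrow> 0 < e \<Longrightarrow> \<exists>i. P' 0 [z i, x] < e"
    and eq: "\<And>i js. P i (map a js) = P' i (map z js)"
  shows "\<exists>h. bij_betw h S S' \<and> (\<forall>i. \<forall>xs\<in>lists S. P' i (map h xs) = P i xs)"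
proof -
  interpret A: complete_preds S P by fact
  interpret B: complete_preds S' P' by fact
  have "\<exists>y\<in>S'. \<forall>i. P 0 [a i, x] = P' 0 [z i, y]" if "x \<in> S" for x
    by (rule complete_preds_limit[where a=a and z=z, OF A B a z(1) eq that])
  then obtain h where h: "\<And>x. x \<in> S \<Longrightarrow> h x \<in> S'" "\<And>x i. x \<in> S \<Longrightarrow> P 0 [a i, x] = P' 0 [z i, h x]" by metis
  have "bij_betw h S S'"
    unfolding bij_betw_def
  proof
    show "inj_on h S"
    proof
      fix x y assume xy: "x \<in> S" "y \<in> S" "h x = h y"
      have "P 0 [x, y] < e" if "0 < e" for e
      proof -
        obtain i where "P 0 [a i, x] < e / 2" using a(2)[OF xy(1), of "e/2"] \<open>0 < e\<close> by auto
        then show ?thesis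
          using h(2)[OF xy(1), of i] h(2)[OF xy(2), of i] xy(3)
            A.dist_tri[OF xy(1) a(1) xy(2), of i] A.dist_sym[OF xy(1) a(1), of i] by simp
      qed
      then have "P 0 [x, y] \<le> 0" by (metis linorder_not_less less_irrefl)
      then show "x = y" using A.dist_nonneg[OF xy(1,2)] A.dist_zero[OF xy(1,2)] by simp
    qed
    show "h ` S = S'"
    proof
      show "S' \<subseteq> h ` S"
      proof
        fix y assume y: "y \<in> S'"
        have "\<exists>x\<in>S. \<forall>i. P' 0 [z i, y] = P 0 [a i, x]"
          by (rule complete_preds_limit[where a=z and z=a, OF B A z a(1) eq[symmetric] y])
        then obtain x where x: "x \<in> S" "\<And>i. P' 0 [z i, y] = P 0 [a i, x]" by blast
        have "P' 0 [y, h x] < e" if "0 < e" for e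
        proof -
          obtain i where "P' 0 [z i, y] < e / 2" using z(2)[OF y, of "e/2"] \<open>0 < e\<close> by auto
          then show ?thesis
            using h(2)[OF x(1), of i] x(2)[of i] B.dist_tri[OF y z(1) h(1)[OF x(1)], of i]
              B.dist_sym[OF y z(1), of i] by simp
        qed
        then have "P' 0 [y, h x] \<le> 0" by (metis linorder_not_less less_irrefl)
        then have "y = h x" using B.dist_nonneg[OF y h(1)[OF x(1)]] B.dist_zero[OF y h(1)[OF x(1)]] by simp
        then show "y \<in> h ` S" using x(1) by blast
      qed
    qed (use h in auto)
  qed
  moreover have "P' i (map h xs) = P i xs" if xs: "xs \<in> lists S" for i xs
  proof -
    have hS: "map h xs \<in> lists S'" using xs h(1) by auto
    have "\<bar>P' i (map h xs) - P i xs\<bar> < e" if e: "0 < e" for e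
    proof -
      obtain \<delta> where \<delta>: "\<delta> > 0" "\<forall>us\<in>lists S. \<forall>ys\<in>lists S. length us = length xs \<longrightarrow>
        near P \<delta> us ys \<longrightarrow> \<bar>P i us - P i ys\<bar> < e/2" using A.preds_uc[of "e/2" "length xs" i] e by auto
      obtain \<delta>' where \<delta>': "\<delta>' > 0" "\<forall>us\<in>lists S'. \<forall>ys\<in>lists S'. length us = length xs \<longrightarrow>
        near P' \<delta>' us ys \<longrightarrow> \<bar>P' i us - P' i ys\<bar> < e/2" using B.preds_uc[of "e/2" "length xs" i] e by auto
      have "\<exists>js. near P (min \<delta> \<delta>') (map a js) xs" using xs
      proof (induction xs rule: list.induct)
        case (Cons x xs)
        then obtain js where "near P (min \<delta> \<delta>') (map a js) xs" by auto
        moreover obtain j where "P 0 [a j, x] < min \<delta> \<delta>'" using a(2)[of x "min \<delta> \<delta>'"] Cons.prems \<delta>(1) \<delta>'(1) by auto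
        ultimately show ?case by (intro exI[of _ "j # js"]) simp
      qed (simp add: near_def)
      then obtain js where js: "near P (min \<delta> \<delta>') (map a js) xs" by blast
      have l: "length js = length xs" using near_length[OF js] by simp
      have aS: "map a js \<in> lists S" "map z js \<in> lists S'" using a z by auto
      have "near P' (min \<delta> \<delta>') (map z js) (map h xs)"
        using js l h(2) A.nth_S[OF xs] by (auto simp: near_nth)
      then have "\<bar>P' i (map z js) - P' i (map h xs)\<bar> < e/2"
        using \<delta>'(2) aS(2) hS l near_mono[of P' "min \<delta> \<delta>'" _ _ \<delta>'] by simp
      moreover have "\<bar>P i (map a js) - P i xs\<bar> < e/2"
        using \<delta>(2) aS(1) xs l near_mono[OF js, of \<delta>] by simp
      ultimately show ?thesis using eq[of i js] by linarith
    qed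
    then have "\<bar>P' i (map h xs) - P i xs\<bar> \<le> 0" by (metis linorder_not_less less_irrefl)
    then show ?thesis by simp
  qed
  ultimately show ?thesis by blast
qed

section \<open>Locally compact structures satisfy the locale assumptions\<close>

lemma modulus_small:
  assumes m: "is_modulus n \<Delta>" and e: "0 < e"
  shows "\<exists>\<delta>>0. \<forall>r. length r = n \<longrightarrow> (\<forall>x\<in>set r. 0 \<le> x \<and> x < \<delta>) \<longrightarrow> \<Delta> r < e"
proof -
  have c: "continuous_map (product_topology (\<lambda>_. top_of_set {0..}) {..<n}) euclideanreal (\<lambda>r. \<Delta> (map r [0..<n]))"
    and z: "\<Delta> (replicate n 0) = 0"
    and mono: "\<And>r s. length r = n \<Longrightarrow> length s = n \<Longrightarrow> (\<forall>x\<in>set r. 0 \<le> x) \<Longrightarrow> (\<forall>x\<in>set s. 0 \<le> x) \<Longrightarrow>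
        \<Delta> r \<le> \<Delta> (map2 (+) r s)"
    using m by (auto simp: is_modulus_def)
  have "continuous_map (top_of_set {0::real..}) (product_topology (\<lambda>_. top_of_set {0..}) {..<n}) (\<lambda>t. \<lambda>i\<in>{..<n}. t)"
    by (auto simp: continuous_map_componentwise)
  from continuous_map_compose[OF this c]
  have "continuous_map (top_of_set {0::real..}) euclideanreal (\<lambda>t. \<Delta> (replicate n t))"
    by (rule continuous_map_eq) (auto simp: comp_def map_replicate_const intro!: arg_cong[where f = \<Delta>] nth_equalityI)
  then have "continuous_on {0..} (\<lambda>t::real. \<Delta> (replicate n t))" by simp
  then obtain d where d: "d > 0" "\<And>t. 0 \<le> t \<Longrightarrow> t < d \<Longrightarrow> \<bar>\<Delta> (replicate n t)\<bar> < e"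
    using e z unfolding continuous_on_iff by (force simp: dist_real_def)
  have "\<Delta> r < e" if r: "length r = n" "\<forall>x\<in>set r. 0 \<le> x \<and> x < d / 2" for r
  proof -
    \<comment> \<open>Monotonicity of a modulus is stated through addition, so each coordinate is
      filled up to \<open>d / 2\<close>; continuity on the diagonal then suffices.\<close>
    have "\<Delta> r \<le> \<Delta> (map2 (+) r (map (\<lambda>x. d/2 - x) r))" using r by (intro mono) auto
    also have "map2 (+) r (map (\<lambda>x. d/2 - x) r) = replicate n (d/2)"
      using r(1) by (intro nth_equalityI) auto
    also have "\<Delta> (replicate n (d/2)) < e" using d(2)[of "d/2"] d(1) by simp
    finally show ?thesis .
  qed
  then show ?thesis using d(1) by (intro exI[of _ "d/2"]) auto
qed

lemma structure_complete_preds: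
  assumes L: "is_signature L" and M: "is_structure L M"
  shows "complete_preds (univ M) (predc L M)"
proof -
  interpret D: Metric_space "univ M" "sdist M" using M by (simp add: is_structure_def)
  have d: "predc L M 0 [x, y] = sdist M x y" if "x \<in> univ M" "y \<in> univ M" for x y
    using L that by (simp add: is_signature_def predc_def sdist_def)
  have R: "pred M i xs \<in> {lower L i..upper L i}"
      "\<bar>pred M i xs - pred M i ys\<bar> \<le> modulus L i (map2 (sdist M) xs ys)"
    if "i \<in> symbols L" "xs \<in> lists (univ M)" "length xs = arity L i" "ys \<in> lists (univ M)" "length ys = arity L i" for i xs ys
  proof -
    have "set xs \<subseteq> univ M \<and> length xs = arity L i \<and> set ys \<subseteq> univ M \<and> length ys = arity L i"
      using that by auto
    then have "pred M i xs \<in> {lower L i..upper L i} \<and>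
        \<bar>pred M i xs - pred M i ys\<bar> \<le> modulus L i (map2 (sdist M) xs ys)"
      using M that(1) unfolding is_structure_def by meson
    then show "pred M i xs \<in> {lower L i..upper L i}"
      "\<bar>pred M i xs - pred M i ys\<bar> \<le> modulus L i (map2 (sdist M) xs ys)" by blast+
  qed
  show ?thesis
  proof
    show "univ M \<noteq> {}" using M by (simp add: is_structure_def)
    fix x y assume xy: "x \<in> univ M" "y \<in> univ M"
    show "0 \<le> predc L M 0 [x, y]" using d xy by simp
    show "predc L M 0 [x, y] = 0 \<longleftrightarrow> x = y" using d xy by simp
    show "predc L M 0 [x, y] = predc L M 0 [y, x]" using d xy D.commute by simp
    fix w assume "w \<in> univ M"
    then show "predc L M 0 [x, w] \<le> predc L M 0 [x, y] + predc L M 0 [y, w]"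
      using d xy D.triangle by simp
  next
    fix i
    have "\<bar>predc L M i xs\<bar> \<le> max \<bar>lower L i\<bar> \<bar>upper L i\<bar>" if "xs \<in> lists (univ M)" for xs
      using R(1)[of i xs xs] that by (auto simp: predc_def)
    then show "\<exists>B. \<forall>xs\<in>lists (univ M). \<bar>predc L M i xs\<bar> \<le> B" by blast
  next
    fix i n and e :: real assume e: "0 < e"
    show "\<exists>\<delta>>0. \<forall>xs\<in>lists (univ M). \<forall>ys\<in>lists (univ M). length xs = n \<longrightarrow>
      near (predc L M) \<delta> xs ys \<longrightarrow> \<bar>predc L M i xs - predc L M i ys\<bar> < e"
    proof (cases "i \<in> symbols L \<and> n = arity L i")
      case True
      then have "is_modulus n (modulus L i)" using L by (auto simp: is_signature_def)
      from modulus_small[OF this e] obtain \<delta> where \<delta>: "\<delta> > 0"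
        "\<And>r. length r = n \<Longrightarrow> (\<forall>x\<in>set r. 0 \<le> x \<and> x < \<delta>) \<Longrightarrow> modulus L i r < e" by blast
      have "\<bar>predc L M i xs - predc L M i ys\<bar> < e"
        if s: "xs \<in> lists (univ M)" "ys \<in> lists (univ M)" "length xs = n" "near (predc L M) \<delta> xs ys" for xs ys
      proof -
        have l: "length ys = n" using near_length[OF s(4)] s(3) by simp
        have "modulus L i (map2 (sdist M) xs ys) < e"
        proof (rule \<delta>(2))
          show "\<forall>x\<in>set (map2 (sdist M) xs ys). 0 \<le> x \<and> x < \<delta>"
          proof
            fix u assume "u \<in> set (map2 (sdist M) xs ys)"
            then obtain k where k: "k < n" "u = sdist M (xs ! k) (ys ! k)"
              using s(3) l by (auto simp: set_zip)
            then have "xs ! k \<in> univ M" "ys ! k \<in> univ M" using s l by (auto simp: subset_iff)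
            then show "0 \<le> u \<and> u < \<delta>" using s(3,4) k d by (auto simp: near_nth)
          qed
        qed (use s l in simp)
        then show ?thesis using R(2)[of i xs ys] s l True by (simp add: predc_def del: in_lists_conv_set)
      qed
      then show ?thesis using \<delta>(1) by blast
    next
      case False
      have "\<bar>predc L M i xs - predc L M i ys\<bar> < e" if "length xs = n" "near (predc L M) 1 xs ys" for xs ys
        using that near_length[OF that(2)] False e by (auto simp: predc_def)
      then show ?thesis by (intro exI[of _ 1]) auto
    qed
  next
    fix \<sigma> :: "nat \<Rightarrow> 'a"
    assume \<sigma>: "\<And>n. \<sigma> n \<in> univ M" and c: "\<And>e. 0 < e \<Longrightarrow> \<exists>N. \<forall>m\<ge>N. \<forall>n\<ge>N. predc L M 0 [\<sigma> m, \<sigma> n] < e"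
    have "D.MCauchy \<sigma>" using \<sigma> c d by (fastforce simp: D.MCauchy_def)
    moreover have "D.mcomplete" using M by (simp only: is_structure_def)
    ultimately obtain l where "limitin D.mtopology \<sigma> l sequentially"
      unfolding D.mcomplete_def by blast
    then have l: "l \<in> univ M" "\<And>e. 0 < e \<Longrightarrow> eventually (\<lambda>n. sdist M (\<sigma> n) l < e) sequentially"
      by (auto simp: D.limitin_metric elim: eventually_mono)
    have "(\<lambda>n. predc L M 0 [\<sigma> n, l]) \<longlonglongrightarrow> 0"
      by (rule tendstoI) (use l \<sigma> d in \<open>auto simp: dist_real_def\<close>)
    then show "\<exists>l\<in>univ M. (\<lambda>n. predc L M 0 [\<sigma> n, l]) \<longlonglongrightarrow> 0" using l(1) by blast
  qed
qed

lemma tail_dense_dense: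
  assumes L: "is_signature L" and M: "is_structure L M" and a: "tail_dense M a"
  shows "a i \<in> univ M" "x \<in> univ M \<Longrightarrow> 0 < e \<Longrightarrow> \<exists>i. predc L M 0 [a i, x] < e"
proof -
  interpret D: Metric_space "univ M" "sdist M" using M by (simp add: is_structure_def)
  show aM: "a i \<in> univ M" for i using a by (auto simp: tail_dense_def)
  assume x: "x \<in> univ M" and e: "0 < e"
  have "x \<in> D.mtopology closure_of (a ` {0..})" using a x unfolding tail_dense_def by blast
  then obtain i where i: "sdist M x (a i) < e" using e unfolding D.metric_closure_of by auto
  have "predc L M 0 [a i, x] = sdist M (a i) x"
    using L x aM by (simp add: is_signature_def predc_def sdist_def)
  then show "\<exists>i. predc L M 0 [a i, x] < e" using i D.commute by metis
qed

lemma locally_compact_radius: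
  assumes L: "is_signature L" and M: "is_structure L M"
    and loc: "locally_compact_space (structure_topology M)" and x: "x \<in> univ M"
  shows "0 < radius (univ M) (predc L M) x"
proof -
  interpret D: Metric_space "univ M" "sdist M" using M by (simp add: is_structure_def)
  have d: "predc L M 0 [u, v] = sdist M u v" if "u \<in> univ M" "v \<in> univ M" for u v
    using L that by (simp add: is_signature_def predc_def sdist_def)
  obtain U K where UK: "openin D.mtopology U" "compactin D.mtopology K" "x \<in> U" "U \<subseteq> K"
    using loc x unfolding locally_compact_space_def D.topspace_mtopology by blast
  obtain r where r: "0 < r" "D.mball x r \<subseteq> U" using UK(1,3) unfolding D.openin_mtopology by blast
  have tK: "D.mtotally_bounded K" using D.compactin_imp_mtotally_bounded[OF UK(2)] .
  \<comment> \<open>The minimum with 1 respects the cap on \<open>radius\<close> in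
    \<open>tb_ball_radius\<close>.\<close>
  have "tb_ball (univ M) (predc L M) x (min r 1)"
    unfolding tb_ball_def
  proof
    fix n :: nat
    obtain F where F: "finite F" "F \<subseteq> K" "K \<subseteq> (\<Union>f\<in>F. D.mball f (1 / real (Suc n)))"
      using tK unfolding D.mtotally_bounded_def by (metis divide_pos_pos of_nat_0_less_iff zero_less_Suc zero_less_one)
    obtain fs where fs: "set fs = F" using finite_list[OF F(1)] by blast
    have "F \<subseteq> univ M" using F(2) D.mtotally_bounded_imp_subset[OF tK] by blast
    moreover have "\<exists>f\<in>F. predc L M 0 [f, y] < 1 / real (Suc n)" if y: "y \<in> univ M" "predc L M 0 [x, y] < min r 1" for y
    proof -
      have "y \<in> D.mball x r" using y x d by simp
      then obtain f where "f \<in> F" "y \<in> D.mball f (1 / real (Suc n))" using r UK F(3) by blast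
      then show ?thesis using d by (intro bexI[of _ f]) auto
    qed
    ultimately show "\<exists>F. set F \<subseteq> univ M \<and> (\<forall>y\<in>univ M. predc L M 0 [x, y] < min r 1 \<longrightarrow>
       (\<exists>f\<in>set F. predc L M 0 [f, y] < 1 / real (Suc n)))"
      using fs by blast
  qed
  from tb_ball_radius[OF this] show ?thesis using r(1) by linarith
qed

lemma model_dense_preds:
  assumes L: "is_signature L" and M: "is_structure L M"
    and loc: "locally_compact_space (structure_topology M)" and a: "tail_dense M a"
  shows "dense_preds (univ M) (predc L M) a"
proof -
  interpret complete_preds "univ M" "predc L M" by (rule structure_complete_preds[OF L M])
  show ?thesis
    by unfold_locales (use locally_compact_radius[OF L M loc] tail_dense_dense[OF L M a] in auto)
qed

lemma isomorphicI:
  assumes "bij_betw h (univ M) (univ N)" "\<And>i xs. xs \<in> lists (univ M) \<Longrightarrow> predc L N i (map h xs) = predc L M i xs"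
  shows "isomorphic L M N"
  unfolding isomorphic_def
proof (intro exI[of _ h] conjI assms(1) ballI allI impI)
  fix i xs assume "i \<in> symbols L" "set xs \<subseteq> univ M \<and> length xs = arity L i"
  moreover from this have "xs \<in> lists (univ M)" by auto
  ultimately show "pred N i (map h xs) = pred M i xs"
    using assms(2)[of xs i] by (simp add: predc_def)
qed

lemma isomorphic_trans:
  assumes "isomorphic L M N" "isomorphic L N K"
  shows "isomorphic L M K"
proof -
  obtain g where g: "bij_betw g (univ M) (univ N)"
    "\<And>i xs. i \<in> symbols L \<Longrightarrow> set xs \<subseteq> univ M \<Longrightarrow> length xs = arity L i \<Longrightarrow> pred N i (map g xs) = pred M i xs"
    using assms(1) unfolding isomorphic_def by blast
  obtain h where h: "bij_betw h (univ N) (univ K)"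
    "\<And>i xs. i \<in> symbols L \<Longrightarrow> set xs \<subseteq> univ N \<Longrightarrow> length xs = arity L i \<Longrightarrow> pred K i (map h xs) = pred N i xs"
    using assms(2) unfolding isomorphic_def by blast
  show ?thesis
    unfolding isomorphic_def
  proof (intro exI[of _ "h \<circ> g"] conjI ballI allI impI)
    show "bij_betw (h \<circ> g) (univ M) (univ K)" using g(1) h(1) by (rule bij_betw_trans)
    fix i xs assume i: "i \<in> symbols L" "set xs \<subseteq> univ M \<and> length xs = arity L i"
    then have "set (map g xs) \<subseteq> univ N" using bij_betw_apply[OF g(1)] by auto
    from h(2)[OF i(1) this] g(2)[OF i(1)] i(2) show "pred K i (map (h \<circ> g) xs) = pred M i xs" by simp
  qed
qed

text \<open>\<open>iso_codes\<close> may use other representatives of a code than those obtained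
  from \<open>Mod\<close>; this result identifies them.\<close>

lemma isomorphic_of_code:
  assumes L: "is_signature L" and M: "is_structure L M" "tail_dense M a"
    and N: "is_structure L N" "tail_dense N b" and c: "code L M a = code L N b"
  shows "isomorphic L M N"
proof -
  have eq: "predc L M i (map a js) = predc L N i (map b js)" for i js
    using fun_cong[OF fun_cong[OF c, of i], of js] by (simp add: code_pullback pullback_def)
  have "\<exists>h. bij_betw h (univ M) (univ N) \<and>
      (\<forall>i. \<forall>xs\<in>lists (univ M). predc L N i (map h xs) = predc L M i xs)"
    by (rule iso_of_dense[OF structure_complete_preds[OF L M(1)] structure_complete_preds[OF L N(1)]
          tail_dense_dense[OF L M] tail_dense_dense[OF L N] eq])
  then obtain h where h: "bij_betw h (univ M) (univ N)"
    "\<forall>i. \<forall>xs\<in>lists (univ M). predc L N i (map h xs) = predc L M i xs" by (elim exE conjE)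
  show ?thesis by (rule isomorphicI[OF h(1)]) (rule h(2)[rule_format])
qed

text \<open>Pulling the dense sequence back along the isomorphism reduces a comparison of two
  structures to one of two dense sequences in a single structure.\<close>

lemma isomorphic_transport:
  assumes L: "is_signature L" and iso: "isomorphic L M N"
    and M: "dense_preds (univ M) (predc L M) a" and N: "dense_preds (univ N) (predc L N) b"
  shows "\<exists>b'. dense_preds (univ M) (predc L M) b' \<and> code L N b = code L M b'"
proof -
  interpret M: dense_preds "univ M" "predc L M" a by fact
  interpret N: dense_preds "univ N" "predc L N" b by fact
  obtain g where g: "bij_betw g (univ M) (univ N)"
    "\<And>i xs. i \<in> symbols L \<Longrightarrow> set xs \<subseteq> univ M \<Longrightarrow> length xs = arity L i \<Longrightarrow> pred N i (map g xs) = pred M i xs"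
    using iso unfolding isomorphic_def by blast
  have gp: "predc L N i (map g xs) = predc L M i xs" if "set xs \<subseteq> univ M" for i xs
    using g(2) that by (simp add: predc_def)
  define b' where "b' j = inv_into (univ M) g (b j)" for j
  have b': "b' j \<in> univ M" "g (b' j) = b j" for j
    using bij_betw_imp_surj_on[OF g(1)] N.a_S[of j] unfolding b'_def
    by (metis inv_into_into, metis f_inv_into_f)
  have "dense_preds (univ M) (predc L M) b'"
  proof
    fix x and e :: real assume x: "x \<in> univ M" and e: "0 < e"
    have "g x \<in> univ N" using bij_betw_apply[OF g(1) x] .
    from N.a_dense[OF this e] obtain j where "predc L N 0 [b j, g x] < e" by blast
    then have "predc L M 0 [b' j, x] < e" using gp[of "[b' j, x]" 0] b' x by simp
    then show "\<exists>i. predc L M 0 [b' i, x] < e" by blast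
  qed (rule b')
  moreover have "code L N b = code L M b'"
  proof -
    have "predc L N i (map b js) = predc L M i (map b' js)" for i js
      using gp[of "map b' js" i] b' by (simp add: comp_def image_subset_iff)
    then show ?thesis by (simp add: code_pullback pullback_def fun_eq_iff)
  qed
  ultimately show ?thesis by blast
qed

section \<open>Measurability\<close>

text \<open>Coordinatewise measurability yields Borel measurability of a map into a countable
  product when the factors are second countable.\<close>

instance bool :: second_countable_topology
proof
  have "open = generate_topology (UNIV :: bool set set)"
    by (auto simp: fun_eq_iff open_discrete intro: generate_topology.Basis)
  then show "\<exists>B::bool set set. countable B \<and> open = generate_topology B"
    by (metis countable_finite finite)
qed

definition fo_sig :: fo_signature where
  "fo_sig = \<lparr>rel_symbols = UNIV,
     rel_arity = (\<lambda>r. case from_nat r :: (nat \<times> frm \<times> rat \<times> rat) + (nat list \<times> rat) of Inl _ \<Rightarrow> 1 | Inr _ \<Rightarrow> 2),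
     fun_symbols = {}, fun_arity = (\<lambda>_. 0)\<rparr>"

definition fo_str :: "nat preds \<Rightarrow> fo_structure" where
  "fo_str \<xi> = (coded_rel UNIV \<xi> id, \<lambda>_ _. 0)"

lemma coded_rel_arity: "coded_rel S P a r xs \<Longrightarrow> length xs = rel_arity fo_sig r"
  by (auto simp: coded_rel_def fo_sig_def split: sum.splits)

lemma fo_str_in: "fo_str \<xi> \<in> fo_structures fo_sig"
  using coded_rel_arity[of UNIV \<xi> id] by (auto simp: fo_structures_def fo_str_def) (auto simp: fo_sig_def)

lemma fo_isomorphic_iff:
  "fo_isomorphic fo_sig (fo_str \<xi>) (fo_str \<eta>) \<longleftrightarrow>
     (\<exists>h. bij h \<and> (\<forall>r xs. coded_rel UNIV \<eta> id r (map h xs) = coded_rel UNIV \<xi> id r xs))"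
proof -
  have "coded_rel UNIV \<eta> id r (map h xs) = coded_rel UNIV \<xi> id r xs" if "length xs \<noteq> rel_arity fo_sig r" for r xs and h :: "nat \<Rightarrow> nat"
    using that coded_rel_arity[of UNIV \<xi> id r xs] coded_rel_arity[of UNIV \<eta> id r "map h xs"] by auto
  then have "(\<forall>r xs. coded_rel UNIV \<eta> id r (map h xs) = coded_rel UNIV \<xi> id r xs) \<longleftrightarrow>
      (\<forall>r xs. length xs = rel_arity fo_sig r \<longrightarrow> coded_rel UNIV \<eta> id r (map h xs) = coded_rel UNIV \<xi> id r xs)" for h :: "nat \<Rightarrow> nat"
    by blast
  then show ?thesis
    by (simp add: fo_isomorphic_def fo_str_def) (simp add: fo_sig_def)
qed

abbreviation code_space :: "nat preds measure" where
  "code_space \<equiv> borel"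

lemma coord_measurable [measurable]: "(\<lambda>\<xi>. \<xi> i js) \<in> borel_measurable code_space"
proof -
  have "(\<lambda>\<xi>. \<xi> i) \<in> borel_measurable (code_space)"
    by (rule borel_measurable_continuous_onI) simp
  moreover have "(\<lambda>f. f js) \<in> borel_measurable (borel :: (nat list \<Rightarrow> real) measure)"
    by (rule borel_measurable_continuous_onI) simp
  ultimately show ?thesis by (rule measurable_compose)
qed

lemma tb_ball_measurable [measurable]: "Measurable.pred code_space (\<lambda>\<xi>. tb_ball UNIV \<xi> i r)"
proof -
  have *: "tb_ball UNIV \<xi> i r \<longleftrightarrow> (\<forall>n::nat. \<exists>F::nat list. \<forall>y. \<xi> 0 [i, y] < r \<longrightarrow>
     (\<exists>k<length F. \<xi> 0 [F ! k, y] < 1 / real (Suc n)))" for \<xi> :: "nat preds"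
    unfolding tb_ball_def by (simp add: Bex_def in_set_conv_nth) metis
  show ?thesis unfolding * by measurable
qed

lemma radius_measurable [measurable]: "(\<lambda>\<xi>. radius UNIV \<xi> i) \<in> borel_measurable code_space"
  unfolding radius_def
proof (rule borel_measurable_cSUP)
  show "bdd_above ((\<lambda>r. if tb_ball UNIV \<xi> i (of_rat r) then of_rat r else 0::real) ` {0..1})" for \<xi> :: "nat preds"
    by (rule radius_bdd)
qed (auto simp: countable_subset)

lemma val_measurable [measurable]: "(\<lambda>\<xi>. val UNIV \<xi> \<phi> js) \<in> borel_measurable code_space"
proof (induction \<phi> arbitrary: js)
  case (FInf \<phi>)
  note [measurable] = FInf
  show ?case unfolding val.simps by (rule borel_measurable_cINF_real) auto
next
  case (FNeg \<phi>)
  note [measurable] = FNeg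
  show ?case unfolding val.simps by measurable
next
  case (FMax \<phi> \<psi>)
  note [measurable] = FMax
  show ?case unfolding val.simps by measurable
next
  case (FShift q \<phi>)
  note [measurable] = FShift
  show ?case unfolding val.simps by measurable
qed auto

lemma sat_measurable [measurable]: "Measurable.pred code_space (\<lambda>\<xi>. js \<in> sat UNIV \<xi> \<phi> q)"
  unfolding sat_def by simp

lemma linked_measurable [measurable]: "Measurable.pred code_space (\<lambda>\<xi>. list_all2 (linked UNIV \<xi> s) js ks)"
  unfolding list_all2_conv_all_nth linked_def by measurable

lemma near_measurable [measurable]: "Measurable.pred code_space (\<lambda>\<xi>. near \<xi> e js ks)"
  unfolding near_nth by measurable

text \<open>A chain of index tuples is a finite sequence from a countable set, so the closure is a
  countable union of iterates of a measurable relation.\<close>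

lemma chained_measurable [measurable]: "Measurable.pred code_space (\<lambda>\<xi>. chained UNIV \<xi> s (sat UNIV \<xi> \<phi> q) js ks)"
proof -
  define R where "R \<xi> = (\<lambda>u v. u \<in> sat UNIV \<xi> \<phi> q \<and> v \<in> sat UNIV \<xi> \<phi> q \<and> list_all2 (linked UNIV \<xi> s) u v)" for \<xi> :: "nat preds"
  have [measurable]: "Measurable.pred code_space (\<lambda>\<xi>. R \<xi> u v)" for u v unfolding R_def by measurable
  have "Measurable.pred code_space (\<lambda>\<xi>. (R \<xi> ^^ n) js ks)" for n
  proof (induction n arbitrary: ks)
    case (Suc n)
    note [measurable] = Suc
    have *: "(R \<xi> ^^ Suc n) js ks \<longleftrightarrow> (\<exists>z. (R \<xi> ^^ n) js z \<and> R \<xi> z ks)" for \<xi> by auto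
    show ?case unfolding * by measurable
  qed simp
  note [measurable] = this
  have *: "chained UNIV \<xi> s (sat UNIV \<xi> \<phi> q) js ks \<longleftrightarrow> (\<exists>n. (R \<xi> ^^ n) js ks)" for \<xi>
    unfolding chained_def R_def[symmetric] by (simp add: rtranclp_power)
  show ?thesis unfolding * by measurable
qed

lemma coded_rel_measurable: "Measurable.pred code_space (\<lambda>\<xi>. coded_rel UNIV \<xi> id r xs)"
proof (cases "from_nat r :: (nat \<times> frm \<times> rat \<times> rat) + (nat list \<times> rat)")
  case (Inl l)
  show ?thesis
  proof (cases "\<exists>x. xs = [x]")
    case True
    then obtain x where x: "xs = [x]" by blast
    obtain \<phi> q s js where d: "decode x = (\<phi>, q, s, js)" by (metis prod_cases4)
    have *: "coded_rel UNIV \<xi> id r xs \<longleftrightarrow> 0 < s \<and> val UNIV \<xi> \<phi> js < of_rat q \<and> (length js, \<phi>, q, s) = l" for \<xi>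
      by (cases l rule: prod_cases4) (auto simp: coded_rel_def Inl x comp_of_def d)
    show ?thesis unfolding * by measurable
  qed (simp add: coded_rel_def Inl split: prod.splits)
next
  case (Inr p)
  obtain I e where p: "p = (I, e)" by (cases p)
  show ?thesis
  proof (cases "\<exists>x y. xs = [x, y]")
    case True
    then obtain x y where x: "xs = [x, y]" by blast
    obtain \<phi> q s js where d: "decode x = (\<phi>, q, s, js)" by (metis prod_cases4)
    obtain \<phi>' q' s' js' where d': "decode y = (\<phi>', q', s', js')" by (metis prod_cases4)
    have *: "coded_rel UNIV \<xi> id r xs \<longleftrightarrow> (0 < s \<and> 0 < s' \<and> set I \<subseteq> {..<length js} \<and> length I \<le> length js') \<and>
      val UNIV \<xi> \<phi> js < of_rat q \<and> val UNIV \<xi> \<phi>' js' < of_rat q' \<and>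
      (\<forall>v. chained UNIV \<xi> (of_rat s) (sat UNIV \<xi> \<phi> q) js v \<longrightarrow> (\<forall>t. e < t \<longrightarrow>
        (\<exists>w. chained UNIV \<xi> (of_rat s') (sat UNIV \<xi> \<phi>' q') js' w \<and> near \<xi> (of_rat t) (map (nth v) I) (take (length I) w))))" for \<xi>
      by (auto simp: coded_rel_def Inr p x comp_of_def d d' covered_def)
    show ?thesis unfolding * by measurable
  qed (simp add: coded_rel_def Inr p)
qed

lemma fo_str_measurable: "fo_str \<in> borel_measurable code_space"
proof -
  have "(\<lambda>\<xi>. coded_rel UNIV \<xi> id) \<in> borel_measurable code_space"
  proof (intro measurable_coordinatewise_then_product)
    fix r xs
    have "(\<lambda>\<xi>. coded_rel UNIV \<xi> id r xs) \<in> measurable code_space (count_space UNIV)" by (rule coded_rel_measurable)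
    then show "(\<lambda>\<xi>. coded_rel UNIV \<xi> id r xs) \<in> borel_measurable code_space"
      by (rule measurable_compose) simp
  qed
  then show ?thesis unfolding fo_str_def[abs_def] by (intro borel_measurable_Pair) auto
qed

section \<open>Isomorphism of models against isomorphism of component structures\<close>

lemma (in iso_pair) isomorphic_structures:
  "\<exists>g. bij_betw g S S' \<and> (\<forall>i. \<forall>xs\<in>lists S. P' i (map g xs) = P i xs)"
proof -
  obtain z where z: "\<And>i. z i \<in> S'" and el: "\<And>n \<phi>. val S' P' \<phi> (map z [0..<n]) = val S P \<phi> (map a [0..<n])"
    and d: "\<And>y e. y \<in> S' \<Longrightarrow> 0 < e \<Longrightarrow> \<exists>i. P' 0 [z i, y] < e"
    using dense_elementary_sequence by blast
  have eq: "P i (map a js) = P' i (map z js)" for i js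
  proof -
    define n where "n = Suc (Max (insert 0 (set js)))"
    have n: "j < n" if "j \<in> set js" for j using that by (simp add: n_def less_Suc_eq_le)
    have "map ((!) (map a [0..<n])) js = map a js" "map ((!) (map z [0..<n])) js = map z js"
      using n by auto
    then show ?thesis using el[of "FAtom i js" n] n by (simp del: map_eq_conv)
  qed
  show ?thesis
    by (rule iso_of_dense[OF A.complete_preds_axioms B.complete_preds_axioms A.a_S A.a_dense z d eq])
qed

theorem theorem4p6:
  fixes L :: signature and F :: "fml set" and T :: "(fml \<times> real) set"
  assumes "is_signature L"
    and "is_fragment L F"
    and "is_theory F T"
    and "\<And>M :: real mstruct. is_model L T M \<Longrightarrow> locally_compact_space (structure_topology M)"
  shows "classifiable_by_countable_structures (Mod L T) (iso_codes L)"
proof -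
  note L = assms(1)
  have "fo_str \<in> restrict_space borel (Mod L T) \<rightarrow>\<^sub>M restrict_space borel (fo_structures fo_sig)"
    by (intro measurable_restrict_space1 measurable_restrict_space2 fo_str_measurable)
       (simp add: fo_str_in)
  moreover have "iso_codes L \<xi> \<eta> \<longleftrightarrow> fo_isomorphic fo_sig (fo_str \<xi>) (fo_str \<eta>)"
    if "\<xi> \<in> Mod L T" "\<eta> \<in> Mod L T" for \<xi> \<eta>
  proof -
    obtain M :: "real mstruct" and a where M: "is_model L T M" "tail_dense M a" and \<xi>: "\<xi> = code L M a"
      using \<open>\<xi> \<in> Mod L T\<close> unfolding Mod_def by blast
    obtain N :: "real mstruct" and b where N: "is_model L T N" "tail_dense N b" and \<eta>: "\<eta> = code L N b"
      using \<open>\<eta> \<in> Mod L T\<close> unfolding Mod_def by blast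
    have sM: "is_structure L M" and sN: "is_structure L N" using M(1) N(1) by (simp_all add: is_model_def)
    interpret A: dense_preds "univ M" "predc L M" a by (rule model_dense_preds[OF L sM assms(4)[OF M(1)] M(2)])
    interpret B: dense_preds "univ N" "predc L N" b by (rule model_dense_preds[OF L sN assms(4)[OF N(1)] N(2)])
    show ?thesis
    proof
      assume "iso_codes L \<xi> \<eta>"
      then obtain M' :: "real mstruct" and a' and N' :: "real mstruct" and b' where
        M': "is_structure L M'" "tail_dense M' a'" "\<xi> = code L M' a'" and
        N': "is_structure L N'" "tail_dense N' b'" "\<eta> = code L N' b'" and iso: "isomorphic L M' N'"
        unfolding iso_codes_def by blast
      have "isomorphic L M M'" by (rule isomorphic_of_code[OF L sM M(2) M'(1,2)]) (use \<xi> M'(3) in simp)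
      moreover have "isomorphic L N' N" by (rule isomorphic_of_code[OF L N'(1,2) sN N(2)]) (use \<eta> N'(3) in simp)
      ultimately have "isomorphic L M N" using iso isomorphic_trans by blast
      \<comment> \<open>From here on both codes come from dense sequences of the one structure
        \<open>M\<close>.\<close>
      from isomorphic_transport[OF L this A.dense_preds_axioms B.dense_preds_axioms]
      obtain c where c: "dense_preds (univ M) (predc L M) c" "\<eta> = code L M c" unfolding \<eta> by blast
      from coded_rel_same[OF A.dense_preds_axioms c(1)] show "fo_isomorphic fo_sig (fo_str \<xi>) (fo_str \<eta>)"
        unfolding fo_isomorphic_iff \<xi> c(2) code_pullback A.coded_rel_pullback dense_preds.coded_rel_pullback[OF c(1)] .
    next
      assume "fo_isomorphic fo_sig (fo_str \<xi>) (fo_str \<eta>)"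
      then obtain h where "bij h" "\<And>r xs. coded_rel (univ N) (predc L N) b r (map h xs) = coded_rel (univ M) (predc L M) a r xs"
        unfolding fo_isomorphic_iff \<xi> \<eta> code_pullback A.coded_rel_pullback B.coded_rel_pullback by blast
      then interpret iso_pair "univ M" "predc L M" a "univ N" "predc L N" b h
        by unfold_locales
      obtain g where "bij_betw g (univ M) (univ N)"
        "\<And>i xs. xs \<in> lists (univ M) \<Longrightarrow> predc L N i (map g xs) = predc L M i xs"
        using isomorphic_structures by blast
      then have "isomorphic L M N" by (rule isomorphicI)
      then show "iso_codes L \<xi> \<eta>" unfolding iso_codes_def using sM M(2) \<xi> sN N(2) \<eta> by blast
    qed
  qed
  ultimately show ?thesis unfolding classifiable_by_countable_structures_def by blast
qed

end
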